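(* Let $\mathcal K$ be a Fra\"{\i}ss\'{e} class of finite ordered binary relational structures with the Ramsey property and let $T$ be an $\mathbf{F_{\max}}$-tree. For every type $\tau$ of a finite induced substructure of $\mathbf{F_{\max}}$ and every continuous coloring $c:\binom{\mathbf{F(T)}}{\tau}\to2$, there is an $\mathbf{F_{\max}}$-subtree $S$ of $T$ such that $c$ is monochromatic on $\binom{\mathbf{F(S)}}{\tau}$.
   Context: Setting: $L=\{<,R_0,\dots,R_{k-1}\}$ with binary $R_\ell$; $\mathcal K$ a Fra\"{\i}ss\'{e} class (hereditary, joint embedding, amalgamation, countably many isomorphism types, arbitrarily large members) with the Ramsey property (for $\mathbf A\le\mathbf B$ in $\mathcal K$, $l\ge2$, some $\mathbf C\in\mathcal K$ has every $l$-coloring of its copies of $\mathbf A$ constant on the copies of $\mathbf A$ in some copy of $\mathbf B$). $\mathrm{Flim}(\mathcal K)$ on $\omega$; $\mathrm{Flim}(\mathcal K)_n$ its restriction to $\{0,\dots,n\}$. Trees: $\omega^{<\omega}$ with initial segments; $|s|$; $\mathrm{succ}_T(t)$; $[T]$ infinite branches; $x\cap y$ longest common initial segment of distinct branches. $T_{\max}$: $\mathrm{succ}_{T_{\max}}(t)=\{t^\frown\langle0\rangle,\dots,t^\frown\langle|t|\rangle\}$. Fixed $\mathbf{F_t}\in\mathcal K$ on $\mathrm{succ}_{T_{\max}}(t)$ (lexicographic order) isomorphic to $\mathrm{Flim}(\mathcal K)_{|t|}$. $\mathbf{F_{\max}}$ on $[T_{\max}]$ ordered lexicographically, $(x,y)\in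 R_\ell$ for distinct $x,y$ iff $(x\upharpoonright(|x\cap y|+1),y\upharpoonright(|x\cap y|+1))\in R_\ell^{\mathbf{F_{x\cap y}}}$. For a subtree $T$: $\mathbf{F^T_t}$ the induced substructure of $\mathbf{F_t}$ on $\mathrm{succ}_T(t)$; $\mathbf{F(T)}$ the induced substructure of $\mathbf{F_{\max}}$ on $[T]$. $\mathbf{F_{\max}}$-tree: subtree $T\subseteq T_{\max}$ such that for all $\mathbf F\in\mathcal K$, $t\in T$ there is $s\supseteq t$ in $T$ with $\mathbf F$ embedding in $\mathbf{F^T_s}$; $\mathbf{F_{\max}}$-subtree of $T$: an $\mathbf{F_{\max}}$-tree contained in $T$. Types: strong isomorphism classes of finite induced substructures of $\mathbf{F_{\max}}$, where an isomorphism $\varphi$ is strong if $|x_0\cap y_0|\le|x_1\cap y_1|\iff|\varphi(x_0)\cap\varphi(y_0)|\le|\varphi(x_1)\cap\varphi(y_1)|$ for all 2-subsets. $\binom{\mathbf{F(T)}}{\tau}$: induced substructures of $\mathbf{F(T)}$ of type $\tau$. Topology: on $n$-element induced substructures of $\mathbf{F_{\max}}$, $\mathcal U$ is open iff every member has open neighborhoods $U_1,\dots,U_n$ (in $[T_{\max}]\subseteq\omega^\omega$) of its elements such that every $n$-element induced substructure with exactly one element in each $U_i$ is in $\mathcal U$; subsets get the subspace topology.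
   Formalization: Added: all one-point members of K are isomorphic (loops carry no information; without it, linear orders with a unary predicate coded by loops are a counterexample). In the topology the neighborhoods U_1,…,U_n are taken pairwise disjoint, as otherwise every coloring is continuous for n≥2. *)

theory Defs
  imports "HOL-Analysis.Analysis" "HOL-Library.Ramsey" "HOL-Library.Sublist"
begin

section \<open>Ordered binary relational structures\<close>

text \<open>The signature consists of an order symbol and binary relation symbols indexed by the
  natural numbers below a parameter \<open>k\<close>; the field \<open>rel\<close> is irrelevant at
  indices \<open>l \<ge> k\<close>.\<close>

record 'a ostruct =
  univ :: "'a set"
  lt :: "('a \<times> 'a) set"
  rel :: "nat \<Rightarrow> ('a \<times> 'a) set"

definition ordered_structure :: "nat \<Rightarrow> 'a ostruct \<Rightarrow> bool" where
  "ordered_structure k A \<longleftrightarrow>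
     univ A \<noteq> {} \<and>
     lt A \<subseteq> univ A \<times> univ A \<and> strict_linear_order_on (univ A) (lt A) \<and>
     (\<forall>l<k. rel A l \<subseteq> univ A \<times> univ A)"

definition induced :: "'a ostruct \<Rightarrow> 'a set \<Rightarrow> 'a ostruct" where
  "induced A X =
     \<lparr>univ = univ A \<inter> X, lt = lt A \<inter> X \<times> X, rel = (\<lambda>l. rel A l \<inter> X \<times> X)\<rparr>"

definition embedding :: "nat \<Rightarrow> ('a \<Rightarrow> 'b) \<Rightarrow> 'a ostruct \<Rightarrow> 'b ostruct \<Rightarrow> bool" where
  "embedding k f A B \<longleftrightarrow>
     inj_on f (univ A) \<and> f ` univ A \<subseteq> univ B \<and>
     (\<forall>x\<in>univ A. \<forall>y\<in>univ A. (x, y) \<in> lt A \<longleftrightarrow> (f x, f y) \<in> lt B) \<and>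
     (\<forall>l<k. \<forall>x\<in>univ A. \<forall>y\<in>univ A. (x, y) \<in> rel A l \<longleftrightarrow> (f x, f y) \<in> rel B l)"

definition isomorphism :: "nat \<Rightarrow> ('a \<Rightarrow> 'b) \<Rightarrow> 'a ostruct \<Rightarrow> 'b ostruct \<Rightarrow> bool" where
  "isomorphism k f A B \<longleftrightarrow> embedding k f A B \<and> f ` univ A = univ B"

definition embeds :: "nat \<Rightarrow> 'a ostruct \<Rightarrow> 'b ostruct \<Rightarrow> bool" where
  "embeds k A B \<longleftrightarrow> (\<exists>f. embedding k f A B)"

definition isomorphic :: "nat \<Rightarrow> 'a ostruct \<Rightarrow> 'b ostruct \<Rightarrow> bool" where
  "isomorphic k A B \<longleftrightarrow> (\<exists>f. isomorphism k f A B)"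


section \<open>Fraisse classes, the Ramsey property, Fraisse limits\<close>

text \<open>A class of finite structures is given by its members with universe a finite set of natural
  numbers. The hereditary property is stated for the embeddability relation, so a class is in
  particular closed under isomorphism.\<close>

definition fraisse_class :: "nat \<Rightarrow> nat ostruct set \<Rightarrow> bool" where
  "fraisse_class k K \<longleftrightarrow>
     (\<forall>A\<in>K. ordered_structure k A \<and> finite (univ A)) \<and>
     (\<forall>B\<in>K. \<forall>A. ordered_structure k A \<and> embeds k A B \<longrightarrow> A \<in> K) \<and>
     (\<forall>A\<in>K. \<forall>B\<in>K. \<exists>C\<in>K. embeds k A C \<and> embeds k B C) \<and>
     (\<forall>A\<in>K. \<forall>B\<in>K. \<forall>C\<in>K. \<forall>f g. embedding k f A B \<and> embedding k g A C \<longrightarrow>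
        (\<exists>D\<in>K. \<exists>r s. embedding k r B D \<and> embedding k s C D \<and>
           (\<forall>a\<in>univ A. r (f a) = s (g a)))) \<and>
     (\<exists>R. countable R \<and> R \<subseteq> K \<and> (\<forall>A\<in>K. \<exists>B\<in>R. isomorphic k A B)) \<and>
     (\<forall>n. \<exists>A\<in>K. n \<le> card (univ A))"

text \<open>Copies of \<open>A\<close> in \<open>C\<close>, each represented by its universe.\<close>

definition copies :: "nat \<Rightarrow> 'b ostruct \<Rightarrow> 'a ostruct \<Rightarrow> 'b set set" where
  "copies k C A = {X. X \<subseteq> univ C \<and> isomorphic k (induced C X) A}"

definition ramsey_property :: "nat \<Rightarrow> nat ostruct set \<Rightarrow> bool" where
  "ramsey_property k K \<longleftrightarrow>
     (\<forall>A\<in>K. \<forall>B\<in>K. embeds k A B \<longrightarrow> (\<forall>l\<ge>(2::nat). \<exists>C\<in>K.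
        \<forall>c. c \<in> copies k C A \<rightarrow> {..<l} \<longrightarrow>
          (\<exists>X\<in>copies k C B. \<exists>i<l. \<forall>Y\<in>copies k C A. Y \<subseteq> X \<longrightarrow> c Y = i)))"

text \<open>Every binary relation of the limit structure on branches defined below is specified on
  pairs of distinct elements only, so loops \<open>(x, x)\<close> are not part of the data recorded by
  types. The following condition says that loops carry no information within the class
  either; it holds in particular if all relations are irreflexive. Without it, unary
  predicates could be coded by loops, and the partition theorem fails, for example for finite
  linear orders with one such predicate.\<close>

definition uniform_loops :: "nat \<Rightarrow> nat ostruct set \<Rightarrow> bool" where
  "uniform_loops k K \<longleftrightarrow>
     (\<forall>A\<in>K. \<forall>B\<in>K. card (univ A) = 1 \<and> card (univ B) = 1 \<longrightarrow> isomorphic k A B)"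

definition ultrahomogeneous :: "nat \<Rightarrow> 'a ostruct \<Rightarrow> bool" where
  "ultrahomogeneous k M \<longleftrightarrow>
     (\<forall>X Y f. finite X \<and> X \<subseteq> univ M \<and> Y \<subseteq> univ M \<and>
        isomorphism k f (induced M X) (induced M Y) \<longrightarrow>
        (\<exists>h. isomorphism k h M M \<and> (\<forall>x\<in>X. h x = f x)))"

definition fraisse_limit :: "nat \<Rightarrow> nat ostruct set \<Rightarrow> nat ostruct \<Rightarrow> bool" where
  "fraisse_limit k K M \<longleftrightarrow>
     ordered_structure k M \<and> univ M = UNIV \<and> ultrahomogeneous k M \<and>
     (\<forall>A. ordered_structure k A \<and> finite (univ A) \<longrightarrow> (A \<in> K \<longleftrightarrow> embeds k A M))"


section \<open>Trees and branches\<close>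

definition is_tree :: "nat list set \<Rightarrow> bool" where
  "is_tree T \<longleftrightarrow> T \<noteq> {} \<and> (\<forall>t\<in>T. \<forall>s. prefix s t \<longrightarrow> s \<in> T)"

definition tsucc :: "nat list set \<Rightarrow> nat list \<Rightarrow> nat list set" where
  "tsucc T t = {s \<in> T. \<exists>i. s = t @ [i]}"

inductive_set Tmax :: "nat list set" where
  "[] \<in> Tmax"
| "t \<in> Tmax \<Longrightarrow> i \<le> length t \<Longrightarrow> t @ [i] \<in> Tmax"

definition restr :: "(nat \<Rightarrow> nat) \<Rightarrow> nat \<Rightarrow> nat list" where
  "restr x n = map x [0..<n]"

definition branches :: "nat list set \<Rightarrow> (nat \<Rightarrow> nat) set" where
  "branches T = {x. \<forall>n. restr x n \<in> T}"

text \<open>The longest common initial segment; only meaningful for distinct arguments.\<close>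

definition meet :: "(nat \<Rightarrow> nat) \<Rightarrow> (nat \<Rightarrow> nat) \<Rightarrow> nat list" where
  "meet x y = restr x (LEAST n. x n \<noteq> y n)"


section \<open>The structure on the branches of the maximal tree\<close>

definition node_structures ::
  "nat \<Rightarrow> nat ostruct set \<Rightarrow> nat ostruct \<Rightarrow> (nat list \<Rightarrow> nat list ostruct) \<Rightarrow> bool" where
  "node_structures k K M F \<longleftrightarrow>
     (\<forall>t\<in>Tmax. ordered_structure k (F t) \<and>
        univ (F t) = tsucc Tmax t \<and>
        lt (F t) = lexord less_than \<inter> tsucc Tmax t \<times> tsucc Tmax t \<and>
        (\<exists>A\<in>K. isomorphic k (F t) A) \<and>
        isomorphic k (F t) (induced M {0..length t}))"

definition Fmax :: "(nat list \<Rightarrow> nat list ostruct) \<Rightarrow> (nat \<Rightarrow> nat) ostruct" where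
  "Fmax F =
     \<lparr>univ = branches Tmax,
      lt = {(x, y). x \<in> branches Tmax \<and> y \<in> branches Tmax \<and>
                    (\<exists>n. (\<forall>m<n. x m = y m) \<and> x n < y n)},
      rel = (\<lambda>l. {(x, y). x \<in> branches Tmax \<and> y \<in> branches Tmax \<and> x \<noteq> y \<and>
                    (restr x (length (meet x y) + 1), restr y (length (meet x y) + 1))
                      \<in> rel (F (meet x y)) l})\<rparr>"

definition Fmax_tree ::
  "nat \<Rightarrow> nat ostruct set \<Rightarrow> (nat list \<Rightarrow> nat list ostruct) \<Rightarrow> nat list set \<Rightarrow> bool" where
  "Fmax_tree k K F T \<longleftrightarrow>
     is_tree T \<and> T \<subseteq> Tmax \<and>
     (\<forall>A\<in>K. \<forall>t\<in>T. \<exists>s\<in>T. prefix t s \<and> embeds k A (induced (F s) (tsucc T s)))"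


section \<open>Types\<close>

text \<open>Finite induced substructures of \<open>Fmax F\<close> are represented by their universes.\<close>

definition strong_isomorphism ::
  "nat \<Rightarrow> (nat list \<Rightarrow> nat list ostruct) \<Rightarrow> ((nat \<Rightarrow> nat) \<Rightarrow> (nat \<Rightarrow> nat)) \<Rightarrow>
     (nat \<Rightarrow> nat) set \<Rightarrow> (nat \<Rightarrow> nat) set \<Rightarrow> bool" where
  "strong_isomorphism k F p X Y \<longleftrightarrow>
     isomorphism k p (induced (Fmax F) X) (induced (Fmax F) Y) \<and>
     (\<forall>x0\<in>X. \<forall>y0\<in>X. \<forall>x1\<in>X. \<forall>y1\<in>X. x0 \<noteq> y0 \<and> x1 \<noteq> y1 \<longrightarrow>
        (length (meet x0 y0) \<le> length (meet x1 y1) \<longleftrightarrow>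
         length (meet (p x0) (p y0)) \<le> length (meet (p x1) (p y1))))"

definition strong_iso_rel ::
  "nat \<Rightarrow> (nat list \<Rightarrow> nat list ostruct) \<Rightarrow> nat \<Rightarrow>
     ((nat \<Rightarrow> nat) set \<times> (nat \<Rightarrow> nat) set) set" where
  "strong_iso_rel k F n =
     {(X, Y). X \<in> [branches Tmax]\<^bsup>n\<^esup> \<and> Y \<in> [branches Tmax]\<^bsup>n\<^esup> \<and>
              (\<exists>p. strong_isomorphism k F p X Y)}"

text \<open>Strong isomorphisms are bijections, so the types of finite induced substructures are
  obtained separately for each cardinality \<open>n\<close>.\<close>

definition types ::
  "nat \<Rightarrow> (nat list \<Rightarrow> nat list ostruct) \<Rightarrow> nat \<Rightarrow> (nat \<Rightarrow> nat) set set set" where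
  "types k F n = [branches Tmax]\<^bsup>n\<^esup> // strong_iso_rel k F n"

definition of_type :: "nat list set \<Rightarrow> (nat \<Rightarrow> nat) set set \<Rightarrow> (nat \<Rightarrow> nat) set set" where
  "of_type T \<tau> = {X \<in> \<tau>. X \<subseteq> branches T}"

lemma strong_isomorphism_id:
  assumes "X \<subseteq> branches Tmax"
  shows "strong_isomorphism k F id X X"
  using assms
  by (auto simp: strong_isomorphism_def isomorphism_def embedding_def induced_def Fmax_def)

lemma strong_isomorphism_comp:
  assumes "strong_isomorphism k F p X Y" "strong_isomorphism k F q Y Z"
    "X \<subseteq> branches Tmax" "Y \<subseteq> branches Tmax" "Z \<subseteq> branches Tmax"
  shows "strong_isomorphism k F (q \<circ> p) X Z"
proof -
  have u: "univ (induced (Fmax F) W) = W" if "W \<subseteq> branches Tmax" for W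
    using that by (auto simp: induced_def Fmax_def)
  have p: "inj_on p X" "p ` X = Y" and q: "inj_on q Y" "q ` Y = Z"
    using assms by (auto simp: strong_isomorphism_def isomorphism_def embedding_def u)
  have "p x \<in> Y" if "x \<in> X" for x using p that by blast
  moreover have "p x \<noteq> p y" if "x \<in> X" "y \<in> X" "x \<noteq> y" for x y
    using p that by (auto dest: inj_onD)
  moreover have "inj_on (q \<circ> p) X" using p q comp_inj_on by blast
  moreover have "(q \<circ> p) ` X = Z" using p q by (auto simp: image_comp[symmetric])
  ultimately show ?thesis
    using assms unfolding strong_isomorphism_def isomorphism_def embedding_def
    by (simp add: u)
qed

lemma strong_isomorphism_inv:
  assumes "strong_isomorphism k F p X Y" "X \<subseteq> branches Tmax" "Y \<subseteq> branches Tmax"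
  shows "strong_isomorphism k F (inv_into X p) Y X"
proof -
  have u: "univ (induced (Fmax F) W) = W" if "W \<subseteq> branches Tmax" for W
    using that by (auto simp: induced_def Fmax_def)
  have p: "inj_on p X" "p ` X = Y"
    using assms by (auto simp: strong_isomorphism_def isomorphism_def embedding_def u)
  define q where "q = inv_into X p"
  have q1: "q y \<in> X" "p (q y) = y" if "y \<in> Y" for y
    using that p unfolding q_def by (auto simp: inv_into_into f_inv_into_f)
  have q2: "inj_on q Y" using q1 by (metis inj_onI)
  have q3: "q ` Y = X" using p unfolding q_def by (metis inv_into_image_cancel subset_refl)
  have q4: "q x \<noteq> q y" if "x \<in> Y" "y \<in> Y" "x \<noteq> y" for x y
    using q1 that by metis
  show ?thesis
    unfolding q_def[symmetric]
    using assms unfolding strong_isomorphism_def isomorphism_def embedding_def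
    by (simp add: u q1 q2 q3 q4)
qed

lemma equiv_strong_iso_rel: "equiv ([branches Tmax]\<^bsup>n\<^esup>) (strong_iso_rel k F n)"
proof (rule equivI)
  show "strong_iso_rel k F n \<subseteq> [branches Tmax]\<^bsup>n\<^esup> \<times> [branches Tmax]\<^bsup>n\<^esup>"
    by (auto simp: strong_iso_rel_def)
  show "refl_on ([branches Tmax]\<^bsup>n\<^esup>) (strong_iso_rel k F n)"
    by (rule refl_onI) (auto simp: strong_iso_rel_def nsets_def intro: strong_isomorphism_id)
  show "sym (strong_iso_rel k F n)"
    by (rule symI) (auto simp: strong_iso_rel_def nsets_def dest: strong_isomorphism_inv)
  show "trans (strong_iso_rel k F n)"
    by (rule transI) (auto simp: strong_iso_rel_def nsets_def dest: strong_isomorphism_comp)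
qed


section \<open>The topology on \<open>n\<close>-element substructures\<close>

text \<open>The neighbourhoods are required to be pairwise disjoint. Otherwise, one could take them all
  equal to the whole space, and for \<open>n \<ge> 2\<close> no set would have exactly one element in each
  of them, so that every set would be open.\<close>

definition nset_open :: "nat \<Rightarrow> (nat \<Rightarrow> nat) set set \<Rightarrow> bool" where
  "nset_open n U \<longleftrightarrow>
     U \<subseteq> [branches Tmax]\<^bsup>n\<^esup> \<and>
     (\<forall>X\<in>U. \<exists>V.
        (\<forall>x\<in>X. x \<in> V x \<and> openin (top_of_set (branches Tmax)) (V x)) \<and>
        disjoint_family_on V X \<and>
        (\<forall>Y\<in>[branches Tmax]\<^bsup>n\<^esup>. (\<forall>x\<in>X. \<exists>!y. y \<in> Y \<inter> V x) \<longrightarrow> Y \<in> U))"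

definition nset_topology :: "nat \<Rightarrow> (nat \<Rightarrow> nat) set topology" where
  "nset_topology n = topology (nset_open n)"

lemma nset_open_Int_aux:
  assumes Y: "Y \<in> [B]\<^bsup>n\<^esup>" and X: "X \<in> [B]\<^bsup>n\<^esup>"
    and V: "disjoint_family_on V X"
    and W: "\<And>x. x \<in> X \<Longrightarrow> W x \<subseteq> V x" and ex: "\<forall>x\<in>X. \<exists>!y. y \<in> Y \<inter> W x"
  shows "\<forall>x\<in>X. \<exists>!y. y \<in> Y \<inter> V x"
proof -
  have "\<forall>x\<in>X. \<exists>y. y \<in> Y \<inter> W x"
    using ex by (auto dest: ex1_implies_ex)
  from bchoice[OF this] obtain g where g: "\<And>x. x \<in> X \<Longrightarrow> g x \<in> Y \<inter> W x"
    by auto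
  have gV: "g x \<in> V x" if "x \<in> X" for x using g W that by blast
  have uniq: "x = z" if "x \<in> X" "z \<in> X" "y \<in> V x" "y \<in> V z" for x z y
    using V that by (auto simp: disjoint_family_on_def)
  have "inj_on g X"
    by (rule inj_onI) (metis gV uniq)
  then have "card (g ` X) = card Y"
    using X Y by (simp add: nsets_def card_image)
  moreover have "g ` X \<subseteq> Y" "finite Y"
    using g Y by (auto simp: nsets_def)
  ultimately have eq: "g ` X = Y"
    by (simp add: card_subset_eq)
  show ?thesis
  proof
    fix x assume x: "x \<in> X"
    show "\<exists>!y. y \<in> Y \<inter> V x"
    proof (rule ex1I)
      show "g x \<in> Y \<inter> V x" using g gV x by blast
      fix y assume y: "y \<in> Y \<inter> V x"
      then obtain z where "z \<in> X" "y = g z" using eq by blast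
      then show "y = g x" using uniq gV x y by blast
    qed
  qed
qed

lemma nset_openE:
  assumes "nset_open n U" "X \<in> U"
  obtains V where "\<forall>x\<in>X. x \<in> V x \<and> openin (top_of_set (branches Tmax)) (V x)"
    "disjoint_family_on V X"
    "\<forall>Y\<in>[branches Tmax]\<^bsup>n\<^esup>. (\<forall>x\<in>X. \<exists>!y. y \<in> Y \<inter> V x) \<longrightarrow> Y \<in> U"
proof -
  note bspec[OF conjunct2[OF assms(1)[unfolded nset_open_def]] assms(2)]
  then show ?thesis
    by (elim exE conjE) (rule that)
qed

lemma istopology_nset_open: "istopology (nset_open n)"
  unfolding istopology_def
proof (intro conjI allI impI)
  fix U U' assume U: "nset_open n U" and U': "nset_open n U'"
  have "\<exists>V. (\<forall>x\<in>X. x \<in> V x \<and> openin (top_of_set (branches Tmax)) (V x)) \<and>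
        disjoint_family_on V X \<and>
        (\<forall>Y\<in>[branches Tmax]\<^bsup>n\<^esup>. (\<forall>x\<in>X. \<exists>!y. y \<in> Y \<inter> V x) \<longrightarrow> Y \<in> U \<inter> U')"
    if XU: "X \<in> U \<inter> U'" for X
  proof -
    have X: "X \<in> [branches Tmax]\<^bsup>n\<^esup>" using that U by (auto simp: nset_open_def)
    obtain V where V: "\<forall>x\<in>X. x \<in> V x \<and> openin (top_of_set (branches Tmax)) (V x)"
      "disjoint_family_on V X"
      "\<forall>Y\<in>[branches Tmax]\<^bsup>n\<^esup>. (\<forall>x\<in>X. \<exists>!y. y \<in> Y \<inter> V x) \<longrightarrow> Y \<in> U"
      by (rule nset_openE[OF U IntD1[OF XU]])
    obtain V' where V': "\<forall>x\<in>X. x \<in> V' x \<and> openin (top_of_set (branches Tmax)) (V' x)"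
      "disjoint_family_on V' X"
      "\<forall>Y\<in>[branches Tmax]\<^bsup>n\<^esup>. (\<forall>x\<in>X. \<exists>!y. y \<in> Y \<inter> V' x) \<longrightarrow> Y \<in> U'"
      by (rule nset_openE[OF U' IntD2[OF XU]])
    let ?W = "\<lambda>x. V x \<inter> V' x"
    have "\<forall>x\<in>X. x \<in> ?W x \<and> openin (top_of_set (branches Tmax)) (?W x)"
      using V(1) V'(1) by (simp add: openin_Int)
    moreover have "disjoint_family_on ?W X"
      using V(2) by (auto simp: disjoint_family_on_def)
    moreover have "Y \<in> U \<inter> U'"
      if "Y \<in> [branches Tmax]\<^bsup>n\<^esup>" "\<forall>x\<in>X. \<exists>!y. y \<in> Y \<inter> ?W x" for Y
    proof -
      have "\<forall>x\<in>X. \<exists>!y. y \<in> Y \<inter> V x"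
        by (rule nset_open_Int_aux[OF that(1) X V(2) _ that(2)]) simp
      moreover have "\<forall>x\<in>X. \<exists>!y. y \<in> Y \<inter> V' x"
        by (rule nset_open_Int_aux[OF that(1) X V'(2) _ that(2)]) simp
      ultimately show ?thesis using V(3)[rule_format, OF that(1)] V'(3)[rule_format, OF that(1)] by blast
    qed
    ultimately show ?thesis
      by (intro exI[of _ ?W] conjI ballI impI) (assumption | simp)+
  qed
  moreover have "U \<inter> U' \<subseteq> [branches Tmax]\<^bsup>n\<^esup>"
    using U by (auto simp: nset_open_def)
  ultimately show "nset_open n (U \<inter> U')"
    unfolding nset_open_def by blast
next
  fix \<U> assume a: "\<forall>U\<in>\<U>. nset_open n U"
  show "nset_open n (\<Union>\<U>)"
    unfolding nset_open_def
  proof (intro conjI ballI)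
    show "\<Union>\<U> \<subseteq> [branches Tmax]\<^bsup>n\<^esup>" using a by (auto simp: nset_open_def)
    fix X assume "X \<in> \<Union>\<U>"
    then obtain U where U: "U \<in> \<U>" "X \<in> U" by blast
    obtain V where V: "\<forall>x\<in>X. x \<in> V x \<and> openin (top_of_set (branches Tmax)) (V x)"
      "disjoint_family_on V X"
      "\<forall>Y\<in>[branches Tmax]\<^bsup>n\<^esup>. (\<forall>x\<in>X. \<exists>!y. y \<in> Y \<inter> V x) \<longrightarrow> Y \<in> U"
      by (rule nset_openE[OF bspec[OF a U(1)] U(2)])
    show "\<exists>V. (\<forall>x\<in>X. x \<in> V x \<and> openin (top_of_set (branches Tmax)) (V x)) \<and>
        disjoint_family_on V X \<and>
        (\<forall>Y\<in>[branches Tmax]\<^bsup>n\<^esup>. (\<forall>x\<in>X. \<exists>!y. y \<in> Y \<inter> V x) \<longrightarrow> Y \<in> \<Union>\<U>)"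
      by (intro exI[of _ V] conjI V(1,2) ballI impI UnionI[OF U(1)] V(3)[rule_format]) (assumption, simp)
  qed
qed

lemma openin_nset_topology: "openin (nset_topology n) U \<longleftrightarrow> nset_open n U"
  by (simp add: nset_topology_def istopology_nset_open topology_inverse')

end

theory Submission
  imports Defs
begin

text \<open>Induction on the number \<open>n\<close> of branches. In a tree with at most one splitting node on each
  level, the last splitting node of an \<open>n\<close>-element set \<open>X\<close> of the given type is unique; let
  \<open>P \<subseteq> X\<close> be the branches passing through it. If the colour of \<open>X\<close> depends only on \<open>X\<close> with \<open>P\<close>
  replaced by one of its elements, the induction hypothesis applies. To arrange this by a fusion,
  one needs the following step: given incomparable nodes \<open>u0, u1, ..., ud\<close>, shrink the tree above
  each of them so that all sets consisting of a copy of a fixed structure \<open>A\<close> splitting at one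
  node above \<open>u0\<close> and one branch through each of \<open>u1, ..., ud\<close> get the same colour.

  This step has the strength of the Halpern-Laeuchli theorem. Nodes are coded by words, and a
  tuple of words \<open>(s0, s1, ..., sd)\<close> is coloured by the limit, along an ultrafilter on the copies
  of \<open>A\<close> above \<open>s0\<close> whose members contain all copies of \<open>A\<close> inside arbitrarily rich structures (by
  the Ramsey property of \<open>K\<close>), of the colours obtained with branches through \<open>s1, ..., sd\<close>. An
  idempotent ultrafilter on the semigroup of such tuples, each of whose members contains a product
  of one-step splittings, then drives the construction of the subtrees.\<close>

section \<open>Idempotent ultrafilters\<close>

text \<open>Words are used because a finite part of the subtree has many nodes above each of
  \<open>u0, ..., ud\<close>, and an extension has to work for all tuples formed from them.
  Concatenation appends one extension to all of them at once; the nodes of an arbitrary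
  \<open>T\<close> admit no such operation. Since a tuple of words names nodes only, its colour is
  read off from fixed branches through them; by continuity that colour is decided at a finite level,
  and the construction follows the fixed branches up to that level before it splits again. The
  structure containing a good copy of \<open>A\<close> depends on the colouring, so it cannot be
  fixed in advance like the splittings above \<open>u1, ..., ud\<close>: the limit along the
  ultrafilter delays its choice until the finitely many tuples of the other words are known. The
  last splitting is removed, not the first, because the rest of \<open>X\<close> is then separated
  strictly below it, at a level where only finitely many sets of nodes have to be treated. A type
  fixes the structure \<open>A\<close> of the last splitting because loops, which are invisible in
  \<open>Fmax\<close>, are uniform in \<open>K\<close>.\<close>

definition ultra :: "'s set set \<Rightarrow> bool" where
  "ultra p \<longleftrightarrow> {} \<notin> p \<and> (\<forall>A B. A \<in> p \<longrightarrow> A \<subseteq> B \<longrightarrow> B \<in> p) \<and>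
     (\<forall>A\<in>p. \<forall>B\<in>p. A \<inter> B \<in> p) \<and> (\<forall>A. A \<in> p \<or> - A \<in> p)"

lemma ultra_empty: "ultra p \<Longrightarrow> {} \<notin> p"
  and ultra_mono: "ultra p \<Longrightarrow> A \<in> p \<Longrightarrow> A \<subseteq> B \<Longrightarrow> B \<in> p"
  and ultra_Int: "ultra p \<Longrightarrow> A \<in> p \<Longrightarrow> B \<in> p \<Longrightarrow> A \<inter> B \<in> p"
  and ultra_or: "ultra p \<Longrightarrow> A \<in> p \<or> - A \<in> p"
  by (auto simp: ultra_def)

lemma ultra_UNIV: "ultra p \<Longrightarrow> UNIV \<in> p"
  by (metis Compl_empty_eq ultra_empty ultra_or)

lemma ultra_Compl: "ultra p \<Longrightarrow> - A \<in> p \<longleftrightarrow> A \<notin> p"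
  by (metis Compl_disjoint ultra_Int ultra_empty ultra_or)

lemma ultra_Inter:
  assumes "ultra p" "finite \<F>" "\<F> \<subseteq> p"
  shows "\<Inter>\<F> \<in> p"
  using assms(2,3) by (induction \<F> rule: finite_induct) (auto simp: ultra_UNIV ultra_Int assms(1))

lemma ultra_INT:
  "ultra p \<Longrightarrow> finite I \<Longrightarrow> (\<And>i. i \<in> I \<Longrightarrow> A i \<in> p) \<Longrightarrow> (\<Inter>i\<in>I. A i) \<in> p"
  by (rule ultra_Inter) auto

lemma ultra_ex: "ultra p \<Longrightarrow> A \<in> p \<Longrightarrow> \<exists>x. x \<in> A"
  by (metis ex_in_conv ultra_empty)

lemma ultra_subset_eq: "ultra p \<Longrightarrow> ultra q \<Longrightarrow> p \<subseteq> q \<Longrightarrow> p = q"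
  by (metis subsetD subset_antisym subsetI ultra_Compl)

lemma ultra_colour:
  assumes "ultra p" "\<And>s. \<kappa> s < (r::nat)"
  shows "\<exists>i<r. {s. \<kappa> s = i} \<in> p"
proof (rule ccontr)
  assume "\<not> ?thesis"
  then have "- {s. \<kappa> s = i} \<in> p" if "i < r" for i
    using that ultra_Compl[OF assms(1)] by blast
  then have "(\<Inter>i\<in>{..<r}. - {s. \<kappa> s = i}) \<in> p"
    using assms(1) by (intro ultra_INT) auto
  moreover have "(\<Inter>i\<in>{..<r}. - {s. \<kappa> s = i}) = {}"
    using assms(2) by auto
  ultimately show False using ultra_empty[OF assms(1)] by simp
qed

text \<open>Zorn's lemma for families with the finite intersection property. A set outside a maximal
  family is disjoint from some finite intersection of members; if this held for both
  \<open>A\<close> and its complement, two such intersections would be disjoint.\<close>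

lemma ultra_extend:
  assumes fip: "\<And>\<F>. finite \<F> \<Longrightarrow> \<F> \<subseteq> \<B> \<Longrightarrow> \<Inter>\<F> \<noteq> {}"
  shows "\<exists>p. ultra p \<and> \<B> \<subseteq> p"
proof -
  define FIP where "FIP = (\<lambda>\<C> :: 'a set set. \<forall>\<F>. finite \<F> \<and> \<F> \<subseteq> \<C> \<longrightarrow> \<Inter>\<F> \<noteq> {})"
  let ?A = "{\<C>. \<B> \<subseteq> \<C> \<and> FIP \<C>}"
  have "\<exists>M\<in>?A. \<forall>X\<in>?A. M \<subseteq> X \<longrightarrow> X = M"
  proof (rule subset_Zorn_nonempty)
    show "?A \<noteq> {}" using fip by (auto simp: FIP_def)
    fix \<C> assume ne: "\<C> \<noteq> {}" and ch: "subset.chain ?A \<C>"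
    have "FIP (\<Union>\<C>)"
      unfolding FIP_def
    proof (intro allI impI)
      fix \<F> assume "finite \<F> \<and> \<F> \<subseteq> \<Union>\<C>"
      then have "\<exists>X\<in>\<C>. \<F> \<subseteq> X"
        using finite_subset_Union_chain[of \<F> \<C> ?A] ne ch by metis
      then obtain X where "X \<in> \<C>" "\<F> \<subseteq> X" by blast
      moreover have "FIP X" using ch \<open>X \<in> \<C>\<close> by (auto simp: subset.chain_def)
      ultimately show "\<Inter>\<F> \<noteq> {}" using \<open>finite \<F> \<and> _\<close> by (auto simp: FIP_def)
    qed
    moreover have "\<B> \<subseteq> \<Union>\<C>" 
    proof -
      obtain X where "X \<in> \<C>" using ne by blast
      then have "\<B> \<subseteq> X" using ch by (auto simp: subset.chain_def)
      then show ?thesis using \<open>X \<in> \<C>\<close> by blast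
    qed
    ultimately show "\<Union>\<C> \<in> ?A" by simp
  qed
  then obtain M where MA: "M \<in> ?A" and mx: "\<forall>X\<in>?A. M \<subseteq> X \<longrightarrow> X = M" ..
  have M: "\<B> \<subseteq> M" "FIP M" using MA by simp_all
  have max: "X = M" if "\<B> \<subseteq> X" "FIP X" "M \<subseteq> X" for X using mx that by simp
  have ins: "\<exists>\<F>. finite \<F> \<and> \<F> \<subseteq> M \<and> \<Inter>\<F> \<inter> A = {}" if "A \<notin> M" for A
  proof -
    have "\<not> FIP (insert A M)" using max[of "insert A M"] M(1) that by auto
    then obtain \<F> where F: "finite \<F>" "\<F> \<subseteq> insert A M" "\<Inter>\<F> = {}" by (auto simp: FIP_def)
    then show ?thesis by (intro exI[of _ "\<F> - {A}"]) auto
  qed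
  have F2: "A \<inter> B \<noteq> {}" if "A \<in> M" "B \<in> M" for A B
    using M(2)[unfolded FIP_def, rule_format, of "{A, B}"] that by auto
  have F3: "A \<inter> B \<inter> C \<noteq> {}" if "A \<in> M" "B \<in> M" "C \<in> M" for A B C
    using M(2)[unfolded FIP_def, rule_format, of "{A, B, C}"] that by auto
  have or: "A \<in> M \<or> - A \<in> M" for A
  proof (rule ccontr)
    assume "\<not> ?thesis"
    then obtain \<F> \<G> where "finite \<F>" "\<F> \<subseteq> M" "\<Inter>\<F> \<inter> A = {}" "finite \<G>" "\<G> \<subseteq> M" "\<Inter>\<G> \<inter> - A = {}"
      using ins[of A] ins[of "- A"] by blast
    then have "finite (\<F> \<union> \<G>)" "\<F> \<union> \<G> \<subseteq> M" "\<Inter>(\<F> \<union> \<G>) = {}"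
      unfolding Inf_union_distrib by blast+
    then show False using M(2) unfolding FIP_def by blast
  qed
  have "ultra M"
    unfolding ultra_def
  proof (intro conjI allI impI ballI)
    show "{} \<notin> M" using F2 by blast
    show "B \<in> M" if "A \<in> M" "A \<subseteq> B" for A B using or[of B] F2[of A "- B"] that by blast
    show "A \<inter> B \<in> M" if "A \<in> M" "B \<in> M" for A B using or[of "A \<inter> B"] F3[of A B "- (A \<inter> B)"] that by blast
    show "A \<in> M \<or> - A \<in> M" for A by (rule or)
  qed
  then show ?thesis using M(1) by blast
qed

text \<open>The complements of the sets that are good for only finitely many \<open>q\<close> have
  the finite intersection property: otherwise finitely many such sets cover the type, the least
  index of a covering set is a colouring, and some index is a good colour for infinitely many
  \<open>q\<close>. Infinitely many are kept because \<open>q\<close> will index structures of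
  growing richness.\<close>

lemma ultra_infinitely_often:
  fixes good :: "nat \<Rightarrow> 's set \<Rightarrow> bool"
  assumes mono: "\<And>q C D. good q C \<Longrightarrow> C \<subseteq> D \<Longrightarrow> good q D"
    and col: "\<And>q \<kappa> r. (\<And>s. \<kappa> s < (r::nat)) \<Longrightarrow> \<exists>i<r. good q {s. \<kappa> s = i}"
  shows "\<exists>p. ultra p \<and> (\<forall>C\<in>p. \<exists>\<^sub>\<infinity>q. good q C)"
proof -
  let ?B = "{- C | C. \<not> (\<exists>\<^sub>\<infinity>q. good q C)}"
  have "\<Inter>\<F> \<noteq> {}" if fin: "finite \<F>" and sub: "\<F> \<subseteq> ?B" for \<F>
  proof
    assume empty: "\<Inter>\<F> = {}"
    have "finite (uminus ` \<F>)" using fin by simp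
    from finite_list[OF this] obtain Cs where Cs: "set Cs = uminus ` \<F>" ..
    have cov: "\<exists>i. i < length Cs \<and> s \<in> Cs ! i" for s
    proof -
      obtain D where "D \<in> \<F>" "s \<notin> D" using empty by blast
      then have "- D \<in> set Cs" "s \<in> - D" using Cs by auto
      then show ?thesis by (metis in_set_conv_nth)
    qed
    define \<kappa> where "\<kappa> s = (LEAST i. i < length Cs \<and> s \<in> Cs ! i)" for s
    have \<kappa>: "\<kappa> s < length Cs \<and> s \<in> Cs ! \<kappa> s" for s
      unfolding \<kappa>_def by (rule LeastI_ex[OF cov])
    have "\<exists>i<length Cs. good q {s. \<kappa> s = i}" for q using col[of \<kappa> "length Cs" q] \<kappa> by blast
    then obtain g where g: "\<And>q. g q < length Cs \<and> good q {s. \<kappa> s = g q}" by metis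
    have "range g \<subseteq> {..<length Cs}" using g by auto
    then have "finite (range g)" using finite_subset by blast
    then obtain i where i: "infinite {q. g q = i}"
      using pigeonhole_infinite[of UNIV g] by auto
    then have iL: "i < length Cs" using g by (metis (mono_tags, lifting) empty_Collect_eq infinite_imp_nonempty)
    have "\<exists>\<^sub>\<infinity>q. g q = i" using i by (simp add: INFM_iff_infinite)
    then have "\<exists>\<^sub>\<infinity>q. good q (Cs ! i)"
    proof (rule INFM_mono)
      fix q assume "g q = i"
      then have "good q {s. \<kappa> s = i}" using g by blast
      then show "good q (Cs ! i)" by (rule mono) (use \<kappa> in blast)
    qed
    moreover have "- (Cs ! i) \<in> \<F>" using Cs nth_mem[OF iL] by auto
    moreover have "\<exists>C. - (Cs ! i) = - C \<and> \<not> (\<exists>\<^sub>\<infinity>q. good q C)" using \<open>- (Cs ! i) \<in> \<F>\<close> sub by blast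
    ultimately show False by (metis double_complement)
  qed
  then obtain p where p: "ultra p" "?B \<subseteq> p" using ultra_extend[of ?B] by blast
  have "\<exists>\<^sub>\<infinity>q. good q C" if "C \<in> p" for C
  proof (rule ccontr)
    assume "\<not> ?thesis"
    then have "- C \<in> p" using p(2) by blast
    then show False using that ultra_Compl[OF p(1)] by blast
  qed
  then show ?thesis using p(1) by blast
qed

text \<open>The extension of a semigroup operation to the space of ultrafilters. With this order of
  the two arguments it is continuous in the left one, so right translates of compact sets are
  compact.\<close>

definition ultra_prod :: "('s \<Rightarrow> 's \<Rightarrow> 's) \<Rightarrow> 's set set \<Rightarrow> 's set set \<Rightarrow> 's set set" where
  "ultra_prod m U V = {C. {s. {t. m s t \<in> C} \<in> V} \<in> U}"

lemma ultra_ultra_prod: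
  assumes U: "ultra U" and V: "ultra V"
  shows "ultra (ultra_prod m U V)"
proof -
  have 1: "{s. {t. m s t \<in> - A} \<in> V} = - {s. {t. m s t \<in> A} \<in> V}" for A
  proof -
    have "{t. m s t \<in> - A} = - {t. m s t \<in> A}" for s by auto
    then show ?thesis using ultra_Compl[OF V] by auto
  qed
  have 2: "{s. {t. m s t \<in> A \<inter> B} \<in> V} \<supseteq> {s. {t. m s t \<in> A} \<in> V} \<inter> {s. {t. m s t \<in> B} \<in> V}" for A B
  proof -
    have "{t. m s t \<in> A \<inter> B} = {t. m s t \<in> A} \<inter> {t. m s t \<in> B}" for s by auto
    then show ?thesis using ultra_Int[OF V] by auto
  qed
  have 3: "{s. {t. m s t \<in> A} \<in> V} \<subseteq> {s. {t. m s t \<in> B} \<in> V}" if "A \<subseteq> B" for A B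
    using that by (auto intro: ultra_mono[OF V])
  show ?thesis
    unfolding ultra_def ultra_prod_def mem_Collect_eq 1
    using ultra_empty[OF V] ultra_empty[OF U] ultra_or[OF U] ultra_mono[OF U _ 3]
      ultra_mono[OF U ultra_Int[OF U] 2] by auto
qed

lemma ultra_prod_assoc:
  assumes "\<And>a b c. m (m a b) c = m a (m b c)"
  shows "ultra_prod m (ultra_prod m U V) W = ultra_prod m U (ultra_prod m V W)"
  by (simp add: ultra_prod_def assms)

text \<open>The Ellis-Numakura argument, run inside the closed subsemigroup of the ultrafilters with
  \<open>Good\<close> members only. If \<open>E\<close> is a minimal closed subsemigroup and
  \<open>p\<close> is in \<open>E\<close>, then the right translate of \<open>E\<close> by
  \<open>p\<close> is all of \<open>E\<close>, so some \<open>x\<close> satisfies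
  \<open>ultra_prod m x p = p\<close>; the solutions again form a closed subsemigroup, hence all of
  \<open>E\<close>, and \<open>p\<close> is one of them.\<close>

lemma idempotent_ultrafilter:
  fixes m :: "'s \<Rightarrow> 's \<Rightarrow> 's"
  assumes assoc: "\<And>a b c. m (m a b) c = m a (m b c)"
    and ex: "\<exists>p. ultra p \<and> (\<forall>C\<in>p. Good C)"
    and mult: "\<And>U V C. ultra U \<Longrightarrow> ultra V \<Longrightarrow> \<forall>C\<in>U. Good C \<Longrightarrow> \<forall>C\<in>V. Good C \<Longrightarrow>
      C \<in> ultra_prod m U V \<Longrightarrow> Good C"
  shows "\<exists>p. ultra p \<and> (\<forall>C\<in>p. Good C) \<and> ultra_prod m p p = p"
proof -
  \<comment> \<open>Topological closedness: \<open>U\<close> is a limit point if each of its basic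
    neighbourhoods, given by a member \<open>C\<close>, contains a point of
    \<open>E\<close>.\<close>
  define cls where "cls = (\<lambda>E. \<forall>U. ultra U \<and> (\<forall>C\<in>U. \<exists>V\<in>E. C \<in> V) \<longrightarrow> (U :: 's set set) \<in> E)"
  define H where "H = {p :: 's set set. ultra p \<and> (\<forall>C\<in>p. Good C)}"
  define Sub where "Sub = (\<lambda>E. E \<noteq> {} \<and> E \<subseteq> H \<and> cls E \<and> (\<forall>U\<in>E. \<forall>V\<in>E. ultra_prod m U V \<in> E))"
  have Hu: "ultra U" if "U \<in> H" for U using that by (simp add: H_def)
  \<comment> \<open>Compactness. Adding the sets common to all of \<open>E\<close> forces the
    ultrafilter found to be a limit point of \<open>E\<close>: otherwise the complement of one of
    its members would be among those sets.\<close>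
  have compact: "\<exists>U. ultra U \<and> \<G> \<subseteq> U \<and> U \<in> E"
    if E: "E \<subseteq> H" "cls E" and fip: "\<And>\<F>. finite \<F> \<Longrightarrow> \<F> \<subseteq> \<G> \<Longrightarrow> \<exists>V\<in>E. \<F> \<subseteq> V" for E \<G>
  proof -
    have "\<exists>U. ultra U \<and> \<G> \<union> {D. \<forall>V\<in>E. D \<in> V} \<subseteq> U"
    proof (rule ultra_extend)
      fix \<F> assume F: "finite \<F>" "\<F> \<subseteq> \<G> \<union> {D. \<forall>V\<in>E. D \<in> V}"
      obtain V where V: "V \<in> E" "\<F> \<inter> \<G> \<subseteq> V" using fip[of "\<F> \<inter> \<G>"] F(1) by auto
      then have "\<F> \<subseteq> V" using F(2) by blast
      then show "\<Inter>\<F> \<noteq> {}"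
        using ultra_Inter[OF Hu F(1)] ultra_empty[OF Hu] V(1) E(1) by (metis subsetD)
    qed
    then obtain U where U: "ultra U" "\<G> \<subseteq> U" "{D. \<forall>V\<in>E. D \<in> V} \<subseteq> U" by blast
    have "\<exists>V\<in>E. C \<in> V" if C: "C \<in> U" for C
    proof (rule ccontr)
      assume "\<not> ?thesis"
      then have "\<forall>V\<in>E. - C \<in> V" using E(1) Hu ultra_Compl by blast
      then have "- C \<in> U" using U(3) by blast
      then show False using C ultra_Compl[OF U(1)] by blast
    qed
    then have "U \<in> E" using E(2) U(1) unfolding cls_def by blast
    then show ?thesis using U by blast
  qed
  have "Sub H"
    unfolding Sub_def
  proof (intro conjI ballI)
    show "H \<noteq> {}" using ex by (auto simp: H_def)
    show "cls H" by (auto simp: cls_def H_def)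
    fix U V assume U: "U \<in> H" and V: "V \<in> H"
    then have "Good C" if "C \<in> ultra_prod m U V" for C using that mult unfolding H_def by blast
    then show "ultra_prod m U V \<in> H" using U V ultra_ultra_prod by (auto simp: H_def)
  qed simp
  \<comment> \<open>Zorn's lemma supplies maximal elements; taking complements turns them into
    minimal subsemigroups.\<close>
  have "\<exists>M\<in>uminus ` Collect Sub. \<forall>X\<in>uminus ` Collect Sub. M \<subseteq> X \<longrightarrow> X = M"
  proof (rule subset_Zorn_nonempty)
    show "uminus ` Collect Sub \<noteq> {}" using \<open>Sub H\<close> by blast
    fix \<C> assume ne: "\<C> \<noteq> {}" and ch: "subset.chain (uminus ` Collect Sub) \<C>"
    let ?E = "- \<Union>\<C>"
    have S: "Sub (- X)" if "X \<in> \<C>" for X using ch that by (auto simp: subset.chain_def)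
    have E: "?E \<subseteq> - X" if "X \<in> \<C>" for X using that by blast
    obtain X0 where X0: "X0 \<in> \<C>" using ne by blast
    have cls: "cls ?E"
      unfolding cls_def
    proof (intro allI impI)
      fix U assume U: "ultra U \<and> (\<forall>C\<in>U. \<exists>V\<in>?E. C \<in> V)"
      have "U \<in> - X" if "X \<in> \<C>" for X
      proof -
        have "\<forall>C\<in>U. \<exists>V\<in>- X. C \<in> V" using U that by blast
        moreover have "cls (- X)" using S[OF that] by (simp only: Sub_def)
        ultimately show ?thesis using U unfolding cls_def by (elim allE[of _ U]) blast
      qed
      then show "U \<in> ?E" by blast
    qed
    \<comment> \<open>Compactness keeps the intersection of the chain nonempty: finitely many of
      these sets belong to a common ultrafilter, taken from the smallest of the finitely many
      subsemigroups concerned.\<close>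
    have "\<exists>U. ultra U \<and> {D. \<exists>X\<in>\<C>. \<forall>V\<in>- X. D \<in> V} \<subseteq> U"
    proof (rule ultra_extend)
      fix \<F> assume F: "finite \<F>" "\<F> \<subseteq> {D. \<exists>X\<in>\<C>. \<forall>V\<in>- X. D \<in> V}"
      have "\<forall>D\<in>\<F>. \<exists>X. X \<in> \<C> \<and> (\<forall>V\<in>- X. D \<in> V)"
      proof
        fix D assume "D \<in> \<F>"
        then have "D \<in> {D. \<exists>X\<in>\<C>. \<forall>V\<in>- X. D \<in> V}" using F(2) by (rule rev_subsetD)
        then show "\<exists>X. X \<in> \<C> \<and> (\<forall>V\<in>- X. D \<in> V)" by (simp only: mem_Collect_eq Bex_def)
      qed
      from bchoice[OF this] obtain h
        where h0: "\<forall>D\<in>\<F>. h D \<in> \<C> \<and> (\<forall>V\<in>- h D. D \<in> V)" ..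
      have h: "h D \<in> \<C>" "V \<in> - h D \<Longrightarrow> D \<in> V" if "D \<in> \<F>" for D V using h0 that by simp_all
      have "\<Union>(insert X0 (h ` \<F>)) \<in> insert X0 (h ` \<F>)"
      proof (rule Union_in_chain)
        show "finite (insert X0 (h ` \<F>))" using F by simp
        show "insert X0 (h ` \<F>) \<noteq> {}" by simp
        show "subset.chain (uminus ` Collect Sub) (insert X0 (h ` \<F>))"
          using ch h(1) X0 unfolding subset.chain_def by auto
      qed
      then have "\<Union>(insert X0 (h ` \<F>)) \<in> \<C>" using h(1) X0 by auto
      from S[OF this] obtain V where V1: "V \<in> - \<Union>(insert X0 (h ` \<F>))" "V \<in> H"
        unfolding Sub_def by blast
      then have V: "V \<in> - \<Union>(insert X0 (h ` \<F>))" "ultra V" using Hu by simp_all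
      have "\<F> \<subseteq> V"
      proof
        fix D assume D: "D \<in> \<F>"
        then have "V \<in> - h D" using V(1) by simp
        then show "D \<in> V" by (rule h(2)[OF D])
      qed
      then show "\<Inter>\<F> \<noteq> {}" using ultra_Inter[OF V(2) F(1)] ultra_empty[OF V(2)] by metis
    qed
    then obtain U where U: "ultra U" "{D. \<exists>X\<in>\<C>. \<forall>V\<in>- X. D \<in> V} \<subseteq> U" by (elim exE conjE)
    have "U \<in> - X" if X: "X \<in> \<C>" for X
    proof -
      have "\<exists>V\<in>- X. C \<in> V" if C: "C \<in> U" for C
      proof (rule ccontr)
        assume "\<not> ?thesis"
        then have "\<forall>V\<in>- X. - C \<in> V" using S[OF X] Hu ultra_Compl unfolding Sub_def by blast
        then have "- C \<in> U" using U(2) X by blast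
        then show False using C ultra_Compl[OF U(1)] by blast
      qed
      moreover have "cls (- X)" using S[OF X] by (simp only: Sub_def)
      ultimately show ?thesis using U(1) unfolding cls_def by (elim allE[of _ U]) blast
    qed
    then have "?E \<noteq> {}" by blast
    moreover have "?E \<subseteq> H" using S[OF X0] E[OF X0] unfolding Sub_def by blast
    moreover have "ultra_prod m U V \<in> ?E" if "U \<in> ?E" "V \<in> ?E" for U V
    proof -
      have "ultra_prod m U V \<in> - X" if X: "X \<in> \<C>" for X
        using S[OF X] \<open>U \<in> ?E\<close> \<open>V \<in> ?E\<close> X unfolding Sub_def by blast
      then show ?thesis by blast
    qed
    ultimately have "Sub ?E" using cls unfolding Sub_def by blast
    then show "\<Union>\<C> \<in> uminus ` Collect Sub" by (metis (mono_tags, lifting) double_complement image_eqI mem_Collect_eq)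
  qed
  then obtain E where SE: "Sub E" and min: "\<And>E'. Sub E' \<Longrightarrow> E' \<subseteq> E \<Longrightarrow> E' = E"
    by (auto simp: image_iff)
  have EH: "E \<subseteq> H" and Ecl: "cls E" and Eup: "\<And>U V. U \<in> E \<Longrightarrow> V \<in> E \<Longrightarrow> ultra_prod m U V \<in> E"
    using SE by (auto simp: Sub_def)
  obtain p where p: "p \<in> E" using SE by (auto simp: Sub_def)
  have pu: "ultra p" using p EH Hu by blast
  have "Sub ((\<lambda>x. ultra_prod m x p) ` E)"
    unfolding Sub_def
  proof (intro conjI ballI)
    show "(\<lambda>x. ultra_prod m x p) ` E \<noteq> {}" using p by blast
    show "(\<lambda>x. ultra_prod m x p) ` E \<subseteq> H" using Eup p EH by blast
    show "cls ((\<lambda>x. ultra_prod m x p) ` E)"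
      unfolding cls_def
    proof (intro allI impI)
      fix U assume U: "ultra U \<and> (\<forall>C\<in>U. \<exists>V\<in>(\<lambda>x. ultra_prod m x p) ` E. C \<in> V)"
      \<comment> \<open>\<open>C\<close> belongs to \<open>ultra_prod m x p\<close> iff
        \<open>h C\<close> belongs to \<open>x\<close>; hence a limit \<open>U\<close> of the
        translate is the translate of any \<open>x\<close> in \<open>E\<close> that contains all
        \<open>h C\<close> with \<open>C\<close> in \<open>U\<close>.\<close>
      define h where "h C = {s. {t. m s t \<in> C} \<in> p}" for C
      have "\<exists>x. ultra x \<and> h ` U \<subseteq> x \<and> x \<in> E"
      proof (rule compact[OF EH Ecl])
        fix \<F> assume F: "finite \<F>" "\<F> \<subseteq> h ` U"
        then obtain \<D> where D: "finite \<D>" "\<D> \<subseteq> U" "\<F> = h ` \<D>" by (meson finite_subset_image)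
        have "\<Inter>\<D> \<in> U" using ultra_Inter D U by blast
        then obtain x where x: "x \<in> E" "h (\<Inter>\<D>) \<in> x" using U by (auto simp: ultra_prod_def h_def)
        have "h C \<in> x" if "C \<in> \<D>" for C
        proof (rule ultra_mono[OF _ x(2)])
          show "ultra x" using x EH Hu by blast
          show "h (\<Inter>\<D>) \<subseteq> h C" using that by (auto simp: h_def elim!: ultra_mono[OF pu])
        qed
        then show "\<exists>V\<in>E. \<F> \<subseteq> V" using D(3) x(1) by blast
      qed
      then obtain x where x: "ultra x" "h ` U \<subseteq> x" "x \<in> E" by blast
      have "U \<subseteq> ultra_prod m x p" using x(2) by (auto simp: ultra_prod_def h_def)
      then have "U = ultra_prod m x p" using U ultra_ultra_prod[OF x(1) pu] ultra_subset_eq by blast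
      then show "U \<in> (\<lambda>x. ultra_prod m x p) ` E" using x(3) by blast
    qed
    fix U V assume "U \<in> (\<lambda>x. ultra_prod m x p) ` E" "V \<in> (\<lambda>x. ultra_prod m x p) ` E"
    then obtain x y where xy: "x \<in> E" "y \<in> E" "U = ultra_prod m x p" "V = ultra_prod m y p" by blast
    then have "ultra_prod m U V = ultra_prod m (ultra_prod m (ultra_prod m x p) y) p" using ultra_prod_assoc[of m, OF assoc] by metis
    then show "ultra_prod m U V \<in> (\<lambda>x. ultra_prod m x p) ` E" using xy Eup p by blast
  qed
  then have "(\<lambda>x. ultra_prod m x p) ` E = E" by (rule min) (use Eup p in blast)
  then obtain y where y: "y \<in> E" "ultra_prod m y p = p" using p by (metis imageE)
  have "Sub {x \<in> E. ultra_prod m x p = p}"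
    unfolding Sub_def
  proof (intro conjI ballI)
    show "{x \<in> E. ultra_prod m x p = p} \<noteq> {}" using y by blast
    show "{x \<in> E. ultra_prod m x p = p} \<subseteq> H" using EH by blast
    show "cls {x \<in> E. ultra_prod m x p = p}"
      unfolding cls_def
    proof (intro allI impI)
      fix U assume U: "ultra U \<and> (\<forall>C\<in>U. \<exists>V\<in>{x \<in> E. ultra_prod m x p = p}. C \<in> V)"
      then have UE: "U \<in> E" using Ecl unfolding cls_def by blast
      have "C \<in> p" if "C \<in> ultra_prod m U p" for C
      proof -
        have "{s. {t. m s t \<in> C} \<in> p} \<in> U" using that by (simp add: ultra_prod_def)
        then obtain x where "ultra_prod m x p = p" "{s. {t. m s t \<in> C} \<in> p} \<in> x" using U by blast
        then show ?thesis by (auto simp: ultra_prod_def)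
      qed
      then have "ultra_prod m U p = p" using ultra_subset_eq[OF ultra_ultra_prod pu, of U p] U pu by blast
      then show "U \<in> {x \<in> E. ultra_prod m x p = p}" using UE by blast
    qed
    fix U V assume "U \<in> {x \<in> E. ultra_prod m x p = p}" "V \<in> {x \<in> E. ultra_prod m x p = p}"
    then show "ultra_prod m U V \<in> {x \<in> E. ultra_prod m x p = p}" using Eup ultra_prod_assoc[of m U V p, OF assoc] by simp
  qed
  then have "{x \<in> E. ultra_prod m x p = p} = E" by (rule min) blast
  then have "ultra_prod m p p = p" using p by blast
  then show ?thesis using p EH by (auto simp: H_def)
qed

section \<open>Lines in a product of free semigroups\<close>

definition wmul :: "'a list \<times> ('i \<Rightarrow> 'b list) \<Rightarrow> 'a list \<times> ('i \<Rightarrow> 'b list) \<Rightarrow> 'a list \<times> ('i \<Rightarrow> 'b list)" where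
  "wmul s t = (fst s @ fst t, \<lambda>i. snd s i @ snd t i)"

lemma wmul_assoc: "wmul (wmul a b) c = wmul a (wmul b c)"
  by (simp add: wmul_def)

text \<open>A weak form of a Hales-Jewett line: the continuation after the letter may depend on the
  letter. Only the splitting into all letters at one place matters for building trees, and this form
  comes from pigeonhole counting.\<close>

definition line_point ::
  "'i set \<Rightarrow> ('i \<Rightarrow> 'b list) \<Rightarrow> ('i \<Rightarrow> 'b \<Rightarrow> 'b list) \<Rightarrow> ('i \<Rightarrow> 'b) \<Rightarrow> 'i \<Rightarrow> 'b list" where
  "line_point I p e \<beta> = (\<lambda>i. if i \<in> I then p i @ [\<beta> i] @ e i (\<beta> i) else [])"

text \<open>The left coordinate of a line splits into all letters, so that in applications the letters used
  there may be chosen after the line has been found.\<close>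

definition has_line ::
  "'i set \<Rightarrow> ('i \<Rightarrow> 'b set) \<Rightarrow> ('i \<Rightarrow> 'b set) \<Rightarrow> ('a list \<times> ('i \<Rightarrow> 'b list)) set \<Rightarrow> bool" where
  "has_line I G F C \<longleftrightarrow> (\<exists>u0 e0 p e.
     (\<forall>i\<in>I. p i \<in> lists (G i) \<and> (\<forall>b\<in>F i. e i b \<in> lists (G i))) \<and>
     (\<forall>\<beta>. (\<forall>i\<in>I. \<beta> i \<in> F i) \<longrightarrow>
        (u0, line_point I p e \<beta>) \<in> C \<and> (\<forall>a. (u0 @ [a] @ e0 a, line_point I p e \<beta>) \<in> C)))"

text \<open>If appending some letter to \<open>u\<close> loses a colour, that letter uses up one of
  the \<open>r\<close> places and the induction continues behind it. Otherwise every letter leads to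
  the same colours, and any of them can be reached behind each letter. The first case cannot exhaust
  \<open>r\<close>, since at length 0 one colour is left. Equal lengths keep all words in one finite
  set.\<close>

lemma word_pigeonhole:
  fixes \<xi> :: "'b list \<Rightarrow> 'c"
  assumes F: "finite F" "F \<noteq> {}"
    and "card (\<xi> ` {u @ s | s. s \<in> lists F \<and> length s = r}) \<le> r"
  shows "\<exists>p e \<epsilon>. p \<in> lists F \<and>
    (\<forall>b\<in>F. e b \<in> lists F \<and> length (p @ [b] @ e b) = r \<and> \<xi> (u @ p @ [b] @ e b) = \<epsilon>)"
  using assms(3)
proof (induction r arbitrary: u)
  case 0
  have "{u @ s | s. s \<in> lists F \<and> length s = 0} = {u}" by auto
  then show ?case using 0 by simp
next
  case (Suc r)
  let ?C = "\<lambda>u r. \<xi> ` {u @ s | s. s \<in> lists F \<and> length s = r}"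
  have fin: "finite (?C u r)" for u r
  proof -
    have "finite {s. set s \<subseteq> F \<and> length s = r}" by (rule finite_lists_length_eq[OF F(1)])
    then have "finite ((@) u ` {s. set s \<subseteq> F \<and> length s = r})" by simp
    moreover have "(@) u ` {s. set s \<subseteq> F \<and> length s = r} = {u @ s | s. s \<in> lists F \<and> length s = r}"
      by (auto simp: in_lists_conv_set)
    ultimately show ?thesis by simp
  qed
  have sub: "?C (u @ [b]) r \<subseteq> ?C u (Suc r)" if b: "b \<in> F" for b
  proof
    fix z assume "z \<in> ?C (u @ [b]) r"
    then obtain s where s: "s \<in> lists F" "length s = r" "z = \<xi> ((u @ [b]) @ s)" by blast
    then have "b # s \<in> lists F" "length (b # s) = Suc r" "z = \<xi> (u @ (b # s))" using b by auto
    then show "z \<in> ?C u (Suc r)" by blast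
  qed
  show ?case
  proof (cases "\<exists>b\<in>F. ?C (u @ [b]) r \<noteq> ?C u (Suc r)")
    case True
    then obtain b where b0: "b \<in> F" "?C (u @ [b]) r \<noteq> ?C u (Suc r)" ..
    have b: "b \<in> F" "?C (u @ [b]) r \<subset> ?C u (Suc r)" using b0 sub[OF b0(1)] by (auto simp only: psubset_eq)
    have "card (?C (u @ [b]) r) < card (?C u (Suc r))" using psubset_card_mono[OF fin b(2)] .
    then have "card (?C (u @ [b]) r) \<le> r" using Suc.prems by linarith
    from Suc.IH[OF this] obtain p e \<epsilon> where pe: "p \<in> lists F"
      "\<forall>b'\<in>F. e b' \<in> lists F \<and> length (p @ [b'] @ e b') = r \<and> \<xi> ((u @ [b]) @ p @ [b'] @ e b') = \<epsilon>"
      by blast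
    show ?thesis
      by (rule exI[of _ "b # p"], rule exI[of _ e], rule exI[of _ \<epsilon>]) (use pe b in auto)
  next
    case False
    obtain b0 where b0: "b0 \<in> F" using F by blast
    have "replicate (Suc r) b0 \<in> lists F" using b0 by (auto simp: in_lists_conv_set)
    then obtain \<epsilon> where \<epsilon>: "\<epsilon> \<in> ?C u (Suc r)" by (metis (mono_tags, lifting) imageI length_replicate mem_Collect_eq)
    have "\<forall>b\<in>F. \<exists>s. s \<in> lists F \<and> length s = r \<and> \<xi> ((u @ [b]) @ s) = \<epsilon>"
    proof
      fix b assume "b \<in> F"
      then have "\<epsilon> \<in> ?C (u @ [b]) r" using False \<epsilon> by blast
      then show "\<exists>s. s \<in> lists F \<and> length s = r \<and> \<xi> ((u @ [b]) @ s) = \<epsilon>" by blast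
    qed
    from bchoice[OF this] obtain e where
      "\<forall>b\<in>F. e b \<in> lists F \<and> length (e b) = r \<and> \<xi> ((u @ [b]) @ e b) = \<epsilon>" ..
    then show ?thesis by (intro exI[of _ "[]"] exI[of _ e] exI[of _ \<epsilon>]) auto
  qed
qed

text \<open>The finite set \<open>L\<close>, uniform in the colouring, is what makes the induction
  on \<open>I\<close> work: a word in the new coordinate is coloured by the colouring that it
  induces on the set \<open>L\<close> of the other coordinates, and there are only finitely many of
  these.\<close>

lemma finite_line_colouring:
  fixes F :: "'i \<Rightarrow> 'b set"
  assumes "finite I" "\<forall>i\<in>I. finite (F i) \<and> F i \<noteq> {}"
  shows "\<exists>L. finite L \<and> (\<forall>\<xi> :: ('i \<Rightarrow> 'b list) \<Rightarrow> nat. (\<forall>s\<in>L. \<xi> s < r) \<longrightarrow> (\<exists>p e \<epsilon>.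
     (\<forall>i\<in>I. p i \<in> lists (F i) \<and> (\<forall>b\<in>F i. e i b \<in> lists (F i))) \<and>
     (\<forall>\<beta>. (\<forall>i\<in>I. \<beta> i \<in> F i) \<longrightarrow> line_point I p e \<beta> \<in> L \<and> \<xi> (line_point I p e \<beta>) = \<epsilon>)))"
  using assms
proof (induction I rule: finite_induct)
  case empty
  show ?case by (rule exI[of _ "{\<lambda>_. []}"]) (auto simp: line_point_def)
next
  case (insert i I)
  then obtain L where L: "finite L" and L2: "\<And>\<xi> :: ('i \<Rightarrow> 'b list) \<Rightarrow> nat. (\<forall>s\<in>L. \<xi> s < r) \<Longrightarrow> (\<exists>p e \<epsilon>.
     (\<forall>i\<in>I. p i \<in> lists (F i) \<and> (\<forall>b\<in>F i. e i b \<in> lists (F i))) \<and>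
     (\<forall>\<beta>. (\<forall>i\<in>I. \<beta> i \<in> F i) \<longrightarrow> line_point I p e \<beta> \<in> L \<and> \<xi> (line_point I p e \<beta>) = \<epsilon>))"
    by auto
  have Fi: "finite (F i)" "F i \<noteq> {}" using insert.prems by auto
  let ?E = "L \<rightarrow>\<^sub>E {..<r}"
  \<comment> \<open>The length is the number of induced colourings, as
    \<open>word_pigeonhole\<close> requires.\<close>
  define W where "W = {s. s \<in> lists (F i) \<and> length s = card ?E}"
  have finE: "finite ?E" using L by (intro finite_PiE) auto
  have "W = {s. set s \<subseteq> F i \<and> length s = card ?E}" by (auto simp: W_def in_lists_conv_set)
  then have finW: "finite W" using finite_lists_length_eq[OF Fi(1)] by simp
  show ?case
  proof (intro exI[of _ "(\<lambda>(s, z). s(i := z)) ` (L \<times> W)"] conjI allI impI)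
    show "finite ((\<lambda>(s, z). s(i := z)) ` (L \<times> W))" using L finW by simp
    fix \<xi> :: "('i \<Rightarrow> 'b list) \<Rightarrow> nat"
    assume \<xi>: "\<forall>s\<in>(\<lambda>(s, z). s(i := z)) ` (L \<times> W). \<xi> s < r"
    define \<kappa> where "\<kappa> z = (\<lambda>s\<in>L. \<xi> (s(i := z)))" for z
    have \<kappa>E: "\<kappa> z \<in> ?E" if "z \<in> W" for z using \<xi> that by (auto simp: \<kappa>_def)
    have "card (\<kappa> ` {[] @ s | s. s \<in> lists (F i) \<and> length s = card ?E}) \<le> card ?E"
      by (rule card_mono[OF finE]) (use \<kappa>E in \<open>auto simp: W_def\<close>)
    from word_pigeonhole[OF Fi this] obtain p' e' \<phi> where p': "p' \<in> lists (F i)"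
      and e'0: "\<forall>b\<in>F i. e' b \<in> lists (F i) \<and> length (p' @ [b] @ e' b) = card ?E \<and> \<kappa> ([] @ p' @ [b] @ e' b) = \<phi>"
      by (elim exE conjE)
    have e': "e' b \<in> lists (F i) \<and> length (p' @ [b] @ e' b) = card ?E \<and> \<kappa> (p' @ [b] @ e' b) = \<phi>" if "b \<in> F i" for b
      using bspec[OF e'0 that] by simp
    have inW: "p' @ [b] @ e' b \<in> W" if "b \<in> F i" for b using e'[OF that] p' that by (auto simp: W_def)
    obtain b0 where b0: "b0 \<in> F i" using Fi by blast
    have "\<phi> \<in> ?E" using \<kappa>E[OF inW[OF b0]] e'[OF b0] by simp
    then have "\<forall>s\<in>L. \<phi> s < r" by auto
    from L2[OF this] obtain p e \<epsilon> where pe: "\<forall>i\<in>I. p i \<in> lists (F i) \<and> (\<forall>b\<in>F i. e i b \<in> lists (F i))"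
      and lp: "\<And>\<beta>. (\<forall>i\<in>I. \<beta> i \<in> F i) \<Longrightarrow> line_point I p e \<beta> \<in> L \<and> \<phi> (line_point I p e \<beta>) = \<epsilon>"
      by blast
    have eq: "line_point (insert i I) (p(i := p')) (e(i := e')) \<beta> = (line_point I p e \<beta>)(i := p' @ [\<beta> i] @ e' (\<beta> i))" for \<beta>
      using insert.hyps(2) by (auto simp: line_point_def fun_eq_iff)
    show "\<exists>p e \<epsilon>. (\<forall>i\<in>insert i I. p i \<in> lists (F i) \<and> (\<forall>b\<in>F i. e i b \<in> lists (F i))) \<and>
     (\<forall>\<beta>. (\<forall>i\<in>insert i I. \<beta> i \<in> F i) \<longrightarrow> line_point (insert i I) p e \<beta> \<in> (\<lambda>(s, z). s(i := z)) ` (L \<times> W) \<and>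
        \<xi> (line_point (insert i I) p e \<beta>) = \<epsilon>)"
    proof (intro exI[of _ "p(i := p')"] exI[of _ "e(i := e')"] exI[of _ \<epsilon>] conjI allI impI)
      show "\<forall>j\<in>insert i I. (p(i := p')) j \<in> lists (F j) \<and> (\<forall>b\<in>F j. (e(i := e')) j b \<in> lists (F j))"
        using pe p' e' by simp
      fix \<beta> assume \<beta>: "\<forall>j\<in>insert i I. \<beta> j \<in> F j"
      then have l: "line_point I p e \<beta> \<in> L" "\<phi> (line_point I p e \<beta>) = \<epsilon>" using lp by auto
      have \<beta>i: "\<beta> i \<in> F i" using \<beta> by simp
      show "line_point (insert i I) (p(i := p')) (e(i := e')) \<beta> \<in> (\<lambda>(s, z). s(i := z)) ` (L \<times> W)"
        unfolding eq using l(1) inW[OF \<beta>i] by (intro image_eqI[of _ _ "(line_point I p e \<beta>, p' @ [\<beta> i] @ e' (\<beta> i))"]) auto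
      have "\<phi> = \<kappa> (p' @ [\<beta> i] @ e' (\<beta> i))" using e'[OF \<beta>i] by simp
      then show "\<xi> (line_point (insert i I) (p(i := p')) (e(i := e')) \<beta>) = \<epsilon>"
        unfolding eq using l by (simp add: \<kappa>_def)
    qed
  qed
qed

text \<open>Above a word with the fewest colours no letter loses a colour, so its own colour recurs
  behind every letter. The argument covers infinite alphabets; in the application the left letters
  range over all nodes.\<close>

lemma constant_above_some_word:
  fixes \<kappa> :: "'a list \<Rightarrow> 'c"
  assumes "finite (range \<kappa>)"
  shows "\<exists>u e. \<forall>a. \<kappa> (u @ [a] @ e a) = \<kappa> u"
proof -
  let ?C = "\<lambda>u. \<kappa> ` range ((@) u)"
  obtain u where u: "\<And>v. card (?C u) \<le> card (?C v)"
    using ex_has_least_nat[of "\<lambda>_. True" "[]" "\<lambda>u. card (?C u)"] by auto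
  have fin: "finite (?C v)" for v by (rule finite_subset[OF _ assms]) auto
  have "\<exists>s. \<kappa> (u @ [a] @ s) = \<kappa> u" for a
  proof -
    have "?C (u @ [a]) \<subseteq> ?C u"
    proof
      fix z assume "z \<in> ?C (u @ [a])"
      then obtain s where "z = \<kappa> ((u @ [a]) @ s)" by blast
      then have "z = \<kappa> (u @ (a # s))" by simp
      then show "z \<in> ?C u" by blast
    qed
    then have "?C (u @ [a]) = ?C u" using u[of "u @ [a]"] fin by (simp add: card_seteq)
    moreover have "\<kappa> (u @ []) \<in> ?C u" by blast
    ultimately have "\<kappa> u \<in> ?C (u @ [a])" by simp
    then obtain s where "\<kappa> u = \<kappa> ((u @ [a]) @ s)" by blast
    then show ?thesis by (intro exI[of _ s]) simp
  qed
  then show ?thesis by metis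
qed

text \<open>The left word is treated first: its colour is the colouring it induces on the finite set
  \<open>L\<close>, and \<open>u0\<close> is chosen so that this colouring is restored after passing
  through any letter. What remains is a colouring of \<open>L\<close>.\<close>

lemma line_colouring:
  fixes F :: "'i \<Rightarrow> 'b set" and \<xi> :: "'a list \<times> ('i \<Rightarrow> 'b list) \<Rightarrow> nat"
  assumes "finite I" "\<forall>i\<in>I. finite (F i) \<and> F i \<noteq> {}" "\<And>s. \<xi> s < r"
  shows "\<exists>j<r. has_line I F F {s. \<xi> s = j}"
proof -
  obtain L where L: "finite L" and L2: "\<And>\<xi> :: ('i \<Rightarrow> 'b list) \<Rightarrow> nat. (\<forall>s\<in>L. \<xi> s < r) \<Longrightarrow> (\<exists>p e \<epsilon>.
     (\<forall>i\<in>I. p i \<in> lists (F i) \<and> (\<forall>b\<in>F i. e i b \<in> lists (F i))) \<and>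
     (\<forall>\<beta>. (\<forall>i\<in>I. \<beta> i \<in> F i) \<longrightarrow> line_point I p e \<beta> \<in> L \<and> \<xi> (line_point I p e \<beta>) = \<epsilon>))"
    using finite_line_colouring[OF assms(1,2), of r] by blast
  define \<kappa> where "\<kappa> u = (\<lambda>s\<in>L. \<xi> (u, s))" for u
  have "range \<kappa> \<subseteq> L \<rightarrow>\<^sub>E {..<r}" using assms(3) by (auto simp: \<kappa>_def)
  then have "finite (range \<kappa>)" by (rule finite_subset) (use L in \<open>simp add: finite_PiE\<close>)
  then obtain u0 e0 where u0: "\<And>a. \<kappa> (u0 @ [a] @ e0 a) = \<kappa> u0" using constant_above_some_word by metis
  have "\<forall>s\<in>L. \<xi> (u0, s) < r" using assms(3) by simp
  from L2[OF this] obtain p e \<epsilon> where pe: "\<forall>i\<in>I. p i \<in> lists (F i) \<and> (\<forall>b\<in>F i. e i b \<in> lists (F i))"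
    and lp: "\<And>\<beta>. (\<forall>i\<in>I. \<beta> i \<in> F i) \<Longrightarrow> line_point I p e \<beta> \<in> L \<and> \<xi> (u0, line_point I p e \<beta>) = \<epsilon>"
    by blast
  have "\<xi> (u0 @ [a] @ e0 a, line_point I p e \<beta>) = \<epsilon>" if "\<forall>i\<in>I. \<beta> i \<in> F i" for \<beta> a
    using lp[OF that] u0[of a] by (auto simp: \<kappa>_def fun_eq_iff restrict_def split: if_splits dest: spec[of _ "line_point I p e \<beta>"])
  then have "has_line I F F {s. \<xi> s = \<epsilon>}"
    unfolding has_line_def using pe lp
    by (intro exI[of _ u0] exI[of _ e0] exI[of _ p] exI[of _ e]) auto
  moreover have "\<epsilon> < r"
  proof -
    have "\<forall>i\<in>I. \<exists>b. b \<in> F i" using assms(2) by blast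
    from bchoice[OF this] obtain \<beta> where "\<forall>i\<in>I. \<beta> i \<in> F i" ..
    then show ?thesis using lp assms(3) by metis
  qed
  ultimately show ?thesis by blast
qed

lemma has_line_mono:
  assumes "has_line I G F C" "C \<subseteq> D" "\<And>i. i \<in> I \<Longrightarrow> G i \<subseteq> G' i"
  shows "has_line I G' F D"
proof -
  obtain u0 e0 p e where *: "\<forall>i\<in>I. p i \<in> lists (G i) \<and> (\<forall>b\<in>F i. e i b \<in> lists (G i))"
    "\<forall>\<beta>. (\<forall>i\<in>I. \<beta> i \<in> F i) \<longrightarrow>
        (u0, line_point I p e \<beta>) \<in> C \<and> (\<forall>a. (u0 @ [a] @ e0 a, line_point I p e \<beta>) \<in> C)"
    using assms(1) unfolding has_line_def by blast
  show ?thesis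
    unfolding has_line_def
    by (rule exI[of _ u0], rule exI[of _ e0], rule exI[of _ p], rule exI[of _ e])
      (use * assms(2,3) lists_mono in blast)
qed

text \<open>Lines are required beyond every \<open>N\<close>, with the auxiliary letters of index at
  least \<open>N\<close> as well, because a letter of index \<open>q\<close> will carry a node at
  least to level \<open>q\<close>. The requirement survives products: a line for \<open>V\<close> is
  multiplied from the left by a fixed \<open>s\<close> whose right words use only such letters,
  which lengthens the initial words \<open>p i\<close> and leaves the splitting alone.\<close>

lemma line_idempotent:
  fixes F :: "nat \<Rightarrow> 'i \<Rightarrow> 'b set"
  assumes I: "finite I" and F: "\<And>q i. i \<in> I \<Longrightarrow> finite (F q i) \<and> F q i \<noteq> {}"
  shows "\<exists>p :: ('a list \<times> ('i \<Rightarrow> 'b list)) set set. ultra p \<and>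
    (\<forall>C\<in>p. \<forall>N. \<exists>q\<ge>N. has_line I (\<lambda>i. \<Union>q\<in>{N..}. F q i) (F q) C) \<and> ultra_prod wmul p p = p"
proof (rule idempotent_ultrafilter)
  let ?G = "\<lambda>N i. \<Union>q\<in>{N..}. F q i"
  show "wmul (wmul a b) c = wmul a (wmul b c)" for a b c :: "'a list \<times> ('i \<Rightarrow> 'b list)"
    by (rule wmul_assoc)
  have "\<exists>p :: ('a list \<times> ('i \<Rightarrow> 'b list)) set set. ultra p \<and> (\<forall>C\<in>p. \<exists>\<^sub>\<infinity>q. has_line I (F q) (F q) C)"
  proof (rule ultra_infinitely_often)
    show "has_line I (F q) (F q) D" if "has_line I (F q) (F q) C" "C \<subseteq> D"
      for q and C D :: "('a list \<times> ('i \<Rightarrow> 'b list)) set"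
      using has_line_mono[OF that] by simp
    show "\<exists>j<r. has_line I (F q) (F q) {s. \<kappa> s = j}" if "\<And>s. \<kappa> s < r"
      for q r and \<kappa> :: "'a list \<times> ('i \<Rightarrow> 'b list) \<Rightarrow> nat"
    proof (rule line_colouring[OF I _ that])
      show "\<forall>i\<in>I. finite (F q i) \<and> F q i \<noteq> {}" using F by simp
    qed
  qed
  then obtain p :: "('a list \<times> ('i \<Rightarrow> 'b list)) set set" where
    p: "ultra p" and p2: "\<forall>C\<in>p. \<exists>\<^sub>\<infinity>q. has_line I (F q) (F q) C" by (elim exE conjE)
  have "\<exists>q\<ge>N. has_line I (?G N) (F q) C" if C: "C \<in> p" for C N
  proof -
    obtain q where "q \<ge> N" "has_line I (F q) (F q) C"
      using bspec[OF p2 C] unfolding INFM_nat_le by blast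
    moreover from this have "has_line I (?G N) (F q) C" by (elim has_line_mono) auto
    ultimately show ?thesis by blast
  qed
  then show "\<exists>p :: ('a list \<times> ('i \<Rightarrow> 'b list)) set set. ultra p \<and> (\<forall>C\<in>p. \<forall>N. \<exists>q\<ge>N. has_line I (?G N) (F q) C)"
    using p by blast
  fix U V :: "('a list \<times> ('i \<Rightarrow> 'b list)) set set" and C
  assume U: "ultra U" and V: "ultra V" and gU: "\<forall>C\<in>U. \<forall>N. \<exists>q\<ge>N. has_line I (?G N) (F q) C"
    and gV: "\<forall>C\<in>V. \<forall>N. \<exists>q\<ge>N. has_line I (?G N) (F q) C" and C: "C \<in> ultra_prod wmul U V"
  show "\<forall>N. \<exists>q\<ge>N. has_line I (?G N) (F q) C"
  proof
    fix N
    \<comment> \<open>Almost every tuple for \<open>U\<close> is in \<open>W\<close>; else the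
      complement would contain a line with letters beyond \<open>N\<close>, whose points lie in
      \<open>W\<close>.\<close>
    define W :: "('a list \<times> ('i \<Rightarrow> 'b list)) set"
      where "W = {s. (\<forall>i\<in>I. snd s i \<in> lists (?G N i)) \<and> (\<forall>i. i \<notin> I \<longrightarrow> snd s i = [])}"
    have "W \<in> U"
    proof (rule ccontr)
      assume "W \<notin> U"
      then have "- W \<in> U" using ultra_Compl[OF U] by simp
      then obtain q where q: "q \<ge> N" "has_line I (?G N) (F q) (- W)" using gU by blast
      obtain u0 p e where pe: "\<forall>i\<in>I. p i \<in> lists (?G N i) \<and> (\<forall>b\<in>F q i. e i b \<in> lists (?G N i))"
        "\<forall>\<beta>. (\<forall>i\<in>I. \<beta> i \<in> F q i) \<longrightarrow> (u0, line_point I p e \<beta>) \<in> - W"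
        using q(2) unfolding has_line_def by metis
      have "\<forall>i\<in>I. \<exists>b. b \<in> F q i" using F by blast
      from bchoice[OF this] obtain \<beta> where \<beta>: "\<forall>i\<in>I. \<beta> i \<in> F q i" ..
      then have "(u0, line_point I p e \<beta>) \<in> W" using pe(1) q(1) by (auto simp: W_def line_point_def)
      then show False using pe(2) \<beta> by blast
    qed
    moreover have "{s. {t. wmul s t \<in> C} \<in> V} \<in> U" using C by (simp add: ultra_prod_def)
    ultimately have "W \<inter> {s. {t. wmul s t \<in> C} \<in> V} \<in> U" using ultra_Int[OF U] by blast
    then obtain s where s: "s \<in> W" "{t. wmul s t \<in> C} \<in> V" using ultra_ex[OF U] by blast
    then obtain q where q: "q \<ge> N" "has_line I (?G N) (F q) {t. wmul s t \<in> C}" using gV by blast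
    obtain u0 e0 p e where pe: "\<forall>i\<in>I. p i \<in> lists (?G N i) \<and> (\<forall>b\<in>F q i. e i b \<in> lists (?G N i))"
      "\<And>\<beta>. (\<forall>i\<in>I. \<beta> i \<in> F q i) \<Longrightarrow> wmul s (u0, line_point I p e \<beta>) \<in> C \<and>
         (\<forall>a. wmul s (u0 @ [a] @ e0 a, line_point I p e \<beta>) \<in> C)"
      using q(2) unfolding has_line_def by auto
    let ?p = "\<lambda>i. snd s i @ p i"
    have eq: "wmul s (v, line_point I p e \<beta>) = (fst s @ v, line_point I ?p e \<beta>)" for v \<beta>
      using s(1) by (auto simp: wmul_def line_point_def W_def)
    have "has_line I (?G N) (F q) C"
      unfolding has_line_def
    proof (intro exI[of _ "fst s @ u0"] exI[of _ e0] exI[of _ ?p] exI[of _ e] conjI allI impI ballI)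
      fix \<beta> assume "\<forall>i\<in>I. \<beta> i \<in> F q i"
      note pe(2)[OF this, unfolded eq]
      then show "(fst s @ u0, line_point I ?p e \<beta>) \<in> C"
        "((fst s @ u0) @ [a] @ e0 a, line_point I ?p e \<beta>) \<in> C" for a
        by simp_all
    next
      fix i assume "i \<in> I"
      then show "snd s i @ p i \<in> lists (?G N i)" using pe(1) s(1) by (auto simp: W_def)
    next
      fix i b assume "i \<in> I" "b \<in> F q i"
      then show "e i b \<in> lists (?G N i)" using pe(1) by blast
    qed
    then show "\<exists>q\<ge>N. has_line I (?G N) (F q) C" using q(1) by blast
  qed
qed

section \<open>Structures, trees and branches\<close>

lemma embedding_induced:
  "embedding k f A (induced B Y) \<longleftrightarrow> embedding k f A B \<and> f ` univ A \<subseteq> Y"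
  unfolding embedding_def induced_def by (auto simp: image_subset_iff)

lemma embedding_comp:
  assumes "embedding k f A B" "embedding k g B C"
  shows "embedding k (g \<circ> f) A C"
proof -
  have B: "f x \<in> univ B" if "x \<in> univ A" for x using assms(1) that by (auto simp: embedding_def)
  have "inj_on f (univ A)" "inj_on g (f ` univ A)"
    using assms by (auto simp: embedding_def elim: inj_on_subset)
  then have "inj_on (g \<circ> f) (univ A)" by (rule comp_inj_on)
  then show ?thesis using assms B by (auto simp: embedding_def)
qed

lemma embedding_inv:
  assumes "isomorphism k f A B"
  shows "isomorphism k (inv_into (univ A) f) B A"
proof -
  let ?g = "inv_into (univ A) f"
  have f: "inj_on f (univ A)" "f ` univ A = univ B"
    using assms by (auto simp: isomorphism_def embedding_def)
  have g: "?g y \<in> univ A" "f (?g y) = y" if "y \<in> univ B" for y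
    using f that by (metis inv_into_into, metis f_inv_into_f)
  have "inj_on ?g (univ B)" using g by (metis inj_onI)
  moreover have "?g ` univ B = univ A" using f by (metis inv_into_image_cancel subset_refl)
  ultimately show ?thesis
    using assms g by (auto simp: isomorphism_def embedding_def)
qed

lemma isomorphic_sym: "isomorphic k A B \<Longrightarrow> isomorphic k B A"
  unfolding isomorphic_def using embedding_inv by blast

lemma isomorphic_trans:
  assumes "isomorphic k A B" "isomorphic k B C"
  shows "isomorphic k A C"
proof -
  obtain f g where "isomorphism k f A B" "isomorphism k g B C"
    using assms unfolding isomorphic_def by (elim exE)
  then have "isomorphism k (g \<circ> f) A C"
    unfolding isomorphism_def using embedding_comp[of k f A B g C] by (metis image_comp)
  then show ?thesis unfolding isomorphic_def by blast
qed

lemma embedding_restrict: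
  assumes "embedding k f A B" "Y \<subseteq> univ A"
  shows "isomorphism k f (induced A Y) (induced B (f ` Y))"
  using assms unfolding isomorphism_def embedding_def induced_def inj_on_def by auto

lemma univ_induced: "univ (induced A Y) = univ A \<inter> Y"
  by (simp add: induced_def)

lemma isomorphic_card: "isomorphic k A B \<Longrightarrow> card (univ A) = card (univ B)"
  unfolding isomorphic_def isomorphism_def embedding_def by (metis card_image)

section \<open>Initial segments of branches, and trees generated by levels\<close>

lemma length_restr [simp]: "length (restr x n) = n"
  by (simp add: restr_def)

abbreviation restrs :: "nat \<Rightarrow> (nat \<Rightarrow> nat) set \<Rightarrow> nat list set" where
  "restrs n X \<equiv> (\<lambda>x. restr x n) ` X"

lemma restr_eq_iff: "restr x n = restr y n \<longleftrightarrow> (\<forall>i<n. x i = y i)"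
  by (auto simp: restr_def list_eq_iff_nth_eq)

lemma take_restr: "take m (restr x n) = restr x (min m n)"
  by (simp add: restr_def take_map take_upt min_def)

lemma restr_Suc: "restr x (Suc n) = restr x n @ [x n]"
  by (simp add: restr_def)

definition passes :: "(nat \<Rightarrow> nat) \<Rightarrow> nat list \<Rightarrow> bool" where
  "passes x t \<longleftrightarrow> restr x (length t) = t"

lemma passes_restr [simp]: "passes x (restr x n)"
  by (simp add: passes_def)

lemma passes_prefix: "passes x t \<Longrightarrow> prefix s t \<Longrightarrow> passes x s"
  unfolding passes_def
  by (metis append_eq_conv_conj min_absorb1 prefix_def prefix_length_le take_restr)

lemma prefix_restr: "m \<le> n \<Longrightarrow> prefix (restr x m) (restr x n)"
  by (metis min_absorb1 take_is_prefix take_restr)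

lemma passes_shorter: "passes x s \<Longrightarrow> passes x t \<Longrightarrow> length s \<le> length t \<Longrightarrow> prefix s t"
  unfolding passes_def by (metis prefix_restr)

lemma passes_comparable: "passes x s \<Longrightarrow> passes x t \<Longrightarrow> prefix s t \<or> prefix t s"
  using passes_shorter by (meson nat_le_linear)

lemma passes_same_length: "passes x s \<Longrightarrow> passes x t \<Longrightarrow> length s = length t \<Longrightarrow> s = t"
  by (simp add: passes_def)

lemma branches_passes: "x \<in> branches R \<Longrightarrow> passes x t \<Longrightarrow> t \<in> R"
  unfolding branches_def passes_def by (metis mem_Collect_eq)

lemma branches_mono: "R \<subseteq> R' \<Longrightarrow> branches R \<subseteq> branches R'"
  by (auto simp: branches_def)

lemma tsucc_mono: "R \<subseteq> R' \<Longrightarrow> tsucc R t \<subseteq> tsucc R' t"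
  by (auto simp: tsucc_def)

lemma tsucc_length: "s \<in> tsucc R t \<Longrightarrow> length s = Suc (length t)"
  by (auto simp: tsucc_def)

lemma tsucc_prefix: "s \<in> tsucc R t \<Longrightarrow> prefix t s"
  by (auto simp: tsucc_def)

definition cone :: "nat list set \<Rightarrow> nat list \<Rightarrow> nat list set" where
  "cone R v = {t \<in> R. prefix t v \<or> prefix v t}"

definition downset :: "(nat \<Rightarrow> nat list set) \<Rightarrow> nat list set" where
  "downset V = {s. \<exists>n. \<exists>v\<in>V n. prefix s v}"

lemma downsetI: "v \<in> V n \<Longrightarrow> prefix s v \<Longrightarrow> s \<in> downset V"
  by (auto simp: downset_def)

lemma downset_ancestor:
  assumes "\<And>n v. v \<in> V (Suc n) \<Longrightarrow> \<exists>v'\<in>V n. prefix v' v" "n \<le> m" "v \<in> V m"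
  shows "\<exists>v'\<in>V n. prefix v' v"
  using assms(2,3)
proof (induction m arbitrary: v rule: dec_induct)
  case base
  then show ?case by blast
next
  case (step m)
  obtain v1 where "v1 \<in> V m" "prefix v1 v" using assms(1)[OF step.prems] by blast
  then show ?case using step.IH by (meson prefix_order.trans)
qed

text \<open>The number \<open>b\<close> bounds the lengths of all nodes in the stages up to
  \<open>n\<close>. A node of some stage above the restriction of \<open>x\<close> to
  \<open>Suc b\<close> thus comes from a stage after \<open>n\<close>, and its ancestor in
  \<open>V n\<close> is an initial segment of \<open>x\<close>.\<close>

lemma branch_downset:
  assumes fin: "\<And>n. finite (V n)"
    and anc: "\<And>n v. v \<in> V (Suc n) \<Longrightarrow> \<exists>v'\<in>V n. prefix v' v"
    and x: "x \<in> branches (downset V)"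
  shows "\<exists>v\<in>V n. passes x v"
proof -
  have "finite (\<Union>m\<le>n. V m)" using fin by simp
  then obtain b where b: "\<And>v. v \<in> (\<Union>m\<le>n. V m) \<Longrightarrow> length v \<le> b"
    using finite_imageI[of _ length] by (metis finite_nat_set_iff_bounded_le imageI)
  let ?r = "restr x (Suc b)"
  have "?r \<in> downset V" using x by (simp add: branches_def)
  then obtain m v where v: "v \<in> V m" "prefix ?r v" by (auto simp: downset_def)
  have len: "Suc b \<le> length v" using prefix_length_le[OF v(2)] by simp
  have "\<not> m \<le> n"
  proof
    assume "m \<le> n"
    then have "length v \<le> b" using b v(1) by blast
    then show False using len by simp
  qed
  then obtain v' where v': "v' \<in> V n" "prefix v' v"
    using downset_ancestor[of V n m v] anc v(1) by (meson nat_le_linear)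
  have "length v' \<le> b" using b v'(1) by blast
  then have "prefix v' ?r" using v' v(2) len by (metis length_restr le_SucI prefix_length_prefix)
  then show ?thesis using v'(1) passes_prefix passes_restr by blast
qed

section \<open>Ramsey classes, trees with a stem, and copies inside one node\<close>

locale ramsey_class =
  fixes k :: nat and K :: "nat ostruct set" and M :: "nat ostruct" and F :: "nat list \<Rightarrow> nat list ostruct"
  assumes fraisse: "fraisse_class k K"
    and ramsey: "ramsey_property k K"
    and loops: "uniform_loops k K"
    and nodes: "node_structures k K M F"
begin

lemma K_hereditary: "B \<in> K \<Longrightarrow> ordered_structure k A \<Longrightarrow> embeds k A B \<Longrightarrow> A \<in> K"
  using fraisse unfolding fraisse_class_def by blast

lemma K_joint: "A \<in> K \<Longrightarrow> B \<in> K \<Longrightarrow> \<exists>C\<in>K. embeds k A C \<and> embeds k B C"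
  using fraisse unfolding fraisse_class_def by blast

lemma K_nonempty: "A \<in> K \<Longrightarrow> univ A \<noteq> {}" and K_finite: "A \<in> K \<Longrightarrow> finite (univ A)"
  and K_ordered: "A \<in> K \<Longrightarrow> ordered_structure k A"
  using fraisse unfolding fraisse_class_def ordered_structure_def by blast+

lemma K_ex: "\<exists>A. A \<in> K"
  using fraisse unfolding fraisse_class_def by blast

lemma embeds_trans: "embeds k A B \<Longrightarrow> embeds k B C \<Longrightarrow> embeds k A C"
  unfolding embeds_def using embedding_comp by blast

text \<open>Joint embedding along an enumeration of the isomorphism types gives an increasing chain.
  It reduces the demands of all members of \<open>K\<close> to those of one sequence, where each
  demand may be met by any late enough term.\<close>

lemma cofinal_chain:
  "\<exists>As :: nat \<Rightarrow> nat ostruct. (\<forall>q. As q \<in> K) \<and> (\<forall>A\<in>K. \<exists>m. \<forall>q\<ge>m. embeds k A (As q))"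
proof -
  obtain R where R: "countable R" "R \<subseteq> K" "\<forall>A\<in>K. \<exists>B\<in>R. isomorphic k A B"
    using fraisse unfolding fraisse_class_def by blast
  have ne: "R \<noteq> {}" using K_ex R(3) by blast
  have r: "from_nat_into R n \<in> K" for n by (rule subsetD[OF R(2) from_nat_into[OF ne]])
  have "\<exists>As :: nat \<Rightarrow> nat ostruct. \<forall>n. As n \<in> K \<and> (embeds k (As n) (As (Suc n)) \<and> embeds k (from_nat_into R n) (As (Suc n)))"
  proof (rule dependent_nat_choice)
    show "\<exists>x. x \<in> K" by (rule K_ex)
    fix A n assume "A \<in> K"
    then show "\<exists>B. B \<in> K \<and> (embeds k A B \<and> embeds k (from_nat_into R n) B)"
      using K_joint[OF _ r[of n], of A] unfolding Bex_def by simp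
  qed
  then obtain As where As0: "\<forall>n. As n \<in> K \<and> (embeds k (As n) (As (Suc n)) \<and> embeds k (from_nat_into R n) (As (Suc n)))" ..
  have As: "As n \<in> K" "embeds k (As n) (As (Suc n))" "embeds k (from_nat_into R n) (As (Suc n))" for n
    using As0 by simp_all
  have mono: "embeds k (As m) (As q)" if "m \<le> q" for m q
    using that
  proof (induction q rule: dec_induct)
    case base
    have "embedding k id (As m) (As m)" by (auto simp: embedding_def)
    then show ?case unfolding embeds_def by blast
  next
    case (step q)
    then show ?case using As(2) embeds_trans by blast
  qed
  have "\<exists>m. \<forall>q\<ge>m. embeds k A (As q)" if A: "A \<in> K" for A
  proof -
    obtain B where B: "B \<in> R" "isomorphic k A B" using R(3) A by blast
    obtain n where n: "from_nat_into R n = B" using from_nat_into_surj[OF R(1) B(1)] ..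
    have "embeds k A B" using B(2) unfolding isomorphic_def isomorphism_def embeds_def by blast
    then have "embeds k A (As (Suc n))" using As(3)[of n] n embeds_trans[of A B] by simp
    then have "embeds k A (As q)" if "Suc n \<le> q" for q using mono[OF that] embeds_trans by blast
    then show ?thesis by blast
  qed
  then show ?thesis using As(1) by (intro exI[of _ As]) simp
qed

abbreviation ftree :: "nat list set \<Rightarrow> bool" where "ftree \<equiv> Fmax_tree k K F"

lemma ftree_prefix: "ftree R \<Longrightarrow> t \<in> R \<Longrightarrow> prefix s t \<Longrightarrow> s \<in> R"
  by (auto simp: Fmax_tree_def is_tree_def)

lemma ftree_Tmax: "ftree R \<Longrightarrow> R \<subseteq> Tmax"
  by (simp add: Fmax_tree_def)

lemma ftree_split:
  assumes "ftree R" "t \<in> R" "A \<in> K"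
  shows "\<exists>w f. w \<in> R \<and> prefix t w \<and> embedding k f A (F w) \<and> f ` univ A \<subseteq> tsucc R w"
  using assms unfolding Fmax_tree_def embeds_def embedding_induced by blast

lemma ftree_Nil: "ftree R \<Longrightarrow> [] \<in> R"
  by (auto simp: Fmax_tree_def is_tree_def)

lemma ftree_succ:
  assumes "ftree R" "t \<in> R"
  shows "\<exists>i. t @ [i] \<in> R"
proof -
  obtain A where A: "A \<in> K" using K_ex by blast
  obtain w f where w: "prefix t w" "f ` univ A \<subseteq> tsucc R w"
    using ftree_split[OF assms A] by blast
  obtain a where "a \<in> univ A" using K_nonempty[OF A] by blast
  then obtain i where i: "w @ [i] \<in> R" using w(2) by (auto simp: tsucc_def)
  obtain z where "w = t @ z" using w(1) by (auto simp: prefix_def)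
  then have "\<exists>j. prefix (t @ [j]) (w @ [i])" by (cases z) auto
  then show ?thesis using i ftree_prefix[OF assms(1)] by blast
qed

lemma branch_through:
  assumes R: "ftree R" and t: "t \<in> R"
  shows "\<exists>x\<in>branches R. passes x t"
proof -
  obtain h where h: "\<And>s. s \<in> R \<Longrightarrow> s @ [h s] \<in> R" using ftree_succ[OF R] by metis
  define g where "g n = ((\<lambda>s. s @ [h s]) ^^ n) t" for n
  have gR: "g n \<in> R" for n by (induction n) (auto simp: g_def t h)
  have gS: "g (Suc n) = g n @ [h (g n)]" for n by (simp add: g_def)
  have len: "length (g n) = length t + n" for n by (induction n) (auto simp: g_def)
  have pre: "prefix (g m) (g n)" if "m \<le> n" for m n
    using that by (induction n rule: dec_induct) (auto simp: gS)
  define x where "x i = g (Suc i) ! i" for i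
  have "restr x n = take n (g n)" for n
  proof (rule nth_equalityI)
    show "length (restr x n) = length (take n (g n))" by (simp add: len)
    fix i assume "i < length (restr x n)"
    then have i: "i < n" by simp
    have "g (Suc i) ! i = g n ! i"
      using pre[of "Suc i" n] i len[of "Suc i"] by (auto simp: prefix_def nth_append)
    then show "restr x n ! i = take n (g n) ! i" using i by (simp add: restr_def x_def)
  qed
  then have r: "prefix (restr x n) (g n)" for n by (metis take_is_prefix)
  then have "x \<in> branches R" using gR ftree_prefix[OF R] by (auto simp: branches_def)
  moreover have "passes x t"
  proof -
    let ?n = "length t"
    have "restr x ?n = take ?n (g ?n)" using \<open>\<And>n. restr x n = take n (g n)\<close> .
    moreover have "prefix t (g ?n)" using pre[of 0 ?n] by (simp add: g_def)
    ultimately show ?thesis by (auto simp: passes_def prefix_def)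
  qed
  ultimately show ?thesis by blast
qed

text \<open>One fixed branch through each node turns tuples of nodes into sets of branches that can
  be coloured.\<close>

definition br :: "nat list set \<Rightarrow> nat list \<Rightarrow> nat \<Rightarrow> nat" where
  "br R t = (SOME x. x \<in> branches R \<and> passes x t)"

lemma br:
  assumes "ftree R" "t \<in> R"
  shows "br R t \<in> branches R" "passes (br R t) t"
proof -
  have "br R t \<in> branches R \<and> passes (br R t) t"
    unfolding br_def by (rule someI_ex[of "\<lambda>x. x \<in> branches R \<and> passes x t"])
      (use branch_through[OF assms] in blast)
  then show "br R t \<in> branches R" "passes (br R t) t" by auto
qed

lemma br_restr: "ftree R \<Longrightarrow> t \<in> R \<Longrightarrow> restr (br R t) n \<in> R"
  using br(1) by (auto simp: branches_def)

lemma br_prefix: "ftree R \<Longrightarrow> t \<in> R \<Longrightarrow> length t \<le> n \<Longrightarrow> prefix t (restr (br R t) n)"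
  using br(2) passes_shorter passes_restr by (metis length_restr)

text \<open>All branches of such a tree pass through \<open>v\<close>, so a family of them, one for
  each node of a level, can be shrunk independently.\<close>

definition stem_tree :: "nat list set \<Rightarrow> nat list set \<Rightarrow> nat list \<Rightarrow> bool" where
  "stem_tree T R v \<longleftrightarrow> ftree R \<and> R \<subseteq> T \<and> v \<in> R \<and> (\<forall>t\<in>R. prefix t v \<or> prefix v t)"

lemma stem_tree_branch:
  assumes "stem_tree T R v" "x \<in> branches R"
  shows "passes x v"
proof -
  have "restr x (length v) \<in> R" using assms(2) by (auto simp: branches_def)
  then have "prefix (restr x (length v)) v \<or> prefix v (restr x (length v))"
    using assms(1) by (auto simp: stem_tree_def)
  then have "restr x (length v) = v" by (metis length_restr prefix_order.eq_iff passes_def passes_prefix passes_restr same_prefix_prefix prefix_length_prefix prefix_order.refl order_refl)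
  then show ?thesis by (simp add: passes_def)
qed

lemma stem_tree_cone:
  assumes R: "ftree R" and v: "v \<in> R"
  shows "stem_tree R (cone R v) v"
proof -
  have "ftree (cone R v)"
    unfolding Fmax_tree_def
  proof (intro conjI ballI)
    show "is_tree (cone R v)"
      unfolding is_tree_def
    proof (intro conjI ballI allI impI)
      show "cone R v \<noteq> {}" using v by (auto simp: cone_def)
      fix t s assume t: "t \<in> cone R v" "prefix s t"
      then have "s \<in> R" using ftree_prefix[OF R] by (auto simp: cone_def)
      moreover have "prefix s v \<or> prefix v s"
        using t prefix_same_cases[of v t s] prefix_order.trans[of s t v] by (auto simp: cone_def)
      ultimately show "s \<in> cone R v" by (simp add: cone_def)
    qed
    show "cone R v \<subseteq> Tmax" using ftree_Tmax[OF R] by (auto simp: cone_def)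
    fix A t assume A: "A \<in> K" and t: "t \<in> cone R v"
    define t' where "t' = (if prefix t v then v else t)"
    have t': "t' \<in> R" "prefix v t'" "prefix t t'" using t v by (auto simp: t'_def cone_def)
    obtain w f where w: "w \<in> R" "prefix t' w" "embedding k f A (F w)" "f ` univ A \<subseteq> tsucc R w"
      using ftree_split[OF R t'(1) A] by blast
    have vw: "prefix v w" using t' w by (meson prefix_order.trans)
    have "f ` univ A \<subseteq> tsucc (cone R v) w"
      using w(4) vw by (auto simp: tsucc_def cone_def)
    moreover have "w \<in> cone R v" "prefix t w" using w vw t' by (auto simp: cone_def)
    ultimately show "\<exists>s\<in>cone R v. prefix t s \<and> embeds k A (induced (F s) (tsucc (cone R v) s))"
      using w(3) unfolding embeds_def embedding_induced by blast
  qed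
  then show ?thesis using v by (auto simp: stem_tree_def cone_def)
qed

lemma stem_tree_mono: "stem_tree T R v \<Longrightarrow> T \<subseteq> T' \<Longrightarrow> stem_tree T' R v"
  by (auto simp: stem_tree_def)

text \<open>Splittings need only be supplied at the recorded nodes, since each node of the generated
  tree has a recorded node above it; the successors used must themselves be extended by recorded
  nodes.\<close>

lemma ftree_downset:
  assumes T: "ftree T" and V0: "V 0 \<noteq> {}" and sub: "\<And>n. V n \<subseteq> T"
    and split: "\<And>n v A. v \<in> V n \<Longrightarrow> A \<in> K \<Longrightarrow> \<exists>w f m. prefix v w \<and> embedding k f A (F w) \<and>
      f ` univ A \<subseteq> tsucc T w \<and> (\<forall>a\<in>univ A. \<exists>v'\<in>V m. prefix (f a) v')"
  shows "ftree (downset V)" "downset V \<subseteq> T"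
proof -
  show subT: "downset V \<subseteq> T"
    using sub ftree_prefix[OF T] unfolding downset_def by blast
  show "ftree (downset V)"
    unfolding Fmax_tree_def
  proof (intro conjI ballI)
    show "is_tree (downset V)"
      unfolding is_tree_def downset_def using V0 by (auto intro: prefix_order.trans)
    show "downset V \<subseteq> Tmax" using subT ftree_Tmax[OF T] by blast
    fix A t assume A: "A \<in> K" and t: "t \<in> downset V"
    obtain n v where v: "v \<in> V n" "prefix t v" using t by (auto simp: downset_def)
    obtain w f m where w: "prefix v w" "embedding k f A (F w)" "f ` univ A \<subseteq> tsucc T w"
      "\<forall>a\<in>univ A. \<exists>v'\<in>V m. prefix (f a) v'"
      using split[OF v(1) A] by blast
    have fD: "f a \<in> downset V" if "a \<in> univ A" for a using w(4) that by (auto intro: downsetI)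
    then have sub: "f ` univ A \<subseteq> tsucc (downset V) w" using w(3) by (auto simp: tsucc_def)
    obtain a where a: "a \<in> univ A" using K_nonempty[OF A] by blast
    obtain v' where "v' \<in> V m" "prefix (f a) v'" using w(4) a by blast
    moreover have "prefix w (f a)" using w(3) a by (auto intro: tsucc_prefix)
    ultimately have "w \<in> downset V" by (meson downsetI prefix_order.trans)
    moreover have "prefix t w" using v(2) w(1) by (meson prefix_order.trans)
    ultimately show "\<exists>s\<in>downset V. prefix t s \<and> embeds k A (induced (F s) (tsucc (downset V) s))"
      using w(2) sub unfolding embeds_def embedding_induced by blast
  qed
qed

lemma univ_F: "t \<in> Tmax \<Longrightarrow> univ (F t) = tsucc Tmax t"
  using nodes unfolding node_structures_def by blast

text \<open>Copies of \<open>A\<close> on the successors of a node are represented by their universes.\<close>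

definition full_copy ::
  "nat list set \<Rightarrow> nat list \<Rightarrow> nat ostruct \<Rightarrow> nat ostruct \<Rightarrow> nat list set set \<Rightarrow> bool" where
  "full_copy R t A B C \<longleftrightarrow> (\<exists>w f. w \<in> R \<and> prefix t w \<and> embedding k f B (F w) \<and>
     f ` univ B \<subseteq> tsucc R w \<and> (\<forall>P. P \<subseteq> f ` univ B \<and> isomorphic k (induced (F w) P) A \<longrightarrow> P \<in> C))"

text \<open>The Ramsey property applies to \<open>A\<close> inside a structure \<open>B'\<close>
  containing both \<open>A\<close> and \<open>B\<close>. The structure \<open>D\<close> it provides
  occurs at some node above \<open>t\<close>, and a copy of \<open>B\<close> is found within the
  homogeneous copy of \<open>B'\<close>.\<close>

lemma full_copy_colouring:
  assumes R: "ftree R" and t: "t \<in> R" and A: "A \<in> K" and B: "B \<in> K" and \<kappa>: "\<And>P. \<kappa> P < (r::nat)"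
  shows "\<exists>i<r. full_copy R t A B {P. \<kappa> P = i}"
proof -
  obtain B' where B': "B' \<in> K" "embeds k A B'" "embeds k B B'" using K_joint[OF A B] by blast
  let ?l = "max r 2"
  obtain D where D: "D \<in> K" and DR: "\<And>c. c \<in> copies k D A \<rightarrow> {..<?l} \<Longrightarrow>
          (\<exists>X\<in>copies k D B'. \<exists>i<?l. \<forall>Y\<in>copies k D A. Y \<subseteq> X \<longrightarrow> c Y = i)"
    using ramsey[unfolded ramsey_property_def, rule_format, OF A B'(1,2), of ?l] by auto
  obtain w g where w: "w \<in> R" "prefix t w" and g: "embedding k g D (F w)" "g ` univ D \<subseteq> tsucc R w"
    using ftree_split[OF R t D] by blast
  have "(\<lambda>Y. \<kappa> (g ` Y)) \<in> copies k D A \<rightarrow> {..<?l}" using \<kappa> by (auto simp: less_max_iff_disj)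
  from DR[OF this] obtain X i where X: "X \<in> copies k D B'"
    and i0: "\<forall>Y\<in>copies k D A. Y \<subseteq> X \<longrightarrow> \<kappa> (g ` Y) = i" by (elim bexE exE conjE)
  have i: "\<kappa> (g ` Y) = i" if "Y \<in> copies k D A" "Y \<subseteq> X" for Y using i0 that by simp
  have XD: "X \<subseteq> univ D" using X by (simp add: copies_def)
  obtain h where h: "isomorphism k h (induced D X) B'"
    using X unfolding copies_def isomorphic_def by auto
  obtain b where b: "embedding k b B B'" using B'(3) unfolding embeds_def by blast
  let ?h' = "inv_into (univ (induced D X)) h"
  have h': "embedding k ?h' B' (induced D X)" using embedding_inv[OF h] by (simp add: isomorphism_def)
  have e: "embedding k (?h' \<circ> b) B D" "(?h' \<circ> b) ` univ B \<subseteq> X"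
    using embedding_comp[OF b h'] by (simp_all add: embedding_induced)
  let ?f = "g \<circ> (?h' \<circ> b)"
  have f: "embedding k ?f B (F w)" by (rule embedding_comp[OF e(1) g(1)])
  have fX: "?f ` univ B \<subseteq> g ` X" using e(2) by (metis image_comp image_mono)
  then have fT: "?f ` univ B \<subseteq> tsucc R w" using g(2) XD by blast
  have key: "\<kappa> P = i" if P: "P \<subseteq> ?f ` univ B" "isomorphic k (induced (F w) P) A" for P
  proof -
    define Y where "Y = {y \<in> X. g y \<in> P}"
    have "P \<subseteq> g ` X" using P(1) fX by (rule subset_trans)
    then have gY: "g ` Y = P" by (auto simp: Y_def)
    have YD: "Y \<subseteq> univ D" using XD by (auto simp: Y_def)
    have "isomorphic k (induced D Y) (induced (F w) P)"
      using embedding_restrict[OF g(1) YD] unfolding gY isomorphic_def by blast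
    then have "isomorphic k (induced D Y) A" using P(2) isomorphic_trans by blast
    then have "Y \<in> copies k D A" using YD by (simp add: copies_def)
    then show ?thesis using i[of Y] gY by (auto simp: Y_def)
  qed
  \<comment> \<open>Homogeneity gives a colour below \<open>max r 2\<close> only. If it is not below
    \<open>r\<close>, then the copy of \<open>B\<close> contains no copy of \<open>A\<close> and any
    colour serves.\<close>
  define j where "j = (if i < r then i else 0)"
  have "j < r" using \<kappa>[of "{}"] by (auto simp: j_def)
  moreover have "\<kappa> P = j" if "P \<subseteq> ?f ` univ B" "isomorphic k (induced (F w) P) A" for P
    using key[OF that] \<kappa>[of P] by (auto simp: j_def)
  ultimately have "full_copy R t A B {P. \<kappa> P = j}"
    unfolding full_copy_def using w f fT by (intro exI[of _ w] exI[of _ ?f]) auto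
  then show ?thesis using \<open>j < r\<close> by blast
qed

lemma full_copy_ultrafilter:
  fixes As :: "nat \<Rightarrow> nat ostruct"
  assumes R: "ftree R" and t: "t \<in> R" and A: "A \<in> K" and As: "\<And>q. As q \<in> K"
  shows "\<exists>p. ultra p \<and> (\<forall>C\<in>p. \<forall>N. \<exists>q\<ge>N. full_copy R t A (As q) C)"
proof -
  have "\<exists>p. ultra p \<and> (\<forall>C\<in>p. \<exists>\<^sub>\<infinity>q. full_copy R t A (As q) C)"
  proof (rule ultra_infinitely_often)
    show "full_copy R t A (As q) D" if "full_copy R t A (As q) C" "C \<subseteq> D" for q C D
      using that unfolding full_copy_def by (meson subsetD)
    show "\<exists>i<r. full_copy R t A (As q) {s. \<kappa> s = i}" if "\<And>s. \<kappa> s < r" for q r and \<kappa> :: "_ \<Rightarrow> nat"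
      by (rule full_copy_colouring[OF R t A As that])
  qed
  then show ?thesis by (simp add: INFM_nat_le)
qed

end

section \<open>Configurations with one last splitting node\<close>

context ramsey_class begin

text \<open>Local constancy in terms of finite levels. The bound on the colours concerns arbitrary
  sets, since samples formed from arbitrary sets of nodes are coloured in
  \<open>hue\<close>.\<close>

definition colouring :: "nat \<Rightarrow> nat list set \<Rightarrow> ((nat \<Rightarrow> nat) set \<Rightarrow> nat) \<Rightarrow> nat \<Rightarrow> bool" where
  "colouring n T c r \<longleftrightarrow> (\<forall>X. c X < r) \<and> (\<forall>X\<in>[branches T]\<^bsup>n\<^esup>. \<exists>N. \<forall>Y\<in>[branches T]\<^bsup>n\<^esup>.
     restrs N Y = restrs N X \<longrightarrow> c Y = c X)"

definition config ::
  "nat ostruct \<Rightarrow> (nat list \<Rightarrow> nat list set) \<Rightarrow> nat list \<Rightarrow> nat list set \<Rightarrow> (nat \<Rightarrow> nat) set \<Rightarrow> bool" where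
  "config A R u0 W X \<longleftrightarrow> (\<exists>w P y. prefix u0 w \<and> P \<subseteq> branches (R u0) \<and> (\<forall>x\<in>P. passes x w) \<and>
     inj_on (\<lambda>x. restr x (Suc (length w))) P \<and>
     isomorphic k (induced (F w) (restrs (Suc (length w)) P)) A \<and>
     (\<forall>u\<in>W - {u0}. y u \<in> branches (R u)) \<and> X = P \<union> y ` (W - {u0}))"

end

lemma restr_image_mono:
  assumes "restrs N' Y = restrs N' X" "N \<le> N'"
  shows "restrs N Y = restrs N X"
proof -
  have "restrs N Z = take N ` restrs N' Z" for Z
    using assms(2) by (auto simp: image_image take_restr min_def)
  then show ?thesis using assms(1) by metis
qed

lemma finite_uniform_bound:
  assumes "finite S" "\<And>X. X \<in> S \<Longrightarrow> \<exists>N::nat. Q X N" "\<And>X N N'. Q X N \<Longrightarrow> N \<le> N' \<Longrightarrow> Q X N'"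
  shows "\<exists>N. \<forall>X\<in>S. Q X N"
proof -
  have "\<forall>X\<in>S. \<exists>N. Q X N" using assms(2) by blast
  from bchoice[OF this] obtain h where h: "\<forall>X\<in>S. Q X (h X)" ..
  have "\<forall>X\<in>S. Q X (Max (h ` S))" using assms(1,3) h by (meson Max_ge finite_imageI imageI)
  then show ?thesis by blast
qed

text \<open>The data of one fusion step. The copy of \<open>A\<close> takes the place of one
  element, the one above \<open>u0\<close>, whence \<open>card W + card (univ A) = Suc n\<close>.
  The letter \<open>(q, b)\<close> stands for the element \<open>b\<close> of \<open>As q\<close>,
  so that a letter also tells which structure is to be split off.\<close>

locale splitting = ramsey_class +
  fixes T :: "nat list set" and n r :: nat and c :: "(nat \<Rightarrow> nat) set \<Rightarrow> nat" and A :: "nat ostruct"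
    and W :: "nat list set" and u0 :: "nat list" and R :: "nat list \<Rightarrow> nat list set"
    and As :: "nat \<Rightarrow> nat ostruct"
    and p :: "(nat list list \<times> (nat list \<Rightarrow> (nat \<times> nat) list)) set set"
    and Lt :: "nat \<Rightarrow> (nat \<times> nat) set"
  assumes c: "colouring n T c r"
    and A: "A \<in> K" "2 \<le> card (univ A)"
    and W: "finite W" "u0 \<in> W" "card W + card (univ A) = Suc n"
    and anti: "\<And>u v. u \<in> W \<Longrightarrow> v \<in> W \<Longrightarrow> prefix u v \<Longrightarrow> u = v"
    and R: "\<And>u. u \<in> W \<Longrightarrow> stem_tree T (R u) u"
    and As: "\<And>q. As q \<in> K" and cofinal: "\<And>B. B \<in> K \<Longrightarrow> \<exists>m. \<forall>q\<ge>m. embeds k B (As q)"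
    and Lt: "\<And>q. Lt q = Pair q ` univ (As q)"
    and p: "ultra p" "ultra_prod wmul p p = p"
    and p_line: "\<And>C N. C \<in> p \<Longrightarrow>
      \<exists>q\<ge>N. has_line (W - {u0}) (\<lambda>_. \<Union>q\<in>{N..}. Lt q) (\<lambda>_. Lt q) C"
begin

section \<open>One fusion step: nodes named by words, and the colours of words\<close>

abbreviation I where "I \<equiv> W - {u0}"

lemma R_tree: "u \<in> W \<Longrightarrow> ftree (R u)" and R_T: "u \<in> W \<Longrightarrow> R u \<subseteq> T" and R_stem: "u \<in> W \<Longrightarrow> u \<in> R u"
  using R by (auto simp: stem_tree_def)

lemma R0: "ftree (R u0)" "R u0 \<subseteq> T" "u0 \<in> R u0"
  using R_tree R_T R_stem W(2) by auto

lemma branches_apart: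
  assumes "u \<in> W" "v \<in> W" "x \<in> branches (R u)" "x \<in> branches (R v)"
  shows "u = v"
  using stem_tree_branch[OF R] assms anti passes_comparable by metis

definition split_at :: "nat list set \<Rightarrow> nat list \<Rightarrow> nat \<Rightarrow> nat list \<times> (nat \<Rightarrow> nat list)" where
  "split_at Q t q = (SOME (w, f). w \<in> Q \<and> prefix t w \<and> embedding k f (As q) (F w) \<and>
     f ` univ (As q) \<subseteq> tsucc Q w)"

lemma split_at:
  assumes "ftree Q" "t \<in> Q"
  shows "case split_at Q t q of (w, f) \<Rightarrow> w \<in> Q \<and> prefix t w \<and> embedding k f (As q) (F w) \<and>
     f ` univ (As q) \<subseteq> tsucc Q w"
  unfolding split_at_def
  by (rule someI_ex) (use ftree_split[OF assms As] in auto)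

text \<open>The letter \<open>(q, b)\<close> follows the branch \<open>br (R u) t\<close> at least up to level \<open>q\<close>, and then moves to the
  element \<open>b\<close> of the first copy of \<open>As q\<close>. Following the branch first keeps the later tree inside
  the neighbourhoods on which colours have been determined.\<close>

definition move :: "nat list \<Rightarrow> nat list \<Rightarrow> nat \<times> nat \<Rightarrow> nat list" where
  "move u t a = snd (split_at (R u) (restr (br (R u) t) (max (fst a) (length t))) (fst a)) (snd a)"

lemma move_split:
  assumes u: "u \<in> W" and t: "t \<in> R u"
  shows "\<exists>w f. w \<in> R u \<and> prefix (restr (br (R u) t) (max q (length t))) w \<and> prefix t w \<and>
    embedding k f (As q) (F w) \<and> f ` univ (As q) \<subseteq> tsucc (R u) w \<and> (\<forall>b. move u t (q, b) = f b)"
proof -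
  let ?t = "restr (br (R u) t) (max q (length t))"
  obtain w f where wf: "split_at (R u) ?t q = (w, f)" by (cases "split_at (R u) ?t q")
  have "?t \<in> R u" using br_restr[OF R_tree[OF u] t] .
  then have "w \<in> R u \<and> prefix ?t w \<and> embedding k f (As q) (F w) \<and> f ` univ (As q) \<subseteq> tsucc (R u) w"
    using split_at[OF R_tree[OF u], of ?t q] wf by simp
  moreover have "prefix t ?t" using br_prefix[OF R_tree[OF u] t] by simp
  ultimately show ?thesis
    using wf by (intro exI[of _ w] exI[of _ f]) (auto simp: move_def intro: prefix_order.trans)
qed

lemma move_in:
  assumes u: "u \<in> W" and t: "t \<in> R u" and a: "a \<in> Lt q"
  shows "move u t a \<in> R u" "prefix (restr (br (R u) t) (max q (length t))) (move u t a)" "prefix t (move u t a)"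
proof -
  obtain b where b: "a = (q, b)" "b \<in> univ (As q)" using a by (auto simp: Lt)
  obtain w f where wf: "prefix (restr (br (R u) t) (max q (length t))) w" "prefix t w"
    "f ` univ (As q) \<subseteq> tsucc (R u) w" "\<forall>b. move u t (q, b) = f b"
    using move_split[OF u t, of q] by blast
  have m: "move u t a \<in> tsucc (R u) w" using wf(3,4) b by auto
  then show "move u t a \<in> R u" by (simp add: tsucc_def)
  show "prefix (restr (br (R u) t) (max q (length t))) (move u t a)" "prefix t (move u t a)"
    using wf(1,2) tsucc_prefix[OF m] by (auto intro: prefix_order.trans)
qed

lemma moves_in:
  assumes "u \<in> W" "t \<in> R u" "s \<in> lists (\<Union>q. Lt q)"
  shows "foldl (move u) t s \<in> R u \<and> prefix t (foldl (move u) t s)"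
  using assms(2,3)
proof (induction s arbitrary: t)
  case (Cons a s)
  then obtain q where q: "a \<in> Lt q" by auto
  show ?case using Cons.IH[OF move_in(1)[OF assms(1) Cons.prems(1) q]] Cons.prems
      move_in(3)[OF assms(1) Cons.prems(1) q] by (auto intro: prefix_order.trans)
qed simp

text \<open>The first letter already follows the fixed branch to level \<open>N\<close>, by the
  definition of \<open>move\<close>, and the remaining letters only extend the node. Hence later
  positions agree with the fixed branch as far as colours have been decided.\<close>

lemma moves_first:
  assumes u: "u \<in> W" and t: "t \<in> R u" and s: "s \<in> lists (\<Union>q\<in>{N..}. Lt q)" "s \<noteq> []"
  shows "prefix (restr (br (R u) t) N) (foldl (move u) t s)"
proof -
  obtain a s' where as: "s = a # s'" using s(2) by (cases s) auto
  then obtain q where q: "N \<le> q" "a \<in> Lt q" using s(1) by auto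
  have "prefix (restr (br (R u) t) N) (restr (br (R u) t) (max q (length t)))"
    using q(1) by (intro prefix_restr) simp
  moreover have "prefix (move u t a) (foldl (move u) (move u t a) s')"
    using moves_in[OF u move_in(1)[OF u t q(2)], of s'] s(1) as by auto
  ultimately show ?thesis using move_in(2)[OF u t q(2)] as by (auto intro: prefix_order.trans)
qed

text \<open>In the coordinate \<open>u0\<close> the letters are the nodes themselves: there the copies of \<open>As q\<close> have to be
  chosen depending on the colouring, after the words of the other coordinates.\<close>

definition jump :: "nat list \<Rightarrow> nat list \<Rightarrow> nat list" where
  "jump t a = (if a \<in> R u0 \<and> prefix t a then a else t)"

lemma jumps_in: "t \<in> R u0 \<Longrightarrow> foldl jump t s \<in> R u0 \<and> prefix t (foldl jump t s)"
proof (induction s arbitrary: t)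
  case (Cons a s)
  have "jump t a \<in> R u0" "prefix t (jump t a)" using Cons.prems by (auto simp: jump_def)
  then show ?case using Cons.IH[of "jump t a"] by (auto intro: prefix_order.trans)
qed simp

abbreviation pos :: "nat list \<Rightarrow> (nat \<times> nat) list \<Rightarrow> nat list" where "pos u s \<equiv> foldl (move u) u s"
abbreviation pos0 :: "nat list list \<Rightarrow> nat list" where "pos0 s \<equiv> foldl jump u0 s"

lemma pos0_in: "pos0 s \<in> R u0" using jumps_in R0 by blast

lemma pos_in: "u \<in> W \<Longrightarrow> s \<in> lists (\<Union>q. Lt q) \<Longrightarrow> pos u s \<in> R u"
  using moves_in R_stem by blast

definition copy_ultra :: "nat list \<Rightarrow> nat list set set set" where
  "copy_ultra t = (SOME p. ultra p \<and> (\<forall>C\<in>p. \<forall>N. \<exists>q\<ge>N. full_copy (R u0) t A (As q) C))"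

lemma copy_ultra:
  assumes "t \<in> R u0"
  shows "ultra (copy_ultra t)" "C \<in> copy_ultra t \<Longrightarrow> \<exists>q\<ge>N. full_copy (R u0) t A (As q) C"
proof -
  have "ultra (copy_ultra t) \<and> (\<forall>C\<in>copy_ultra t. \<forall>N. \<exists>q\<ge>N. full_copy (R u0) t A (As q) C)"
    unfolding copy_ultra_def by (rule someI_ex) (rule full_copy_ultrafilter[OF R0(1) assms A(1) As])
  then show "ultra (copy_ultra t)" "C \<in> copy_ultra t \<Longrightarrow> \<exists>q\<ge>N. full_copy (R u0) t A (As q) C" by auto
qed

text \<open>Fixed branches as representatives: by local constancy the colour of an
  \<open>n\<close>-element sample is shared by all \<open>n\<close>-element sets agreeing with it up
  to some level.\<close>

definition sample :: "nat list set \<Rightarrow> (nat list \<Rightarrow> (nat \<times> nat) list) \<Rightarrow> (nat \<Rightarrow> nat) set" where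
  "sample P z = br (R u0) ` P \<union> (\<lambda>u. br (R u) (pos u (z u))) ` I"

definition hue :: "nat list list \<times> (nat list \<Rightarrow> (nat \<times> nat) list) \<Rightarrow> nat" where
  "hue s = (SOME i. i < r \<and> {P. c (sample P (snd s)) = i} \<in> copy_ultra (pos0 (fst s)))"

lemma hue: "hue s < r" "{P. c (sample P (snd s)) = hue s} \<in> copy_ultra (pos0 (fst s))"
proof -
  have "\<exists>i<r. {P. c (sample P (snd s)) = i} \<in> copy_ultra (pos0 (fst s))"
    by (rule ultra_colour[OF copy_ultra(1)[OF pos0_in]]) (use c in \<open>simp add: colouring_def\<close>)
  then have "hue s < r \<and> {P. c (sample P (snd s)) = hue s} \<in> copy_ultra (pos0 (fst s))"
    unfolding hue_def by (rule someI_ex)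
  then show "hue s < r" "{P. c (sample P (snd s)) = hue s} \<in> copy_ultra (pos0 (fst s))" by auto
qed

text \<open>The usual set \<open>C\<^sup>*\<close> of the Galvin-Glazer argument for the colour class \<open>C\<close> of \<open>\<epsilon>\<close>.\<close>

definition stable :: "nat \<Rightarrow> (nat list list \<times> (nat list \<Rightarrow> (nat \<times> nat) list)) set" where
  "stable \<epsilon> = {s. hue s = \<epsilon> \<and> {t. hue (wmul s t) = \<epsilon>} \<in> p}"

lemma stable_in:
  assumes "{s. hue s = \<epsilon>} \<in> p"
  shows "stable \<epsilon> \<in> p"
proof -
  have "{s. {t. wmul s t \<in> {s. hue s = \<epsilon>}} \<in> p} \<in> p"
  proof -
    have "{s. hue s = \<epsilon>} \<in> ultra_prod wmul p p" unfolding p(2) by (rule assms)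
    then show ?thesis unfolding ultra_prod_def mem_Collect_eq .
  qed
  from ultra_Int[OF p(1) assms this] show ?thesis
    by (simp add: stable_def Collect_conj_eq)
qed

text \<open>Idempotency applied to the set of the \<open>t\<close> whose product with
  \<open>s\<close> has hue \<open>\<epsilon>\<close>: almost every \<open>t\<close> lies in it and
  has almost all of its own products in it, which is stability of \<open>wmul s t\<close>.\<close>

lemma stable_shift:
  assumes "s \<in> stable \<epsilon>"
  shows "{t. wmul s t \<in> stable \<epsilon>} \<in> p"
proof -
  let ?E = "{t. hue (wmul s t) = \<epsilon>}"
  have E: "?E \<in> p" using assms by (simp add: stable_def)
  then have "?E \<in> ultra_prod wmul p p" unfolding p(2) .
  then have "{t. {t'. wmul t t' \<in> ?E} \<in> p} \<in> p" unfolding ultra_prod_def mem_Collect_eq .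
  from ultra_Int[OF p(1) E this] show ?thesis
    by (simp add: stable_def Collect_conj_eq wmul_assoc)
qed

lemma sample_nset:
  assumes w: "w \<in> R u0" and P: "P \<subseteq> tsucc (R u0) w" "isomorphic k (induced (F w) P) A"
    and z: "\<And>u. u \<in> I \<Longrightarrow> z u \<in> lists (\<Union>q. Lt q)"
  shows "sample P z \<in> [branches T]\<^bsup>n\<^esup>"
proof -
  have PR: "a \<in> R u0" if "a \<in> P" for a using P(1) that by (auto simp: tsucc_def)
  have "w \<in> Tmax" using w ftree_Tmax[OF R0(1)] by blast
  then have "P \<subseteq> univ (F w)"
    using P(1) tsucc_mono[OF ftree_Tmax[OF R0(1)], of w] by (simp add: univ_F)
  then have "univ (induced (F w) P) = P" by (auto simp: univ_induced)
  then have cP: "card P = card (univ A)" using isomorphic_card[OF P(2)] by simp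
  then have finP: "finite P" using A(2) by (metis card.infinite not_numeral_le_zero)
  have inj1: "inj_on (br (R u0)) P"
  proof (rule inj_onI)
    fix a b assume ab: "a \<in> P" "b \<in> P" "br (R u0) a = br (R u0) b"
    have "passes (br (R u0) a) a" "passes (br (R u0) b) b"
      using br(2)[OF R0(1) PR] ab by blast+
    then have "passes (br (R u0) a) a" "passes (br (R u0) a) b" unfolding ab(3) by simp_all
    moreover have "a \<in> tsucc (R u0) w" "b \<in> tsucc (R u0) w" using P(1) ab by auto
    ultimately have "passes (br (R u0) a) a" "passes (br (R u0) a) b" "length a = length b"
      by (simp_all add: tsucc_length)
    then show "a = b" by (rule passes_same_length)
  qed
  let ?y = "\<lambda>u. br (R u) (pos u (z u))"
  have yb: "?y u \<in> branches (R u)" if "u \<in> I" for u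
    using that br(1)[OF R_tree pos_in] z by simp
  have inj2: "inj_on ?y I"
  proof (rule inj_onI)
    fix u v assume uv: "u \<in> I" "v \<in> I" "?y u = ?y v"
    then have "?y u \<in> branches (R v)" using yb[of v] by simp
    then show "u = v" using branches_apart[OF _ _ yb[of u]] uv by blast
  qed
  have disj: "br (R u0) ` P \<inter> ?y ` I = {}"
  proof -
    have "br (R u0) a \<noteq> ?y u" if a: "a \<in> P" and u: "u \<in> I" for a u
    proof
      assume "br (R u0) a = ?y u"
      then have "br (R u0) a \<in> branches (R u)" using yb[OF u] by simp
      then show False using branches_apart[OF W(2) _ br(1)[OF R0(1) PR[OF a]]] u by blast
    qed
    then show ?thesis by blast
  qed
  have "card (sample P z) = card P + card I"
    unfolding sample_def using card_Un_disjoint[OF _ _ disj] finP W(1) card_image[OF inj1] card_image[OF inj2] by simp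
  also have "\<dots> = n" using cP W(3) card_Suc_Diff1[OF W(1,2)] by linarith
  finally have "card (sample P z) = n" .
  moreover have "sample P z \<subseteq> branches T"
  proof -
    have "?y u \<in> branches T" if "u \<in> I" for u
      using yb[OF that] branches_mono[OF R_T[of u]] that by blast
    moreover have "br (R u0) a \<in> branches T" if "a \<in> P" for a
      using br(1)[OF R0(1) PR[OF that]] branches_mono[OF R0(2)] by blast
    ultimately show ?thesis unfolding sample_def by blast
  qed
  moreover have "finite (sample P z)" using finP W(1) by (simp add: sample_def)
  ultimately show ?thesis by (simp add: nsets_def)
qed

section \<open>The finite states of the construction and the passage from one to the next\<close>

type_synonym state = "nat list list set \<times> (nat list \<Rightarrow> (nat \<times> nat) list set) \<times> nat"

definition choices :: "(nat list \<Rightarrow> (nat \<times> nat) list set) \<Rightarrow> (nat list \<Rightarrow> (nat \<times> nat) list) set" where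
  "choices P = {z. (\<forall>u\<in>I. z u \<in> P u) \<and> (\<forall>u. u \<notin> I \<longrightarrow> z u = [])}"

lemma finite_choices: "(\<And>u. u \<in> I \<Longrightarrow> finite (P u)) \<Longrightarrow> finite (choices P)"
proof -
  assume "\<And>u. u \<in> I \<Longrightarrow> finite (P u)"
  then have "finite {z. \<forall>u. (u \<in> I \<longrightarrow> z u \<in> \<Union>(P ` I)) \<and> (u \<notin> I \<longrightarrow> z u = [])}"
    using W(1) by (intro finite_set_of_finite_funs) auto
  then show "finite (choices P)" by (rule rev_finite_subset) (auto simp: choices_def)
qed

text \<open>In a state \<open>(P0, P, N)\<close> the positions of the words are the current levels
  of the subtrees, and \<open>N\<close> is the level at which the colours fixed so far are decided.
  All mixtures of words must be stable, since a configuration may choose its branches independently.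
  Incomparability in coordinate \<open>u0\<close> serves to recover the splitting node from two
  branches.\<close>

definition invariant :: "nat \<Rightarrow> state \<Rightarrow> bool" where
  "invariant \<epsilon> st \<longleftrightarrow> (case st of (P0, P, N) \<Rightarrow> finite P0 \<and> P0 \<noteq> {} \<and>
     (\<forall>u\<in>I. finite (P u) \<and> P u \<noteq> {} \<and> P u \<subseteq> lists (\<Union>q. Lt q)) \<and>
     (\<forall>s\<in>P0. \<forall>z\<in>choices P. (s, z) \<in> stable \<epsilon>) \<and>
     (\<forall>s\<in>P0. \<forall>s'\<in>P0. prefix (pos0 s) (pos0 s') \<longrightarrow> s = s'))"

text \<open>The copies at \<open>w\<close> are paired with the words of the new state: the line for
  the other coordinates is chosen before the copy, so those words are known at that time.\<close>

definition split0 ::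
  "nat \<Rightarrow> nat \<Rightarrow> state \<Rightarrow> nat list list \<Rightarrow> nat \<Rightarrow> nat list \<Rightarrow> (nat \<Rightarrow> nat list) \<Rightarrow> (nat \<Rightarrow> nat list list) \<Rightarrow> bool" where
  "split0 \<epsilon> m st' s q w f g \<longleftrightarrow> (case st' of (P0', P', N') \<Rightarrow>
     m \<le> q \<and> w \<in> R u0 \<and> prefix (pos0 s) w \<and> embedding k f (As q) (F w) \<and> f ` univ (As q) \<subseteq> tsucc (R u0) w \<and>
     (\<forall>b\<in>univ (As q). prefix (f b) (pos0 (g b)) \<and> prefix (restr (br (R u0) (f b)) N') (pos0 (g b))) \<and>
     (\<forall>P z. P \<subseteq> f ` univ (As q) \<and> isomorphic k (induced (F w) P) A \<and> z \<in> choices P' \<longrightarrow>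
        (\<forall>Y\<in>[branches T]\<^bsup>n\<^esup>. restrs N' Y = (\<lambda>x. restr x N') ` sample P z \<longrightarrow> c Y = \<epsilon>)))"

text \<open>The coordinates are out of step by one: in coordinate \<open>u0\<close> the new
  positions have already followed their fixed branches up to the new level, by
  \<open>split0\<close>, while in the others they follow the branches of the old positions up to the
  old level \<open>N\<close>. The bound \<open>m\<close> on \<open>q\<close> makes every member of
  \<open>K\<close> embed in all structures used from some stage on.\<close>

definition step :: "nat \<Rightarrow> nat \<Rightarrow> state \<Rightarrow> state \<Rightarrow> bool" where
  "step \<epsilon> m st st' \<longleftrightarrow> (case st of (P0, P, N) \<Rightarrow> case st' of (P0', P', N') \<Rightarrow>
     (\<exists>q w f g. P0' = (\<Union>s\<in>P0. g s ` univ (As (q s))) \<and>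
        (\<forall>s\<in>P0. split0 \<epsilon> m st' s (q s) (w s) (f s) (g s))) \<and>
     (\<forall>u\<in>I.
        (\<forall>s\<in>P u. \<exists>q w f. m \<le> q \<and> prefix (pos u s) w \<and> embedding k f (As q) (F w) \<and>
           f ` univ (As q) \<subseteq> tsucc (R u) w \<and> (\<forall>b\<in>univ (As q). \<exists>s'\<in>P' u. prefix (f b) (pos u s'))) \<and>
        (\<forall>s'\<in>P' u. \<exists>s\<in>P u. prefix (pos u s) (pos u s') \<and>
           prefix (restr (br (R u) (pos u s)) N) (pos u s'))))"

text \<open>The order of the choices is essential: a line beyond \<open>N\<close> and
  \<open>m\<close> for the other coordinates, which yields \<open>P'\<close>; then, for each
  \<open>s\<close> in \<open>P0\<close>, a node with a copy of some \<open>As q\<close> all of whose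
  copies of \<open>A\<close> have colour \<open>\<epsilon>\<close> with all tuples from
  \<open>P'\<close>; then a level \<open>N'\<close> deciding these colours; finally the left
  letters, which the line has left open.\<close>

lemma step_ex:
  assumes inv: "invariant \<epsilon> st"
  shows "\<exists>st'. invariant \<epsilon> st' \<and> step \<epsilon> m st st'"
proof -
  obtain P0 P N where st: "st = (P0, P, N)" by (cases st) auto
  let ?L = "\<Union>q. Lt q"
  have P0: "finite P0" "P0 \<noteq> {}"
    and P: "\<And>u. u \<in> I \<Longrightarrow> finite (P u)" "\<And>u. u \<in> I \<Longrightarrow> P u \<noteq> {}" "\<And>u. u \<in> I \<Longrightarrow> P u \<subseteq> lists ?L"
    and stab: "\<And>s z. s \<in> P0 \<Longrightarrow> z \<in> choices P \<Longrightarrow> (s, z) \<in> stable \<epsilon>"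
    and anti0: "\<And>s s'. s \<in> P0 \<Longrightarrow> s' \<in> P0 \<Longrightarrow> prefix (pos0 s) (pos0 s') \<Longrightarrow> s = s'"
    using inv unfolding invariant_def st prod.case by blast+
  have "(\<Inter>x\<in>P0 \<times> choices P. {t. wmul x t \<in> stable \<epsilon>}) \<in> p"
    using P0 finite_choices[of P] P(1) stab by (intro ultra_INT[OF p(1)] stable_shift) auto
  from p_line[OF this, of "max N m"] obtain q v e0 pp ee where q: "max N m \<le> q"
    and pp: "\<forall>u\<in>I. pp u \<in> lists (\<Union>q\<in>{max N m..}. Lt q) \<and> (\<forall>b\<in>Lt q. ee u b \<in> lists (\<Union>q\<in>{max N m..}. Lt q))"
    and ln: "\<forall>\<beta>. (\<forall>i\<in>I. \<beta> i \<in> Lt q) \<longrightarrow>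
        (v, line_point I pp ee \<beta>) \<in> (\<Inter>x\<in>P0 \<times> choices P. {t. wmul x t \<in> stable \<epsilon>}) \<and>
        (\<forall>a. (v @ [a] @ e0 a, line_point I pp ee \<beta>) \<in> (\<Inter>x\<in>P0 \<times> choices P. {t. wmul x t \<in> stable \<epsilon>}))"
    unfolding has_line_def by (elim exE conjE)
  define ext where "ext u s b = s @ pp u @ [(q, b)] @ ee u (q, b)" for u s b
  define P' where "P' u = (\<lambda>(s, b). ext u s b) ` (P u \<times> univ (As q))" for u
  have bL: "(q, b) \<in> Lt q" if "b \<in> univ (As q)" for b using that by (simp add: Lt)
  have tail: "pp u @ [(q, b)] @ ee u (q, b) \<in> lists (\<Union>q\<in>{N..}. Lt q)"
    if "u \<in> I" "b \<in> univ (As q)" for u b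
  proof -
    have "lists (\<Union>q\<in>{max N m..}. Lt q) \<subseteq> lists (\<Union>q\<in>{N..}. Lt q)" by (rule lists_mono) auto
    moreover have "pp u \<in> lists (\<Union>q\<in>{max N m..}. Lt q)" "ee u (q, b) \<in> lists (\<Union>q\<in>{max N m..}. Lt q)"
      using pp that bL[OF that(2)] by blast+
    moreover have "(q, b) \<in> (\<Union>q\<in>{N..}. Lt q)" using bL[OF that(2)] q by auto
    ultimately show ?thesis by auto
  qed
  have tailL: "pp u @ [(q, b)] @ ee u (q, b) \<in> lists ?L" if "u \<in> I" "b \<in> univ (As q)" for u b
    using lists_mono[of "\<Union>q\<in>{N..}. Lt q" ?L] tail[OF that] by blast
  have P'L: "P' u \<subseteq> lists ?L" if "u \<in> I" for u
  proof
    fix s' assume "s' \<in> P' u"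
    then obtain s b where s: "s \<in> P u" "b \<in> univ (As q)" "s' = ext u s b" by (auto simp: P'_def)
    have "s \<in> lists ?L" using P(3)[OF \<open>u \<in> I\<close>] s(1) by blast
    then show "s' \<in> lists ?L" using tailL[OF \<open>u \<in> I\<close> s(2)] unfolding s(3) ext_def
      by (simp only: append_in_lists_conv)
  qed
  have finP': "finite (P' u)" if "u \<in> I" for u using P(1)[OF that] K_finite[OF As] by (simp add: P'_def)
  have P'ne: "P' u \<noteq> {}" if "u \<in> I" for u using P(2)[OF that] K_nonempty[OF As] by (simp add: P'_def)
  \<comment> \<open>Each new tuple is an old tuple multiplied by a point of the line, with the old
    word and the letter chosen separately in each coordinate; this is why mixtures remain
    stable.\<close>
  have ch: "(s @ v, z') \<in> stable \<epsilon> \<and> (\<forall>a. (s @ v @ [a] @ e0 a, z') \<in> stable \<epsilon>)"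
    if s: "s \<in> P0" and z': "z' \<in> choices P'" for s z'
  proof -
    have "\<forall>u\<in>I. \<exists>x. fst x \<in> P u \<and> snd x \<in> univ (As q) \<and> z' u = ext u (fst x) (snd x)"
    proof
      fix u assume "u \<in> I"
      then have "z' u \<in> P' u" using z' unfolding choices_def by blast
      then obtain x where "x \<in> P u \<times> univ (As q)" "z' u = (case x of (s, b) \<Rightarrow> ext u s b)"
        unfolding P'_def by blast
      then show "\<exists>x. fst x \<in> P u \<and> snd x \<in> univ (As q) \<and> z' u = ext u (fst x) (snd x)"
        by (intro exI[of _ x]) (auto simp: case_prod_beta)
    qed
    from bchoice[OF this] obtain x where
      x: "\<forall>u\<in>I. fst (x u) \<in> P u \<and> snd (x u) \<in> univ (As q) \<and> z' u = ext u (fst (x u)) (snd (x u))" ..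
    define z where "z u = (if u \<in> I then fst (x u) else [])" for u
    define \<beta> where "\<beta> u = (q, snd (x u))" for u
    have z: "z \<in> choices P" using x by (auto simp: choices_def z_def)
    have eq: "z' = (\<lambda>u. z u @ line_point I pp ee \<beta> u)"
      using x z' by (auto simp: fun_eq_iff z_def \<beta>_def line_point_def ext_def choices_def)
    have "\<forall>u\<in>I. \<beta> u \<in> Lt q" using x bL by (simp add: \<beta>_def)
    from ln[THEN spec, THEN mp, OF this] s z
    have "wmul (s, z) (v, line_point I pp ee \<beta>) \<in> stable \<epsilon>"
      "\<forall>a. wmul (s, z) (v @ [a] @ e0 a, line_point I pp ee \<beta>) \<in> stable \<epsilon>" by auto
    then show ?thesis by (simp add: wmul_def eq)
  qed
  have finC: "finite (choices P')" by (rule finite_choices) (rule finP')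
  \<comment> \<open>\<open>E\<close> is large because \<open>\<epsilon>\<close> is the limit colour
    of each of the finitely many tuples with left word \<open>s @ v\<close>.\<close>
  define E where "E = (\<Inter>z\<in>choices P'. {B. c (sample B z) = \<epsilon>})"
  define good where "good s q w f \<longleftrightarrow> m \<le> q \<and> w \<in> R u0 \<and> prefix (pos0 (s @ v)) w \<and>
     embedding k f (As q) (F w) \<and> f ` univ (As q) \<subseteq> tsucc (R u0) w \<and>
     (\<forall>B. B \<subseteq> f ` univ (As q) \<and> isomorphic k (induced (F w) B) A \<longrightarrow> B \<in> E)" for s q w f
  have "\<exists>q w f. good s q w f" if s: "s \<in> P0" for s
  proof -
    have "E \<in> copy_ultra (pos0 (s @ v))"
      unfolding E_def
    proof (rule ultra_INT[OF copy_ultra(1)[OF pos0_in] finC])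
      fix z assume "z \<in> choices P'"
      then have "hue (s @ v, z) = \<epsilon>" using ch[OF s] by (simp add: stable_def)
      then show "{B. c (sample B z) = \<epsilon>} \<in> copy_ultra (pos0 (s @ v))" using hue(2)[of "(s @ v, z)"] by simp
    qed
    from copy_ultra(2)[OF pos0_in this, of m] show ?thesis
      unfolding full_copy_def good_def by blast
  qed
  then obtain qf w f where good: "\<And>s. s \<in> P0 \<Longrightarrow> good s (qf s) (w s) (f s)" by metis
  \<comment> \<open>The finitely many samples whose colour has to be preserved; one level
    \<open>N'\<close> decides all of them.\<close>
  define S where "S = (\<Union>s\<in>P0. (\<lambda>(B, z). sample B z) `
    ({B. B \<subseteq> f s ` univ (As (qf s)) \<and> isomorphic k (induced (F (w s)) B) A} \<times> choices P'))"
  have finS: "finite S"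
    unfolding S_def using P0(1) finC K_finite[OF As] by (intro finite_UN_I finite_imageI finite_cartesian_product) auto
  have "\<exists>N'. \<forall>X\<in>S. \<forall>Y\<in>[branches T]\<^bsup>n\<^esup>. restrs N' Y = restrs N' X \<longrightarrow> c Y = \<epsilon>"
  proof (rule finite_uniform_bound[OF finS])
    fix X assume "X \<in> S"
    then obtain s B z where X: "s \<in> P0" "X = sample B z" "B \<subseteq> f s ` univ (As (qf s))"
      "isomorphic k (induced (F (w s)) B) A" "z \<in> choices P'" by (auto simp: S_def)
    have g: "w s \<in> R u0" "B \<subseteq> tsucc (R u0) (w s)" "B \<in> E"
      using good[OF X(1)] X(3,4) by (auto simp: good_def)
    have "z u \<in> lists ?L" if "u \<in> I" for u using X(5) P'L[OF that] that unfolding choices_def by blast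
    then have XT: "X \<in> [branches T]\<^bsup>n\<^esup>" unfolding X(2) by (intro sample_nset[OF g(1,2) X(4)])
    have cX: "c X = \<epsilon>" using g(3) X(2,5) by (simp add: E_def)
    have all: "\<forall>X\<in>[branches T]\<^bsup>n\<^esup>. \<exists>N. \<forall>Y\<in>[branches T]\<^bsup>n\<^esup>.
       restrs N Y = restrs N X \<longrightarrow> c Y = c X" using c unfolding colouring_def ..
    show "\<exists>N'. \<forall>Y\<in>[branches T]\<^bsup>n\<^esup>. restrs N' Y = restrs N' X \<longrightarrow> c Y = \<epsilon>"
      using bspec[OF all XT] unfolding cX .
  next
    show "\<forall>Y\<in>[branches T]\<^bsup>n\<^esup>. restrs N2 Y = restrs N2 X \<longrightarrow> c Y = \<epsilon>"
      if "\<forall>Y\<in>[branches T]\<^bsup>n\<^esup>. restrs N1 Y = restrs N1 X \<longrightarrow> c Y = \<epsilon>" "N1 \<le> N2" for X N1 N2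
    proof (intro ballI impI)
      fix Y assume Y: "Y \<in> [branches T]\<^bsup>n\<^esup>" and eq: "restrs N2 Y = restrs N2 X"
      show "c Y = \<epsilon>" by (rule mp[OF bspec[OF that(1) Y] restr_image_mono[OF eq that(2)]])
    qed
  qed
  then obtain N' where N'0: "\<forall>X\<in>S. \<forall>Y\<in>[branches T]\<^bsup>n\<^esup>.
    restrs N' Y = restrs N' X \<longrightarrow> c Y = \<epsilon>" ..
  have N': "c Y = \<epsilon>" if "X \<in> S" "Y \<in> [branches T]\<^bsup>n\<^esup>"
    "restrs N' Y = restrs N' X" for X Y
    by (rule mp[OF bspec[OF bspec[OF N'0 that(1)] that(2)] that(3)])
  \<comment> \<open>The left letter is the fixed branch through \<open>f s b\<close>, cut no lower
    than \<open>N'\<close> to preserve colours and no lower than \<open>Suc (length (w s))\<close>,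
    the length of \<open>f s b\<close>, to stay above it.\<close>
  define l where "l s b = restr (br (R u0) (f s b)) (max N' (Suc (length (w s))))" for s b
  define g where "g s b = s @ v @ [l s b] @ e0 (l s b)" for s b
  have gl: "prefix (f s b) (pos0 (g s b)) \<and> prefix (restr (br (R u0) (f s b)) N') (pos0 (g s b)) \<and> prefix (pos0 s) (pos0 (g s b))"
    if s: "s \<in> P0" and b: "b \<in> univ (As (qf s))" for s b
  proof -
    have fb: "f s b \<in> tsucc (R u0) (w s)" using good[OF s] b by (auto simp: good_def)
    then have fR: "f s b \<in> R u0" by (simp add: tsucc_def)
    have "l s b \<in> R u0" unfolding l_def by (rule br_restr[OF R0(1) fR])
    moreover have fl: "prefix (f s b) (l s b)"
      unfolding l_def by (rule br_prefix[OF R0(1) fR]) (simp add: tsucc_length[OF fb])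
    moreover have wf: "prefix (pos0 (s @ v)) (f s b)"
      using good[OF s] tsucc_prefix[OF fb] by (auto simp: good_def intro: prefix_order.trans)
    ultimately have "jump (pos0 (s @ v)) (l s b) = l s b" by (auto simp: jump_def intro: prefix_order.trans)
    then have "pos0 (g s b) = foldl jump (l s b) (e0 (l s b))" by (simp add: g_def)
    then have lg: "prefix (l s b) (pos0 (g s b))" using jumps_in[OF \<open>l s b \<in> R u0\<close>] by simp
    have "prefix (pos0 s) (pos0 (s @ v))" using jumps_in[OF pos0_in[of s], of v] by simp
    moreover have "prefix (restr (br (R u0) (f s b)) N') (l s b)" unfolding l_def by (rule prefix_restr) simp
    ultimately show ?thesis using fl wf lg by (meson prefix_order.trans)
  qed
  let ?P0 = "\<Union>s\<in>P0. g s ` univ (As (qf s))"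
  have "invariant \<epsilon> (?P0, P', N')"
    unfolding invariant_def prod.case
  proof (intro conjI ballI impI)
    show "finite ?P0" using P0(1) K_finite[OF As] by simp
    show "?P0 \<noteq> {}" using P0(2) K_nonempty[OF As] by simp
    show "finite (P' u)" "P' u \<noteq> {}" "P' u \<subseteq> lists ?L" if "u \<in> I" for u
      using finP' P'ne P'L that by blast+
    show "(s', z) \<in> stable \<epsilon>" if "s' \<in> ?P0" "z \<in> choices P'" for s' z
      using that ch by (auto simp: g_def)
    fix s1 s2 assume s1: "s1 \<in> ?P0" and s2: "s2 \<in> ?P0" and pre: "prefix (pos0 s1) (pos0 s2)"
    obtain s b where sb: "s \<in> P0" "b \<in> univ (As (qf s))" "s1 = g s b" using s1 by blast
    obtain s' b' where sb': "s' \<in> P0" "b' \<in> univ (As (qf s'))" "s2 = g s' b'" using s2 by blast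
    have "prefix (pos0 s) (pos0 s2)" "prefix (pos0 s') (pos0 s2)"
      using gl[OF sb(1,2)] gl[OF sb'(1,2)] pre sb(3) sb'(3) by (auto intro: prefix_order.trans)
    then have "prefix (pos0 s) (pos0 s') \<or> prefix (pos0 s') (pos0 s)" by (rule prefix_same_cases)
    then have ss: "s = s'" using anti0 sb(1) sb'(1) by blast
    have "prefix (f s b) (pos0 s2)" "prefix (f s b') (pos0 s2)"
      using gl[OF sb(1,2)] gl[OF sb'(1,2)] pre sb(3) sb'(3) ss by (auto intro: prefix_order.trans)
    moreover have "length (f s b) = length (f s b')"
      using good[OF sb(1)] sb(2) sb'(2) ss tsucc_length unfolding good_def by (metis image_subset_iff)
    ultimately have "f s b = f s b'" by (metis prefix_length_prefix prefix_order.antisym order_refl)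
    moreover have "inj_on (f s) (univ (As (qf s)))" using good[OF sb(1)] by (simp add: good_def embedding_def)
    ultimately have "b = b'" using sb(2) sb'(2) ss by (auto dest: inj_onD)
    then show "s1 = s2" using sb(3) sb'(3) ss by simp
  qed
  moreover have "step \<epsilon> m st (?P0, P', N')"
    unfolding step_def st prod.case
  proof (intro conjI ballI exI[of _ qf] exI[of _ w] exI[of _ f] exI[of _ g])
    show "?P0 = ?P0" ..
    fix s assume s: "s \<in> P0"
    have "prefix (pos0 s) (pos0 (s @ v))" using jumps_in[OF pos0_in[of s], of v] by simp
    then have sw: "prefix (pos0 s) (w s)" using good[OF s] by (auto simp: good_def intro: prefix_order.trans)
    have SS: "sample B z \<in> S" if "B \<subseteq> f s ` univ (As (qf s))" "isomorphic k (induced (F (w s)) B) A"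
      "z \<in> choices P'" for B z
      unfolding S_def using s that by (intro UN_I[OF s] image_eqI[of _ _ "(B, z)"]) auto
    show "split0 \<epsilon> m (?P0, P', N') s (qf s) (w s) (f s) (g s)"
      unfolding split0_def prod.case
    proof (intro conjI ballI allI impI)
      show "m \<le> qf s" "w s \<in> R u0" "embedding k (f s) (As (qf s)) (F (w s))"
        "f s ` univ (As (qf s)) \<subseteq> tsucc (R u0) (w s)"
        using good[OF s] by (simp_all add: good_def)
      show "prefix (pos0 s) (w s)" by (rule sw)
      fix b assume b: "b \<in> univ (As (qf s))"
      show "prefix (f s b) (pos0 (g s b))" "prefix (restr (br (R u0) (f s b)) N') (pos0 (g s b))"
        using gl[OF s b] by simp_all
    next
      fix B z Y assume B: "B \<subseteq> f s ` univ (As (qf s)) \<and> isomorphic k (induced (F (w s)) B) A \<and> z \<in> choices P'"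
        and Y: "Y \<in> [branches T]\<^bsup>n\<^esup>" "restrs N' Y = (\<lambda>x. restr x N') ` sample B z"
      show "c Y = \<epsilon>" by (rule N'[OF SS Y]) (use B in auto)
    qed
  next
    fix u s assume u: "u \<in> I" and s: "s \<in> P u"
    \<comment> \<open>The position just before the letter of the line: from here the coordinate
      splits into all of \<open>As q\<close>.\<close>
    let ?t = "foldl (move u) u (s @ pp u)"
    have uW: "u \<in> W" using u by simp
    have pps: "pp u \<in> lists ?L" using tailL[OF u] K_nonempty[OF As, of q] by auto
    have sL: "s \<in> lists ?L" using P(3)[OF u] s by blast
    have tR: "?t \<in> R u" using pps sL by (intro pos_in[OF uW]) auto
    obtain w f where wf: "prefix ?t w" "embedding k f (As q) (F w)"
      "f ` univ (As q) \<subseteq> tsucc (R u) w" "\<forall>b. move u ?t (q, b) = f b"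
      using move_split[OF uW tR, of q] by blast
    have "prefix (pos u s) ?t" using moves_in[OF uW pos_in[OF uW sL] pps] by simp
    then have "prefix (pos u s) w" using wf(1) by (rule prefix_order.trans)
    moreover have "\<exists>s'\<in>P' u. prefix (f b) (pos u s')" if b: "b \<in> univ (As q)" for b
    proof -
      have "f b \<in> R u" using wf(3) b by (auto simp: tsucc_def)
      moreover have "ee u (q, b) \<in> lists ?L" using tailL[OF u b] by simp
      ultimately have "prefix (f b) (foldl (move u) (f b) (ee u (q, b)))" using moves_in[OF uW] by blast
      moreover have "pos u (ext u s b) = foldl (move u) (f b) (ee u (q, b))" using wf(4) by (simp add: ext_def)
      moreover have "ext u s b \<in> P' u" using s b by (auto simp: P'_def)
      ultimately show ?thesis by metis
    qed
    moreover have "m \<le> q" using q by simp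
    ultimately show "\<exists>q w f. m \<le> q \<and> prefix (pos u s) w \<and> embedding k f (As q) (F w) \<and>
           f ` univ (As q) \<subseteq> tsucc (R u) w \<and> (\<forall>b\<in>univ (As q). \<exists>s'\<in>P' u. prefix (f b) (pos u s'))"
      using wf(2,3) by blast
  next
    fix u s' assume u: "u \<in> I" and s': "s' \<in> P' u"
    have uW: "u \<in> W" using u by simp
    obtain s b where s: "s \<in> P u" "b \<in> univ (As q)" "s' = ext u s b" using s' by (auto simp: P'_def)
    have sR: "pos u s \<in> R u" using P(3)[OF u] s(1) pos_in[OF uW] by blast
    have eq: "pos u s' = foldl (move u) (pos u s) (pp u @ [(q, b)] @ ee u (q, b))"
      unfolding s(3) ext_def by (rule foldl_append)
    have "prefix (pos u s) (pos u s')" unfolding eq using moves_in[OF uW sR tailL[OF u s(2)]] ..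
    moreover have "prefix (restr (br (R u) (pos u s)) N) (pos u s')"
      unfolding eq by (rule moves_first[OF uW sR tail[OF u s(2)]]) simp
    ultimately show "\<exists>s\<in>P u. prefix (pos u s) (pos u s') \<and>
           prefix (restr (br (R u) (pos u s)) N) (pos u s')" using s(1) by blast
  qed
  ultimately show ?thesis by blast
qed

end

section \<open>Homogeneous subtrees from a run of the construction\<close>

context ramsey_class begin

text \<open>A demand \<open>A\<close> at a node of \<open>V n\<close> waits for a stage from which
  on \<open>A\<close> embeds in every \<open>As q\<close>; the node is carried forward to that
  stage, where its splitting contains a copy of \<open>A\<close>.\<close>

lemma downset_stem_tree:
  fixes As :: "nat \<Rightarrow> nat ostruct"
  assumes R: "stem_tree T R u" and ne: "V 0 \<noteq> {}" and sub: "\<And>n. V n \<subseteq> R"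
    and u: "\<And>v. v \<in> V 0 \<Longrightarrow> prefix u v"
    and cof: "\<And>B. B \<in> K \<Longrightarrow> \<exists>m. \<forall>q\<ge>m. embeds k B (As q)" and As: "\<And>q. As q \<in> K"
    and split: "\<And>n v. v \<in> V n \<Longrightarrow> \<exists>q w f. n \<le> q \<and> prefix v w \<and> embedding k f (As q) (F w) \<and>
      f ` univ (As q) \<subseteq> tsucc R w \<and> (\<forall>b\<in>univ (As q). \<exists>v'\<in>V (Suc n). prefix (f b) v')"
  shows "stem_tree R (downset V) u"
proof -
  have tR: "ftree R" using R by (simp add: stem_tree_def)
  have fwd1: "\<exists>v'\<in>V (Suc n). prefix v v'" if v: "v \<in> V n" for n v
  proof -
    obtain q w f where *: "prefix v w" "f ` univ (As q) \<subseteq> tsucc R w"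
      "\<forall>b\<in>univ (As q). \<exists>v'\<in>V (Suc n). prefix (f b) v'"
      using split[OF v] by blast
    obtain b where b: "b \<in> univ (As q)" using K_nonempty[OF As[of q]] by blast
    then obtain v' where "v' \<in> V (Suc n)" "prefix (f b) v'" using *(3) by blast
    moreover have "prefix w (f b)" using *(2) b by (auto intro: tsucc_prefix)
    ultimately show ?thesis using *(1) by (meson prefix_order.trans)
  qed
  have fwd: "\<exists>v'\<in>V m. prefix v v'" if "n \<le> m" "v \<in> V n" for n m v
    using that
  proof (induction m rule: dec_induct)
    case base
    then show ?case by blast
  next
    case (step m)
    then obtain v1 where v1: "v1 \<in> V m" "prefix v v1" by blast
    obtain v2 where "v2 \<in> V (Suc m)" "prefix v1 v2" using fwd1[OF v1(1)] by blast
    then show ?case using v1(2) by (meson prefix_order.trans)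
  qed
  have spl: "\<exists>w f m. prefix v w \<and> embedding k f A (F w) \<and> f ` univ A \<subseteq> tsucc R w \<and>
      (\<forall>a\<in>univ A. \<exists>v'\<in>V m. prefix (f a) v')" if v: "v \<in> V n" and A: "A \<in> K" for n v A
  proof -
    obtain m where m: "\<forall>q\<ge>m. embeds k A (As q)" using cof[OF A] ..
    obtain v' where v': "v' \<in> V (max n m)" "prefix v v'" using fwd[OF _ v, of "max n m"] by auto
    obtain q w f where *: "max n m \<le> q" "prefix v' w" "embedding k f (As q) (F w)" "f ` univ (As q) \<subseteq> tsucc R w"
      "\<forall>b\<in>univ (As q). \<exists>v'\<in>V (Suc (max n m)). prefix (f b) v'"
      using split[OF v'(1)] by blast
    obtain e where e: "embedding k e A (As q)" using m *(1) unfolding embeds_def by auto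
    have eu: "e a \<in> univ (As q)" if "a \<in> univ A" for a using e that by (auto simp: embedding_def)
    have "prefix v w" using v'(2) *(2) by (rule prefix_order.trans)
    moreover have "embedding k (f \<circ> e) A (F w)" by (rule embedding_comp[OF e *(3)])
    moreover have "(f \<circ> e) ` univ A \<subseteq> tsucc R w" using *(4) eu by auto
    moreover have "\<forall>a\<in>univ A. \<exists>v'\<in>V (Suc (max n m)). prefix ((f \<circ> e) a) v'" using *(5) eu by simp
    ultimately show ?thesis by blast
  qed
  have "ftree (downset V)" "downset V \<subseteq> R"
    using ftree_downset[where T = R and V = V] tR ne sub spl by blast+
  note d = this
  obtain v where "v \<in> V 0" using ne by blast
  then have "u \<in> downset V" using u by (auto intro: downsetI)
  then show ?thesis using d R unfolding stem_tree_def by blast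
qed

end

context splitting begin

text \<open>A configuration in the limit trees is traced back to the stage \<open>m\<close> at which
  two branches of its copy part. The splitting node of that stage is the node \<open>w0\<close> of
  the configuration, its copy lies in the structure chosen there, and all its branches agree up to
  level \<open>N (Suc m)\<close> with a sample whose colour was fixed at that stage.\<close>

lemma homogeneous:
  "\<exists>R' \<epsilon>. (\<forall>u\<in>W. stem_tree (R u) (R' u) u) \<and> (\<forall>X. config A R' u0 W X \<longrightarrow> c X = \<epsilon>)"
proof -
  obtain \<epsilon> where \<epsilon>: "{s. hue s = \<epsilon>} \<in> p" using ultra_colour[OF p(1), of hue r] hue(1) by blast
  obtain q v e0 pp ee where
    pp: "\<forall>u\<in>I. pp u \<in> lists (\<Union>q\<in>{0..}. Lt q) \<and> (\<forall>b\<in>Lt q. ee u b \<in> lists (\<Union>q\<in>{0..}. Lt q))"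
    and ln: "\<forall>\<beta>. (\<forall>i\<in>I. \<beta> i \<in> Lt q) \<longrightarrow> (v, line_point I pp ee \<beta>) \<in> stable \<epsilon> \<and>
        (\<forall>a. (v @ [a] @ e0 a, line_point I pp ee \<beta>) \<in> stable \<epsilon>)"
    using p_line[OF stable_in[OF \<epsilon>], of 0] unfolding has_line_def by (elim exE conjE)
  obtain b where b: "b \<in> univ (As q)" using K_nonempty[OF As[of q]] by blast
  define lp where "lp = line_point I pp ee (\<lambda>_. (q, b))"
  have bL: "(q, b) \<in> Lt q" using b by (simp add: Lt)
  have lp: "(v, lp) \<in> stable \<epsilon>" using ln bL by (simp add: lp_def)
  have lpL: "lp u \<in> lists (\<Union>q. Lt q)" if "u \<in> I" for u
  proof -
    have "pp u \<in> lists (\<Union>q. Lt q)" "ee u (q, b) \<in> lists (\<Union>q. Lt q)" using pp bL that by auto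
    then show ?thesis using bL that by (auto simp: lp_def line_point_def)
  qed
  have "choices (\<lambda>u. {lp u}) = {lp}"
  proof -
    have "z = lp" if "\<forall>u\<in>I. z u = lp u" "\<forall>u. u \<notin> I \<longrightarrow> z u = []" for z
    proof
      fix u show "z u = lp u" using that by (cases "u \<in> I") (simp_all add: lp_def line_point_def)
    qed
    moreover have "lp u = []" if "u \<notin> I" for u using that by (simp add: lp_def line_point_def)
    ultimately show ?thesis unfolding choices_def by blast
  qed
  then have "invariant \<epsilon> ({v}, \<lambda>u. {lp u}, 0)" using lp lpL by (simp add: invariant_def)
  then have "\<exists>st. \<forall>m. (invariant \<epsilon> (st m) \<and> (m = 0 \<longrightarrow> fst (st m) = {v})) \<and> step \<epsilon> m (st m) (st (Suc m))"
    using step_ex by (intro dependent_nat_choice) auto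
  then obtain st where st0: "\<forall>m. (invariant \<epsilon> (st m) \<and> (m = 0 \<longrightarrow> fst (st m) = {v})) \<and> step \<epsilon> m (st m) (st (Suc m))" ..
  then have st: "\<forall>m. invariant \<epsilon> (st m) \<and> step \<epsilon> m (st m) (st (Suc m))" by simp
  define P0 where "P0 m = fst (st m)" for m
  define P where "P m = fst (snd (st m))" for m
  define N where "N m = snd (snd (st m))" for m
  have stm: "st m = (P0 m, P m, N m)" for m by (simp add: P0_def P_def N_def)
  have inv: "invariant \<epsilon> (P0 m, P m, N m)" for m using spec[OF st, of m] unfolding stm[of m] by simp
  have P0: "finite (P0 m)" "P0 m \<noteq> {}" for m using inv[of m] by (simp_all add: invariant_def)
  have P: "finite (P m u)" "P m u \<noteq> {}" "P m u \<subseteq> lists (\<Union>q. Lt q)" if "u \<in> I" for m u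
    using inv[of m] that by (simp_all add: invariant_def)
  have anti0: "s = s'" if "s \<in> P0 m" "s' \<in> P0 m" "prefix (pos0 s) (pos0 s')" for m s s'
    using inv[of m] that by (simp add: invariant_def)
  have step: "step \<epsilon> m (P0 m, P m, N m) (P0 (Suc m), P (Suc m), N (Suc m))" for m
    using spec[OF st, of m] unfolding stm[of m] stm[of "Suc m"] by simp
  note step2 = conjunct2[OF step[unfolded step_def prod.case]]
  have stepI: "\<exists>q w f. m \<le> q \<and> prefix (pos u s) w \<and> embedding k f (As q) (F w) \<and>
           f ` univ (As q) \<subseteq> tsucc (R u) w \<and> (\<forall>b\<in>univ (As q). \<exists>s'\<in>P (Suc m) u. prefix (f b) (pos u s'))"
    if "u \<in> I" "s \<in> P m u" for m u s
    by (rule bspec[OF conjunct1[OF bspec[OF step2 that(1)]] that(2)])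
  have backI: "\<exists>s\<in>P m u. prefix (pos u s) (pos u s') \<and>
           prefix (restr (br (R u) (pos u s)) (N m)) (pos u s')"
    if "u \<in> I" "s' \<in> P (Suc m) u" for m u s'
    by (rule bspec[OF conjunct2[OF bspec[OF step2 that(1)]] that(2)])
  have "\<forall>m. \<exists>x. P0 (Suc m) = (\<Union>s\<in>P0 m. snd (snd (snd x)) s ` univ (As (fst x s))) \<and>
     (\<forall>s\<in>P0 m. split0 \<epsilon> m (P0 (Suc m), P (Suc m), N (Suc m)) s (fst x s) (fst (snd x) s)
        (fst (snd (snd x)) s) (snd (snd (snd x)) s))"
  proof
    fix m
    obtain qf w f g where "P0 (Suc m) = (\<Union>s\<in>P0 m. g s ` univ (As (qf s)))"
      "\<forall>s\<in>P0 m. split0 \<epsilon> m (P0 (Suc m), P (Suc m), N (Suc m)) s (qf s) (w s) (f s) (g s)"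
      using step[of m] unfolding step_def prod.case by (elim exE conjE)
    then show "\<exists>x. P0 (Suc m) = (\<Union>s\<in>P0 m. snd (snd (snd x)) s ` univ (As (fst x s))) \<and>
     (\<forall>s\<in>P0 m. split0 \<epsilon> m (P0 (Suc m), P (Suc m), N (Suc m)) s (fst x s) (fst (snd x) s)
        (fst (snd (snd x)) s) (snd (snd (snd x)) s))"
      by (intro exI[of _ "(qf, w, f, g)"]) simp
  qed
  from choice[OF this] obtain X where X: "\<forall>m. P0 (Suc m) = (\<Union>s\<in>P0 m. snd (snd (snd (X m))) s ` univ (As (fst (X m) s))) \<and>
     (\<forall>s\<in>P0 m. split0 \<epsilon> m (P0 (Suc m), P (Suc m), N (Suc m)) s (fst (X m) s) (fst (snd (X m)) s)
        (fst (snd (snd (X m))) s) (snd (snd (snd (X m))) s))" ..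
  define qf where "qf m = fst (X m)" for m
  define w where "w m = fst (snd (X m))" for m
  define f where "f m = fst (snd (snd (X m)))" for m
  define g where "g m = snd (snd (snd (X m)))" for m
  have P0S: "P0 (Suc m) = (\<Union>s\<in>P0 m. g m s ` univ (As (qf m s)))"
    and sp: "s \<in> P0 m \<Longrightarrow> split0 \<epsilon> m (P0 (Suc m), P (Suc m), N (Suc m)) s (qf m s) (w m s) (f m s) (g m s)" for m s
    using spec[OF X, of m] unfolding qf_def w_def f_def g_def by (blast, blast)
  have sp1: "m \<le> qf m s" "w m s \<in> R u0" "prefix (pos0 s) (w m s)"
    "embedding k (f m s) (As (qf m s)) (F (w m s))" "f m s ` univ (As (qf m s)) \<subseteq> tsucc (R u0) (w m s)"
    if "s \<in> P0 m" for m s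
    using sp[OF that] unfolding split0_def prod.case by simp_all
  have sp2: "prefix (f m s b) (pos0 (g m s b))" "prefix (restr (br (R u0) (f m s b)) (N (Suc m))) (pos0 (g m s b))"
    if "s \<in> P0 m" "b \<in> univ (As (qf m s))" for m s b
    using sp[OF that(1)] that(2) unfolding split0_def prod.case by simp_all
  have sp3: "c Y = \<epsilon>" if "s \<in> P0 m" "B \<subseteq> f m s ` univ (As (qf m s))" "isomorphic k (induced (F (w m s)) B) A"
    "z \<in> choices (P (Suc m))" "Y \<in> [branches T]\<^bsup>n\<^esup>"
    "restrs (N (Suc m)) Y = (\<lambda>x. restr x (N (Suc m))) ` sample B z" for m s B z Y
    using sp[OF that(1)] that(2-) unfolding split0_def prod.case by blast
  have fs: "f m s b \<in> tsucc (R u0) (w m s)" if "s \<in> P0 m" "b \<in> univ (As (qf m s))" for m s b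
    using sp1(5)[OF that(1)] that(2) by blast
  have gpre: "prefix (pos0 s) (pos0 (g m s b))" "length (pos0 s) < length (pos0 (g m s b))"
    if s: "s \<in> P0 m" and b: "b \<in> univ (As (qf m s))" for m s b
  proof -
    have 1: "prefix (pos0 s) (w m s)" "prefix (w m s) (f m s b)" "prefix (f m s b) (pos0 (g m s b))"
      using sp1(3)[OF s] tsucc_prefix[OF fs[OF s b]] sp2(1)[OF s b] by auto
    then show "prefix (pos0 s) (pos0 (g m s b))" by (meson prefix_order.trans)
    show "length (pos0 s) < length (pos0 (g m s b))"
      using prefix_length_le[OF 1(1)] prefix_length_le[OF 1(3)] tsucc_length[OF fs[OF s b]] by simp
  qed
  define V where "V u m = (if u = u0 then pos0 ` P0 m else pos u ` P m u)" for u m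
  define R' where "R' u = downset (V u)" for u
  have V0: "V u0 m = pos0 ` P0 m" for m by (simp add: V_def)
  have VI: "V u m = pos u ` P m u" if "u \<in> I" for u m using that by (simp add: V_def)
  have finV: "finite (V u m)" if "u \<in> W" for u m using that P0 P by (auto simp: V_def)
  have ancV: "\<exists>v'\<in>V u m. prefix v' v" if u: "u \<in> W" and v: "v \<in> V u (Suc m)" for u m v
  proof (cases "u = u0")
    case True
    then obtain s b where "s \<in> P0 m" "b \<in> univ (As (qf m s))" "v = pos0 (g m s b)"
      using v by (auto simp: V0 P0S)
    then show ?thesis using gpre(1) True by (auto simp: V0)
  next
    case False
    then show ?thesis using backI[of u] u v by (fastforce simp: VI)
  qed
  have splitV: "\<exists>q w f. m \<le> q \<and> prefix v w \<and> embedding k f (As q) (F w) \<and>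
      f ` univ (As q) \<subseteq> tsucc (R u) w \<and> (\<forall>b\<in>univ (As q). \<exists>v'\<in>V u (Suc m). prefix (f b) v')"
    if u: "u \<in> W" and v: "v \<in> V u m" for u m v
  proof (cases "u = u0")
    case True
    then obtain s where s: "s \<in> P0 m" "v = pos0 s" using v by (auto simp: V0)
    have "\<exists>v'\<in>V u (Suc m). prefix (f m s b) v'" if "b \<in> univ (As (qf m s))" for b
      using sp2(1)[OF s(1) that] s(1) that True unfolding V0 True P0S by blast
    then show ?thesis using sp1[OF s(1)] s(2) True by blast
  next
    case False
    then have uI: "u \<in> I" using u by simp
    obtain s where s: "s \<in> P m u" "v = pos u s" using v by (auto simp: VI[OF uI])
    then show ?thesis using stepI[OF uI s(1)] by (simp add: VI[OF uI])
  qed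
  have stem: "stem_tree (R u) (R' u) u" if u: "u \<in> W" for u
    unfolding R'_def
  proof (rule downset_stem_tree[OF R[OF u] _ _ _ cofinal As splitV[OF u]])
    show "V u 0 \<noteq> {}" using P0 P u by (auto simp: V_def)
    show "V u m \<subseteq> R u" for m
    proof (cases "u = u0")
      case True
      then show ?thesis using pos0_in by (auto simp: V0)
    next
      case False
      then have "u \<in> I" using u by simp
      then show ?thesis using subsetD[OF P(3)[of u m]] pos_in[OF u] unfolding VI[OF \<open>u \<in> I\<close>] by blast
    qed
    show "prefix u v" if v: "v \<in> V u 0" for v
    proof (cases "u = u0")
      case True
      then show ?thesis using v jumps_in[OF R0(3)] by (auto simp: V0)
    next
      case False
      then have uI: "u \<in> I" using u by simp
      obtain s where s: "s \<in> P 0 u" "v = pos u s" using v unfolding VI[OF uI] by blast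
      show ?thesis using moves_in[OF u R_stem[OF u] subsetD[OF P(3)[OF uI] s(1)]] s(2) by simp
    qed
  qed
  have R'R: "x \<in> branches (R u)" if "u \<in> W" "x \<in> branches (R' u)" for u x
    using stem[OF that(1)] branches_mono that(2) unfolding stem_tree_def by blast
  have thr: "\<exists>v\<in>V u m. passes x v" if "u \<in> W" "x \<in> branches (R' u)" for u x m
    by (rule branch_downset[where V = "V u"]) (use finV ancV that in \<open>auto simp: R'_def\<close>)
  have thr0: "\<exists>s\<in>P0 m. passes x (pos0 s)" if "x \<in> branches (R' u0)" for x m
    using thr[OF W(2) that, of m] by (auto simp: V0)
  have uniq: "s = s'" if "s \<in> P0 m" "s' \<in> P0 m" "passes x (pos0 s)" "passes x (pos0 s')" for x s s' m
    using passes_comparable[OF that(3,4)] anti0 that(1,2) by blast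
  have long: "m \<le> length (pos0 s)" if "s \<in> P0 m" for m s
    using that
  proof (induction m arbitrary: s)
    case (Suc m)
    obtain s' b where "s' \<in> P0 m" "b \<in> univ (As (qf m s'))" "s = g m s' b"
      using Suc.prems by (auto simp: P0S)
    then show ?case using Suc.IH[of s'] gpre(2)[of s' m b] by simp
  qed simp
  have next0: "\<exists>b\<in>univ (As (qf m s)). passes x (pos0 (g m s b))"
    if s: "s \<in> P0 m" and x: "x \<in> branches (R' u0)" "passes x (pos0 s)" for s m x
  proof -
    obtain s1 where s1: "s1 \<in> P0 (Suc m)" "passes x (pos0 s1)" using thr0[OF x(1)] by blast
    then obtain s2 b where s2: "s2 \<in> P0 m" "b \<in> univ (As (qf m s2))" "s1 = g m s2 b" by (auto simp: P0S)
    have "passes x (pos0 s2)" using passes_prefix[OF s1(2)] gpre(1)[OF s2(1,2)] s2(3) by simp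
    then have "s2 = s" using uniq[OF s2(1) s _ x(2)] by simp
    then show ?thesis using s1(2) s2 by blast
  qed
  have "c Y = \<epsilon>" if conf: "config A R' u0 W Y" for Y
  proof -
    obtain w0 B y where w0: "prefix u0 w0" and B: "B \<subseteq> branches (R' u0)" "\<forall>x\<in>B. passes x w0"
      and inj: "inj_on (\<lambda>x. restr x (Suc (length w0))) B"
      and iso: "isomorphic k (induced (F w0) (restrs (Suc (length w0)) B)) A"
      and y: "\<forall>u\<in>I. y u \<in> branches (R' u)" and Y: "Y = B \<union> y ` I"
      using conf unfolding config_def by (elim exE conjE)
    let ?h = "\<lambda>x. restr x (Suc (length w0))"
    have BR: "x \<in> branches (R u0)" if "x \<in> B" for x using R'R[OF W(2)] B(1) that by blast
    have RT: "R u0 \<subseteq> Tmax" by (rule ftree_Tmax[OF R0(1)])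
    have "?h x \<in> tsucc (R u0) w0" if "x \<in> B" for x
    proof -
      have "?h x \<in> R u0" using BR[OF that] by (simp add: branches_def)
      moreover have "?h x = w0 @ [x (length w0)]" using B(2) that by (simp add: restr_Suc passes_def)
      ultimately show ?thesis by (auto simp: tsucc_def)
    qed
    then have hT: "?h ` B \<subseteq> tsucc (R u0) w0" by blast
    have Bne: "B \<noteq> {}"
    proof
      assume "B = {}"
      then have "card (univ A) = 0" using isomorphic_card[OF iso] by (simp add: univ_induced)
      then show False using A(2) by simp
    qed
    then have "w0 \<in> R u0" using BR B(2) branches_passes by blast
    then have "univ (F w0) = tsucc Tmax w0" using RT univ_F by blast
    then have "univ (induced (F w0) (?h ` B)) = ?h ` B"
      using hT tsucc_mono[OF RT, of w0] by (auto simp: univ_induced)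
    then have cB: "card B = card (univ A)" using isomorphic_card[OF iso] card_image[OF inj] by simp
    then have "\<not> card B \<le> Suc 0" using A(2) by simp
    moreover have finB: "finite B" using cB A(2) by (metis card.infinite not_numeral_le_zero)
    ultimately obtain x x' where xx: "x \<in> B" "x' \<in> B" "x \<noteq> x'"
      by (metis card_le_Suc0_iff_eq)
    have xb: "x \<in> branches (R' u0)" "x' \<in> branches (R' u0)" using B(1) xx by auto
    \<comment> \<open>Both branches pass through the single position of stage 0, and the positions
      of stage \<open>Suc i\<close> are longer than \<open>i\<close>, where the branches differ. So
      some stage \<open>m\<close> is common to them while the next one is not.\<close>
    define com where "com m \<longleftrightarrow> (\<exists>s\<in>P0 m. passes x (pos0 s) \<and> passes x' (pos0 s))" for m
    obtain i where i: "x i \<noteq> x' i" using xx(3) by blast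
    have "\<not> com (Suc i)"
    proof
      assume "com (Suc i)"
      then obtain s where s: "s \<in> P0 (Suc i)" "passes x (pos0 s)" "passes x' (pos0 s)" by (auto simp: com_def)
      then have "restr x (length (pos0 s)) = restr x' (length (pos0 s))" by (simp add: passes_def)
      moreover have "i < length (pos0 s)" using long[OF s(1)] by simp
      ultimately show False using i by (simp add: restr_eq_iff)
    qed
    moreover have "com 0"
    proof -
      have "P0 0 = {v}" using st0 by (simp add: P0_def)
      then show ?thesis using thr0[OF xb(1), of 0] thr0[OF xb(2), of 0] by (auto simp: com_def)
    qed
    ultimately obtain m where m: "com m" "\<not> com (Suc m)" by (metis nat_induct)
    obtain s where s: "s \<in> P0 m" "passes x (pos0 s)" "passes x' (pos0 s)" using m(1) by (auto simp: com_def)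
    obtain b b' where b: "b \<in> univ (As (qf m s))" "passes x (pos0 (g m s b))"
      and b': "b' \<in> univ (As (qf m s))" "passes x' (pos0 (g m s b'))"
      using next0[OF s(1) xb(1) s(2)] next0[OF s(1) xb(2) s(3)] by blast
    have "g m s b \<in> P0 (Suc m)" using s(1) b(1) by (auto simp: P0S)
    then have "b \<noteq> b'" using m(2) b(2) b'(2) by (auto simp: com_def)
    then have fne: "f m s b \<noteq> f m s b'"
      using sp1(4)[OF s(1)] b(1) b'(1) by (auto simp: embedding_def dest: inj_onD)
    have pf: "passes x (f m s b)" "passes x' (f m s b')"
      using passes_prefix[OF b(2) sp2(1)[OF s(1) b(1)]] passes_prefix[OF b'(2) sp2(1)[OF s(1) b'(1)]] by auto
    let ?w = "w m s"
    have lf: "length (f m s b) = Suc (length ?w)" "length (f m s b') = Suc (length ?w)"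
      using fs[OF s(1)] b(1) b'(1) tsucc_length by blast+
    have pw: "passes x ?w" "passes x' ?w"
      using passes_prefix[OF pf(1) tsucc_prefix[OF fs[OF s(1) b(1)]]]
        passes_prefix[OF pf(2) tsucc_prefix[OF fs[OF s(1) b'(1)]]] by auto
    have px: "passes x w0" "passes x' w0" using B(2) xx by auto
    \<comment> \<open>If \<open>?w\<close> were shorter than \<open>w0\<close>, the branches would
      part before \<open>w0\<close>; if longer, they would share a successor of \<open>w0\<close>,
      contrary to \<open>inj\<close>.\<close>
    have "\<not> length ?w < length w0"
    proof
      assume "length ?w < length w0"
      then have "prefix (f m s b) w0" "prefix (f m s b') w0"
        using passes_shorter[OF pf(1) px(1)] passes_shorter[OF pf(2) px(2)] lf by auto
      then have "f m s b = f m s b'" using lf by (metis prefix_length_prefix prefix_order.antisym order_refl)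
      then show False using fne by simp
    qed
    moreover have "\<not> length w0 < length ?w"
    proof
      assume l: "length w0 < length ?w"
      have "take (Suc (length w0)) (restr x (length ?w)) = take (Suc (length w0)) (restr x' (length ?w))"
        using pw by (simp add: passes_def)
      then have "?h x = ?h x'" using l by (simp add: take_restr min_def)
      then show False using inj xx by (auto dest: inj_onD)
    qed
    ultimately have "length ?w = length w0" by simp
    then have ww: "?w = w0" using passes_same_length[OF pw(1) px(1)] by simp
    \<comment> \<open>Every branch of the copy passes through \<open>?w\<close>, hence follows the
      fixed branch through one of the chosen successors up to the level that decides the
      colour.\<close>
    have Bb: "\<exists>b\<in>univ (As (qf m s)). ?h a = f m s b \<and> restr a (N (Suc m)) = restr (br (R u0) (f m s b)) (N (Suc m))"
      if a: "a \<in> B" for a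
    proof -
      have "passes a ?w" using B(2) a ww by simp
      then have "passes a (pos0 s)" using passes_prefix sp1(3)[OF s(1)] by blast
      then obtain d where d: "d \<in> univ (As (qf m s))" "passes a (pos0 (g m s d))"
        using next0[OF s(1)] B(1) a by blast
      have "passes a (f m s d)" using passes_prefix[OF d(2) sp2(1)[OF s(1) d(1)]] .
      then have "?h a = f m s d" using tsucc_length[OF fs[OF s(1) d(1)]] ww by (simp add: passes_def)
      moreover have "passes a (restr (br (R u0) (f m s d)) (N (Suc m)))"
        using passes_prefix[OF d(2) sp2(2)[OF s(1) d(1)]] .
      then have "restr a (N (Suc m)) = restr (br (R u0) (f m s d)) (N (Suc m))" by (simp add: passes_def)
      ultimately show ?thesis using d(1) by blast
    qed
    \<comment> \<open>The proof goes through stage \<open>Suc (Suc m)\<close>, since in these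
      coordinates the positions follow the fixed branches to \<open>N (Suc m)\<close> only one stage
      later.\<close>
    have "\<forall>u\<in>I. \<exists>s'. s' \<in> P (Suc m) u \<and> restr (y u) (N (Suc m)) = restr (br (R u) (pos u s')) (N (Suc m))"
    proof
      fix u assume u: "u \<in> I"
      obtain s1 where s1: "s1 \<in> P (Suc (Suc m)) u" "passes (y u) (pos u s1)"
        using thr[of u "y u" "Suc (Suc m)"] y u by (auto simp: VI[OF u])
      obtain s' where s': "s' \<in> P (Suc m) u" "prefix (restr (br (R u) (pos u s')) (N (Suc m))) (pos u s1)"
        using backI[OF u s1(1)] by blast
      have "passes (y u) (restr (br (R u) (pos u s')) (N (Suc m)))" using passes_prefix[OF s1(2) s'(2)] .
      then show "\<exists>s'. s' \<in> P (Suc m) u \<and> restr (y u) (N (Suc m)) = restr (br (R u) (pos u s')) (N (Suc m))"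
        using s'(1) by (intro exI[of _ s']) (simp add: passes_def)
    qed
    from bchoice[OF this] obtain z0 where z0: "\<forall>u\<in>I. z0 u \<in> P (Suc m) u \<and>
      restr (y u) (N (Suc m)) = restr (br (R u) (pos u (z0 u))) (N (Suc m))" ..
    define z where "z u = (if u \<in> I then z0 u else [])" for u
    have zC: "z \<in> choices (P (Suc m))" using z0 by (auto simp: choices_def z_def)
    have hB: "?h ` B \<subseteq> f m s ` univ (As (qf m s))" using Bb by (auto simp: image_iff)
    have e1: "restrs (N (Suc m)) B = (\<lambda>x. restr x (N (Suc m))) ` br (R u0) ` ?h ` B"
      unfolding image_image by (rule image_cong) (use Bb in \<open>metis\<close>)+
    have e2: "(\<lambda>x. restr x (N (Suc m))) ` y ` I = (\<lambda>x. restr x (N (Suc m))) ` (\<lambda>u. br (R u) (pos u (z u))) ` I"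
      unfolding image_image by (rule image_cong) (use z0 in \<open>auto simp: z_def\<close>)
    have "restrs (N (Suc m)) Y = (\<lambda>x. restr x (N (Suc m))) ` sample (?h ` B) z"
      unfolding Y sample_def image_Un e1 e2 ..
    moreover have "Y \<in> [branches T]\<^bsup>n\<^esup>"
    proof -
      have yR: "y u \<in> branches (R u)" if "u \<in> I" for u using R'R[of u "y u"] y that by simp
      have inj2: "inj_on y I"
      proof (rule inj_onI)
        fix u v assume uv: "u \<in> I" "v \<in> I" "y u = y v"
        then have "y u \<in> branches (R v)" using yR[of v] by simp
        then show "u = v" using branches_apart[OF _ _ yR[of u]] uv by blast
      qed
      have disj: "B \<inter> y ` I = {}"
      proof -
        have "a \<noteq> y u" if a: "a \<in> B" and u: "u \<in> I" for a u
        proof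
          assume "a = y u"
          then have "a \<in> branches (R u)" using yR[OF u] by simp
          then show False using branches_apart[OF W(2) _ BR[OF a]] u by blast
        qed
        then show ?thesis by blast
      qed
      have "card Y = card B + card I"
        unfolding Y using card_Un_disjoint[OF _ _ disj] finB W(1) card_image[OF inj2] by simp
      then have "card Y = n" using cB W(3) card_Suc_Diff1[OF W(1,2)] by linarith
      moreover have "y u \<in> branches T" if "u \<in> I" for u
        using yR[OF that] branches_mono[OF R_T[of u]] that by blast
      moreover have "a \<in> branches T" if "a \<in> B" for a
        using BR[OF that] branches_mono[OF R0(2)] by blast
      ultimately show ?thesis using finB W(1) by (auto simp: nsets_def Y)
    qed
    ultimately show ?thesis using sp3[OF s(1) hB _ zC] iso ww by blast
  qed
  then show ?thesis using stem by blast
qed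

end

context ramsey_class begin

lemma homogeneous_configurations:
  assumes c: "colouring n T c r" and A: "A \<in> K" "2 \<le> card (univ A)"
    and W: "finite W" "u0 \<in> W" "card W + card (univ A) = Suc n"
    and anti: "\<And>u v. u \<in> W \<Longrightarrow> v \<in> W \<Longrightarrow> prefix u v \<Longrightarrow> u = v"
    and R: "\<And>u. u \<in> W \<Longrightarrow> stem_tree T (R u) u"
  shows "\<exists>R' \<epsilon>. (\<forall>u\<in>W. stem_tree (R u) (R' u) u) \<and> (\<forall>X. config A R' u0 W X \<longrightarrow> c X = \<epsilon>)"
proof -
  obtain As :: "nat \<Rightarrow> nat ostruct" where As: "\<forall>q. As q \<in> K" "\<forall>A\<in>K. \<exists>m. \<forall>q\<ge>m. embeds k A (As q)"
    using cofinal_chain by blast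
  define Lt where "Lt q = Pair q ` univ (As q)" for q
  have "\<exists>p :: (nat list list \<times> (nat list \<Rightarrow> (nat \<times> nat) list)) set set. ultra p \<and>
    (\<forall>C\<in>p. \<forall>N. \<exists>q\<ge>N. has_line (W - {u0}) (\<lambda>i. \<Union>q\<in>{N..}. Lt q) (\<lambda>_. Lt q) C) \<and> ultra_prod wmul p p = p"
    by (rule line_idempotent) (use W(1) As(1) K_finite K_nonempty in \<open>auto simp: Lt_def\<close>)
  then obtain p :: "(nat list list \<times> (nat list \<Rightarrow> (nat \<times> nat) list)) set set" where p: "ultra p"
    "\<forall>C\<in>p. \<forall>N. \<exists>q\<ge>N. has_line (W - {u0}) (\<lambda>i. \<Union>q\<in>{N..}. Lt q) (\<lambda>_. Lt q) C" "ultra_prod wmul p p = p"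
    by (elim exE conjE)
  interpret splitting k K M F T n r c A W u0 R As p Lt
    by unfold_locales (use c A W anti R As p Lt_def in auto)
  show ?thesis by (rule homogeneous)
qed

end

section \<open>Fusion\<close>

lemma strict_mono_interval:
  fixes l :: "nat \<Rightarrow> nat"
  assumes "strict_mono l" "l 0 = 0"
  shows "\<exists>m. l m \<le> L \<and> L < l (Suc m)"
proof -
  have "L < l (Suc L)" using strict_mono_imp_increasing[OF assms(1), of "Suc L"] by simp
  then have ex: "\<exists>m. L < l m" by blast
  define m where "m = (LEAST m. L < l m)"
  have m: "L < l m" unfolding m_def by (rule LeastI_ex[OF ex])
  then have "m \<noteq> 0" using assms(2) by (metis not_less_zero)
  then obtain m' where m': "m = Suc m'" by (cases m) auto
  have "m' < m" using m' by simp
  then have "\<not> L < l m'" unfolding m_def by (rule not_less_Least)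
  then show ?thesis using m m' by (intro exI[of _ m']) simp
qed

section \<open>Meets of two branches\<close>

lemma restr_meet: "restr x (LEAST n. x n \<noteq> y n) = restr y (LEAST n. x n \<noteq> y n)"
  unfolding restr_eq_iff
proof (intro allI impI)
  fix i assume "i < (LEAST n. x n \<noteq> y n)"
  then have "\<not> x i \<noteq> y i" by (rule not_less_Least)
  then show "x i = y i" by simp
qed

lemma meet_sym: "meet x y = meet y x"
proof -
  have eq: "(\<lambda>n. y n \<noteq> x n) = (\<lambda>n. x n \<noteq> y n)" by auto
  show ?thesis unfolding meet_def eq by (rule restr_meet)
qed

lemma length_meet: "length (meet x y) = (LEAST n. x n \<noteq> y n)"
  by (simp add: meet_def)

lemma passes_meet: "passes x (meet x y)" "passes y (meet x y)"
  by (simp add: meet_def) (simp add: meet_sym[of x y], simp add: meet_def)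

lemma differ_at_meet: "x \<noteq> y \<Longrightarrow> x (length (meet x y)) \<noteq> y (length (meet x y))"
  unfolding length_meet by (rule LeastI_ex) blast

lemma meet_length_less_iff:
  assumes "x \<noteq> y"
  shows "length (meet x y) < N \<longleftrightarrow> restr x N \<noteq> restr y N"
proof
  assume "length (meet x y) < N"
  then show "restr x N \<noteq> restr y N" using differ_at_meet[OF assms] by (auto simp: restr_eq_iff)
next
  assume "restr x N \<noteq> restr y N"
  then obtain i where "i < N" "x i \<noteq> y i" by (auto simp: restr_eq_iff)
  then show "length (meet x y) < N"
    unfolding length_meet using Least_le[of "\<lambda>n. x n \<noteq> y n" i] by simp
qed

lemma meet_eqI:
  assumes "passes x w" "passes y w" "x (length w) \<noteq> y (length w)"
  shows "meet x y = w"
proof -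
  have "x \<noteq> y" using assms(3) by blast
  have "restr x (length w) = restr y (length w)" using assms(1,2) by (simp add: passes_def)
  then have "\<not> length (meet x y) < length w" using meet_length_less_iff[OF \<open>x \<noteq> y\<close>] by simp
  moreover have "restr x (Suc (length w)) \<noteq> restr y (Suc (length w))" using assms(3) by (auto simp: restr_eq_iff)
  then have "length (meet x y) < Suc (length w)" using meet_length_less_iff[OF \<open>x \<noteq> y\<close>] by simp
  ultimately have "length (meet x y) = length w" by simp
  then show ?thesis using passes_same_length[OF passes_meet(1) assms(1)] by simp
qed

context ramsey_class begin

text \<open>The node \<open>v0\<close> is the bookkeeping request of the stage: if possible, the splitting takes place
  above it.\<close>

definition refines ::
  "(nat \<Rightarrow> nat ostruct) \<Rightarrow> nat list set \<Rightarrow> nat \<Rightarrow> nat list \<Rightarrow> nat \<Rightarrow> nat list set \<Rightarrow> (nat list \<Rightarrow> nat list set) \<Rightarrow>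
     nat list \<Rightarrow> nat list set \<Rightarrow> (nat list \<Rightarrow> nat list set) \<Rightarrow> bool" where
  "refines As T m v0 l V R w V' R' \<longleftrightarrow> l \<le> length w \<and>
    (\<forall>v'\<in>V'. \<exists>v\<in>V. prefix v v' \<and> R' v' \<subseteq> R v) \<and> (\<forall>v\<in>V. \<exists>v'\<in>V'. prefix v v') \<and>
    (\<forall>v1\<in>V'. \<forall>v2\<in>V'. v1 \<noteq> v2 \<and> take l v1 = take l v2 \<longrightarrow> prefix w v1 \<and> prefix w v2) \<and>
    ((\<exists>v\<in>V. prefix v0 v) \<longrightarrow> prefix v0 w \<and>
      (\<exists>f. embedding k f (As m) (F w) \<and> f ` univ (As m) \<subseteq> V' \<inter> tsucc T w))"

text \<open>Only \<open>vs\<close> is split, and all other nodes are prolonged along fixed branches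
  to the length of its new successors, so that between two recorded levels there is a single
  splitting node. The requirement is then solved for the new level inside the cones of the old
  reservoirs.\<close>

lemma fusion_step:
  fixes As :: "nat \<Rightarrow> nat ostruct"
  assumes As_K: "\<forall>q. As q \<in> K"
    and solve: "\<forall>V R. finite V \<and> (\<forall>v\<in>V. stem_tree T (R v) v) \<and> (\<forall>u\<in>V. \<forall>v\<in>V. length u = length v) \<longrightarrow>
      (\<exists>R'. (\<forall>v\<in>V. stem_tree (R v) (R' v) v) \<and> Req V R')"
    and V: "finite V" "V \<noteq> {}" and V_length: "\<forall>v\<in>V. length v = l" and V_stem: "\<forall>v\<in>V. stem_tree T (R v) v"
  shows "\<exists>w V' R'. finite V' \<and> V' \<noteq> {} \<and> (\<forall>v\<in>V'. length v = Suc (length w)) \<and>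
    (\<forall>v\<in>V'. stem_tree T (R' v) v) \<and> Req V' R' \<and> refines As T m v0 l V R w V' R'"
proof -
  note As = spec[OF As_K] and V3 = bspec[OF V_length] and R = bspec[OF V_stem]
  obtain vs where vs: "vs \<in> V" "(\<exists>v\<in>V. prefix v0 v) \<longrightarrow> prefix v0 vs" using V(2) by blast
  have Rt: "ftree (R v)" "R v \<subseteq> T" "v \<in> R v" if "v \<in> V" for v using R[OF that] by (auto simp: stem_tree_def)
  obtain w f where w: "w \<in> R vs" "prefix vs w" and f: "embedding k f (As m) (F w)" "f ` univ (As m) \<subseteq> tsucc (R vs) w"
    using ftree_split[OF Rt(1,3)[OF vs(1)] As] by blast
  have lw: "l \<le> length w" using prefix_length_le[OF w(2)] V3[OF vs(1)] by simp
  define e where "e v = restr (br (R v) v) (Suc (length w))" for v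
  define V' where "V' = f ` univ (As m) \<union> e ` (V - {vs})"
  have e: "e v \<in> R v" "prefix v (e v)" "length (e v) = Suc (length w)" if "v \<in> V" for v
    using br_restr[OF Rt(1,3)[OF that]] br_prefix[OF Rt(1,3)[OF that]] V3[OF that] lw by (auto simp: e_def)
  have f2: "f b \<in> R vs" "prefix vs (f b)" "prefix w (f b)" "length (f b) = Suc (length w)" if "b \<in> univ (As m)" for b
  proof -
    have "f b \<in> tsucc (R vs) w" using f(2) that by blast
    then show "f b \<in> R vs" "prefix w (f b)" "length (f b) = Suc (length w)"
      by (auto simp: tsucc_length tsucc_prefix) (simp add: tsucc_def)
    then show "prefix vs (f b)" using w(2) by (blast intro: prefix_order.trans)
  qed
  have tk: "take l v' = v" if "prefix v v'" "v \<in> V" for v v'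
    using that V3 by (auto simp: prefix_def)
  have par: "take l v' \<in> V \<and> v' \<in> R (take l v') \<and> prefix (take l v') v' \<and> length v' = Suc (length w)" if "v' \<in> V'" for v'
  proof -
    consider b where "b \<in> univ (As m)" "v' = f b" | v where "v \<in> V" "v' = e v"
      using \<open>v' \<in> V'\<close> unfolding V'_def by blast
    then show ?thesis
    proof cases
      case 1
      then show ?thesis using f2[OF 1(1)] tk[OF _ vs(1)] vs(1) by simp
    next
      case 2
      then show ?thesis using e[OF 2(1)] tk[OF _ 2(1)] by simp
    qed
  qed
  have finV': "finite V'" using V(1) K_finite[OF As] by (simp add: V'_def)
  define R1 where "R1 v' = cone (R (take l v')) v'" for v'
  have R1: "stem_tree T (R1 v') v'" if "v' \<in> V'" for v'
    unfolding R1_def using par[OF that] Rt by (intro stem_tree_mono[OF stem_tree_cone]) auto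
  have "\<forall>u\<in>V'. \<forall>v\<in>V'. length u = length v" using par by simp
  then have "finite V' \<and> (\<forall>v\<in>V'. stem_tree T (R1 v) v) \<and> (\<forall>u\<in>V'. \<forall>v\<in>V'. length u = length v)"
    using finV' R1 by blast
  from mp[OF spec[OF spec[OF solve]] this]
  obtain R' where R': "\<forall>v\<in>V'. stem_tree (R1 v) (R' v) v" "Req V' R'" by (elim exE conjE)
  have R'R: "R' v' \<subseteq> R (take l v')" if "v' \<in> V'" for v'
    using R'(1) that by (auto simp: stem_tree_def R1_def cone_def)
  have R'T: "stem_tree T (R' v') v'" if "v' \<in> V'" for v'
    using R'(1) R1[OF that] that by (auto simp: stem_tree_def)
  show ?thesis
    unfolding refines_def
  proof (intro exI[of _ w] exI[of _ V'] exI[of _ R'] conjI ballI impI)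
    show "l \<le> length w" by (rule lw)
    show "finite V'" by (rule finV')
    show "V' \<noteq> {}" using K_nonempty[OF As] by (simp add: V'_def)
    show "length v = Suc (length w)" if "v \<in> V'" for v using par[OF that] by simp
    show "stem_tree T (R' v) v" if "v \<in> V'" for v by (rule R'T[OF that])
    show "Req V' R'" by (rule R'(2))
    show "\<exists>v\<in>V. prefix v v' \<and> R' v' \<subseteq> R v" if "v' \<in> V'" for v'
      using par[OF that] R'R[OF that] by blast
    show "\<exists>v'\<in>V'. prefix v v'" if v: "v \<in> V" for v
    proof (cases "v = vs")
      case True
      obtain b where "b \<in> univ (As m)" using K_nonempty[OF As[of m]] by blast
      then show ?thesis using True f2(2) unfolding V'_def by blast
    next
      case False
      then show ?thesis using e(2)[OF v] v unfolding V'_def by blast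
    qed
    fix v1 v2 assume v1: "v1 \<in> V'" and v2: "v2 \<in> V'" and ne: "v1 \<noteq> v2 \<and> take l v1 = take l v2"
    have E: "v' = e (take l v')" if v': "v' \<in> V'" and nvs: "take l v' \<noteq> vs" for v'
    proof -
      have "v' \<notin> f ` univ (As m)" using nvs tk[OF _ vs(1)] f2(2) by auto
      then obtain v where "v \<in> V" "v' = e v" using v' unfolding V'_def by blast
      then show ?thesis using tk[OF e(2)] by simp
    qed
    have "take l v1 = vs" using E[OF v1] E[OF v2] ne by metis
    then have "v1 \<in> f ` univ (As m)" "v2 \<in> f ` univ (As m)"
      using v1 v2 ne tk[OF e(2)] unfolding V'_def by auto
    then show "prefix w v1" "prefix w v2" using f2(3) by auto
  next
    assume "\<exists>v\<in>V. prefix v0 v"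
    then show "prefix v0 w" using vs(2) w(2) by (blast intro: prefix_order.trans)
    show "\<exists>f. embedding k f (As m) (F w) \<and> f ` univ (As m) \<subseteq> V' \<inter> tsucc T w"
      using f tsucc_mono[OF Rt(2)[OF vs(1)]] unfolding V'_def by blast
  qed
qed

text \<open>\<open>Req\<close> survives shrinking, so what is arranged at stage \<open>m\<close>
  holds for the cones of the limit tree. Since only \<open>wt m\<close> splits between the levels
  \<open>l m\<close> and \<open>l (Suc m)\<close>, and \<open>l (Suc m)\<close> comes right after
  it, the level of a splitting determines its node.\<close>

lemma fusion:
  assumes T: "ftree T"
    and mono: "\<And>V R R'. Req V R \<Longrightarrow> (\<And>v. v \<in> V \<Longrightarrow> R' v \<subseteq> R v) \<Longrightarrow> Req V R'"
    and solve: "\<forall>V R. finite V \<and> (\<forall>v\<in>V. stem_tree T (R v) v) \<and> (\<forall>u\<in>V. \<forall>v\<in>V. length u = length v) \<longrightarrow>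
      (\<exists>R'. (\<forall>v\<in>V. stem_tree (R v) (R' v) v) \<and> Req V R')"
  shows "\<exists>S l wt. ftree S \<and> S \<subseteq> T \<and> strict_mono (l :: nat \<Rightarrow> nat) \<and> l 0 = 0 \<and>
    (\<forall>m. Req {s \<in> S. length s = l m} (cone S)) \<and>
    (\<forall>x\<in>branches S. \<forall>y\<in>branches S. x \<noteq> y \<longrightarrow> (\<exists>m. meet x y = wt m \<and> Suc (length (wt m)) = l (Suc m)))"
proof -
  obtain As :: "nat \<Rightarrow> nat ostruct" where As: "\<forall>q. As q \<in> K" and cof: "\<forall>A\<in>K. \<exists>m. \<forall>q\<ge>m. embeds k A (As q)"
    using cofinal_chain by (elim exE conjE)
  define P where "P m st \<longleftrightarrow> (case st of (l, V, R) \<Rightarrow> finite V \<and> V \<noteq> {} \<and> (\<forall>v\<in>V. length v = l) \<and>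
     (\<forall>v\<in>V. stem_tree T (R v) v) \<and> Req V R \<and> (m = 0 \<longrightarrow> l = 0))"
    for m :: nat and st :: "nat \<times> nat list set \<times> (nat list \<Rightarrow> nat list set)"
  \<comment> \<open>Stage \<open>m\<close> codes a node and a number not above \<open>m\<close>.
    Hence each recorded node is requested at stages beyond any bound, and so with structures rich
    enough for a given \<open>A\<close>.\<close>
  define v0 where "v0 m = list_decode (fst (prod_decode m))" for m
  define Q where "Q m st st' \<longleftrightarrow> (case st of (l, V, R) \<Rightarrow> case st' of (l', V', R') \<Rightarrow>
    \<exists>w. l' = Suc (length w) \<and> refines As T m (v0 m) l V R w V' R')"
    for m :: nat and st st' :: "nat \<times> nat list set \<times> (nat list \<Rightarrow> nat list set)"
  have "\<exists>st. \<forall>m. P m (st m) \<and> Q m (st m) (st (Suc m))"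
  proof (rule dependent_nat_choice)
    have "stem_tree T T []" using T ftree_Nil[OF T] by (simp add: stem_tree_def)
    then obtain R' where "stem_tree T (R' []) []" "Req {[]} R'" using spec[OF spec[OF solve, of "{[]}"], of "\<lambda>_. T"] by auto
    then have "P 0 (0, {[]}, R')" by (simp add: P_def)
    then show "\<exists>st. P 0 st" by blast
  next
    fix st m assume Pst: "P m st"
    obtain l V R where st: "st = (l, V, R)" by (cases st) auto
    have V: "finite V" "V \<noteq> {}" "\<forall>v\<in>V. length v = l" "\<forall>v\<in>V. stem_tree T (R v) v"
      using Pst by (simp_all add: P_def st)
    obtain w V' R' where *: "finite V'" "V' \<noteq> {}" "\<forall>v\<in>V'. length v = Suc (length w)"
      "\<forall>v\<in>V'. stem_tree T (R' v) v" "Req V' R'" "refines As T m (v0 m) l V R w V' R'"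
      using fusion_step[where As = As and T = T and Req = Req and V = V and l = l and R = R and m = m
          and ?v0.0 = "v0 m", OF As solve V] by (elim exE conjE)
    have "P (Suc m) (Suc (length w), V', R')" using *(1-5) unfolding P_def prod.case by simp
    moreover have "Q m st (Suc (length w), V', R')" unfolding Q_def st prod.case
      using *(6) by (intro exI[of _ w] conjI) simp_all
    ultimately show "\<exists>st'. P (Suc m) st' \<and> Q m st st'" by blast
  qed
  then obtain st where st: "\<forall>m. P m (st m) \<and> Q m (st m) (st (Suc m))" ..
  define l where "l m = fst (st m)" for m
  define V where "V m = fst (snd (st m))" for m
  define R where "R m = snd (snd (st m))" for m
  have stm: "st m = (l m, V m, R m)" for m by (simp add: l_def V_def R_def)
  have Pm: "finite (V m)" "V m \<noteq> {}" "\<And>v. v \<in> V m \<Longrightarrow> length v = l m"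
    "\<And>v. v \<in> V m \<Longrightarrow> stem_tree T (R m v) v" "Req (V m) (R m)" for m
    using spec[OF st, of m] unfolding stm P_def prod.case by simp_all
  have l0: "l 0 = 0" using spec[OF st, of 0] unfolding stm P_def prod.case by simp
  have "\<forall>m. \<exists>w. l (Suc m) = Suc (length w) \<and> refines As T m (v0 m) (l m) (V m) (R m) w (V (Suc m)) (R (Suc m))"
  proof
    fix m
    have "Q m (l m, V m, R m) (l (Suc m), V (Suc m), R (Suc m))"
      using spec[OF st, of m] unfolding stm by simp
    then show "\<exists>w. l (Suc m) = Suc (length w) \<and> refines As T m (v0 m) (l m) (V m) (R m) w (V (Suc m)) (R (Suc m))"
      unfolding Q_def prod.case .
  qed
  from choice[OF this] obtain wt where wt: "\<forall>m. l (Suc m) = Suc (length (wt m)) \<and>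
    refines As T m (v0 m) (l m) (V m) (R m) (wt m) (V (Suc m)) (R (Suc m))" ..
  have wt1: "l m \<le> length (wt m)" "l (Suc m) = Suc (length (wt m))" for m using wt unfolding refines_def by blast+
  have ancV: "\<exists>v\<in>V m. prefix v v' \<and> R (Suc m) v' \<subseteq> R m v" if "v' \<in> V (Suc m)" for m v'
    using spec[OF wt, of m] that unfolding refines_def by (elim conjE) simp
  have fwd1: "\<exists>v'\<in>V (Suc m). prefix v v'" if "v \<in> V m" for m v
    using spec[OF wt, of m] that unfolding refines_def by (elim conjE) simp
  have sk: "prefix (wt m) v1 \<and> prefix (wt m) v2"
    if "v1 \<in> V (Suc m)" "v2 \<in> V (Suc m)" "v1 \<noteq> v2" "take (l m) v1 = take (l m) v2" for m v1 v2
    using spec[OF wt, of m] that unfolding refines_def by (elim conjE) simp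
  have req: "prefix (v0 m) (wt m) \<and>
      (\<exists>f. embedding k f (As m) (F (wt m)) \<and> f ` univ (As m) \<subseteq> V (Suc m) \<inter> tsucc T (wt m))"
    if "\<exists>v\<in>V m. prefix (v0 m) v" for m
    using spec[OF wt, of m] that unfolding refines_def by (elim conjE) simp
  have mono_l: "strict_mono l"
    by (rule strict_mono_Suc_iff[THEN iffD2]) (use wt1 in \<open>simp add: le_imp_less_Suc\<close>)
  have fwd: "\<exists>v'\<in>V j. prefix v v'" if "m \<le> j" "v \<in> V m" for m j v
    using that
  proof (induction j rule: dec_induct)
    case base
    then show ?case by blast
  next
    case (step j)
    then obtain v1 where v1: "v1 \<in> V j" "prefix v v1" by blast
    obtain v2 where "v2 \<in> V (Suc j)" "prefix v1 v2" using fwd1[OF v1(1)] by blast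
    then show ?case using v1(2) by (meson prefix_order.trans)
  qed
  have RT: "R m v \<subseteq> T" "ftree (R m v)" "v \<in> R m v" if "v \<in> V m" for m v
    using Pm(4)[OF that] by (auto simp: stem_tree_def)
  have nest: "R j v' \<subseteq> R m v" if "m \<le> j" "v \<in> V m" "v' \<in> V j" "prefix v v'" for m j v v'
    using that
  proof (induction j arbitrary: v' rule: dec_induct)
    case base
    then have "length v = length v'" using Pm(3) by simp
    then have "v = v'" using base.prems(3) by (auto simp: prefix_def)
    then show ?case by simp
  next
    case (step j)
    obtain v1 where v1: "v1 \<in> V j" "prefix v1 v'" "R (Suc j) v' \<subseteq> R j v1" using ancV[OF step.prems(2)] by blast
    have "length v \<le> length v1" using Pm(3)[OF v1(1)] Pm(3)[OF step.prems(1)] mono_l step.hyps(1)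
      by (simp add: strict_mono_less_eq)
    then have "prefix v v1" using step.prems(3) v1(2) prefix_length_prefix by blast
    then show ?case using step.IH[OF step.prems(1) v1(1)] v1(3) by blast
  qed
  define S where "S = downset V"
  have spl: "\<exists>w f m. prefix v w \<and> embedding k f A (F w) \<and> f ` univ A \<subseteq> tsucc T w \<and>
      (\<forall>a\<in>univ A. \<exists>v'\<in>V m. prefix (f a) v')" if v: "v \<in> V n" and A: "A \<in> K" for n v A
  proof -
    obtain m0 where m0: "\<forall>q\<ge>m0. embeds k A (As q)" using bspec[OF cof A] ..
    define m where "m = prod_encode (list_encode v, max n m0)"
    have m: "max n m0 \<le> m" unfolding m_def by (rule le_prod_encode_2)
    have dec: "v0 m = v" by (simp add: v0_def m_def)
    have "\<exists>v'\<in>V m. prefix (v0 m) v'" unfolding dec using fwd[OF _ v] m by simp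
    from req[OF this] obtain f where f: "prefix v (wt m)" "embedding k f (As m) (F (wt m))"
      "f ` univ (As m) \<subseteq> V (Suc m) \<inter> tsucc T (wt m)" unfolding dec by (elim conjE exE)
    obtain e where e: "embedding k e A (As m)" using m0 m unfolding embeds_def by auto
    have eu: "e a \<in> univ (As m)" if "a \<in> univ A" for a using e that by (auto simp: embedding_def)
    have "embedding k (f \<circ> e) A (F (wt m))" by (rule embedding_comp[OF e f(2)])
    moreover have "(f \<circ> e) ` univ A \<subseteq> tsucc T (wt m)" using f(3) eu by auto
    moreover have "\<forall>a\<in>univ A. \<exists>v'\<in>V (Suc m). prefix ((f \<circ> e) a) v'" using f(3) eu by force
    ultimately show ?thesis using f(1) by blast
  qed
  have subT: "V n \<subseteq> T" for n using RT by blast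
  have S: "ftree S" "S \<subseteq> T"
    unfolding S_def using ftree_downset[where T = T and V = V] T Pm(2)[of 0] subT spl by blast+
  have level: "{s \<in> S. length s = l m} = V m" for m
  proof
    show "V m \<subseteq> {s \<in> S. length s = l m}" using Pm(3) by (auto simp: S_def intro: downsetI)
    show "{s \<in> S. length s = l m} \<subseteq> V m"
    proof
      fix s assume "s \<in> {s \<in> S. length s = l m}"
      then obtain j v where s: "length s = l m" "v \<in> V j" "prefix s v" by (auto simp: S_def downset_def)
      have "l m \<le> l j" using prefix_length_le[OF s(3)] s(1) Pm(3)[OF s(2)] by simp
      then have "m \<le> j" using mono_l by (simp add: strict_mono_less_eq)
      then obtain v1 where v1: "v1 \<in> V m" "prefix v1 v"
        using downset_ancestor[of V m j v] ancV s(2) by blast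
      have "length s = length v1" using Pm(3)[OF v1(1)] s(1) by simp
      then have "s = v1" using v1(2) s(3) by (metis prefix_length_prefix prefix_order.antisym order_refl)
      then show "s \<in> V m" using v1(1) by simp
    qed
  qed
  \<comment> \<open>Nodes recorded after stage \<open>m\<close> stay in the reservoirs of stage
    \<open>m\<close>, so each cone of \<open>S\<close> lies in the reservoir of its node.\<close>
  have "Req {s \<in> S. length s = l m} (cone S)" for m
    unfolding level
  proof (rule mono[OF Pm(5)])
    fix v assume v: "v \<in> V m"
    show "cone S v \<subseteq> R m v"
    proof
      fix t assume "t \<in> cone S v"
      then have t: "t \<in> S" "prefix t v \<or> prefix v t" by (auto simp: cone_def)
      show "t \<in> R m v"
      proof (cases "prefix t v")
        case True
        then show ?thesis using ftree_prefix[OF RT(2,3)[OF v]] by blast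
      next
        case False
        then have vt: "prefix v t" using t(2) by simp
        obtain j v' where v': "v' \<in> V j" "prefix t v'" using t(1) by (auto simp: S_def downset_def)
        have vv': "prefix v v'" using vt v'(2) by (rule prefix_order.trans)
        have "l m \<le> l j" using prefix_length_le[OF vv'] Pm(3)[OF v] Pm(3)[OF v'(1)] by simp
        then have "m \<le> j" using mono_l by (simp add: strict_mono_less_eq)
        from nest[OF this v v'(1) vv'] have "v' \<in> R m v" using RT(3)[OF v'(1)] by blast
        then show ?thesis using ftree_prefix[OF RT(2)[OF v]] v'(2) by blast
      qed
    qed
  qed
  moreover have "\<exists>m. meet x y = wt m \<and> Suc (length (wt m)) = l (Suc m)"
    if x: "x \<in> branches S" and y: "y \<in> branches S" and ne: "x \<noteq> y" for x y
  proof -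
    let ?L = "length (meet x y)"
    obtain m where m: "l m \<le> ?L" "?L < l (Suc m)" using strict_mono_interval[OF mono_l l0] by blast
    have in_V: "restr z (l (Suc m)) \<in> V (Suc m)" if "z \<in> branches S" for z
      using that unfolding level[of "Suc m", symmetric] by (simp add: branches_def)
    have d: "restr x (l (Suc m)) \<noteq> restr y (l (Suc m))" using m(2) meet_length_less_iff[OF ne] by simp
    have "restr x (l m) = restr y (l m)" using m(1) meet_length_less_iff[OF ne] by (metis not_less)
    then have tk: "take (l m) (restr x (l (Suc m))) = take (l m) (restr y (l (Suc m)))"
      using wt1[of m] by (simp add: take_restr min_def)
    have "prefix (wt m) (restr x (l (Suc m)))" "prefix (wt m) (restr y (l (Suc m)))"
      using sk[OF in_V[OF x] in_V[OF y] d tk] by auto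
    then have p: "passes x (wt m)" "passes y (wt m)" using passes_prefix passes_restr by blast+
    then have "restr x (length (wt m)) = restr y (length (wt m))" by (simp add: passes_def)
    then have "length (wt m) \<le> ?L" using meet_length_less_iff[OF ne] by (metis not_less)
    then have "?L = length (wt m)" using m(2) wt1(2)[of m] by simp
    then have "meet x y = wt m" using passes_same_length[OF passes_meet(1) p(1)] by simp
    then show ?thesis using wt1(2) by auto
  qed
  ultimately show ?thesis using S mono_l l0
    by (intro exI[of _ S] exI[of _ l] exI[of _ wt]) simp
qed

end

section \<open>Types\<close>

lemma restr_split: "L < N \<Longrightarrow> restr x N = restr x L @ x L # map x [Suc L..<N]"
proof -
  assume "L < N"
  then have "[0..<N] = [0..<L] @ L # [Suc L..<N]"
    by (metis upt_add_eq_append upt_conv_Cons add_0 le0 le_add_diff_inverse less_imp_le)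
  then show ?thesis by (simp add: restr_def)
qed

lemma lt_Fmax_iff:
  assumes "x \<in> branches Tmax" "y \<in> branches Tmax" "x \<noteq> y"
  shows "(x, y) \<in> lt (Fmax F) \<longleftrightarrow> x (length (meet x y)) < y (length (meet x y))"
proof -
  let ?L = "length (meet x y)"
  have eq: "\<forall>m<?L. x m = y m"
    using passes_meet(1)[of x y] passes_meet(2)[of y x] by (simp add: passes_def restr_eq_iff[symmetric])
  have "n = ?L" if "\<forall>m<n. x m = y m" "x n < y n" for n
  proof (rule antisym)
    show "n \<le> ?L" using that(1) differ_at_meet[OF assms(3)] by (metis not_less)
    show "?L \<le> n" using that(2) eq by (metis less_irrefl not_less)
  qed
  then have "(\<exists>n. (\<forall>m<n. x m = y m) \<and> x n < y n) \<longleftrightarrow> x ?L < y ?L" using eq by blast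
  then show ?thesis using assms by (simp add: Fmax_def)
qed

lemma lt_Fmax_irrefl: "(x, x) \<notin> lt (Fmax F)"
  by (auto simp: Fmax_def)

lemma rel_Fmax_irrefl: "(x, x) \<notin> rel (Fmax F) l"
  by (auto simp: Fmax_def)

lemma rel_Fmax_iff:
  assumes "x \<in> branches Tmax" "y \<in> branches Tmax" "x \<noteq> y"
  shows "(x, y) \<in> rel (Fmax F) l \<longleftrightarrow>
    (restr x (Suc (length (meet x y))), restr y (Suc (length (meet x y)))) \<in> rel (F (meet x y)) l"
  using assms by (simp add: Fmax_def)

text \<open>Both orders are decided at the meet. This links the lexicographic order of the nodes of
  a separating level, in particular of the successors of a node, with the order of
  \<open>Fmax\<close>.\<close>

lemma lexord_restr_iff:
  assumes "x \<in> branches Tmax" "y \<in> branches Tmax" "restr x N \<noteq> restr y N"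
  shows "(restr x N, restr y N) \<in> lexord less_than \<longleftrightarrow> (x, y) \<in> lt (Fmax F)"
proof -
  let ?L = "length (meet x y)"
  have ne: "x \<noteq> y" using assms(3) by blast
  have L: "?L < N" using meet_length_less_iff[OF ne] assms(3) by simp
  have "restr x ?L = restr y ?L" using passes_meet(1)[of x y] passes_meet(2)[of y x] by (simp add: passes_def)
  then have "(restr x N, restr y N) \<in> lexord less_than \<longleftrightarrow> x ?L < y ?L"
    using differ_at_meet[OF ne] unfolding restr_split[OF L] by (simp add: lexord_same_pref_iff)
  then show ?thesis using lt_Fmax_iff[OF assms(1,2) ne] by simp
qed

text \<open>For recovering a distinguished branch from the restrictions of a set to a level, where
  its rank is still visible. A smaller element has strictly fewer predecessors.\<close>

lemma lexord_less_than_rank_unique: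
  assumes "finite W" "u \<in> W" "u' \<in> W"
    "card {z \<in> W. (z, u) \<in> lexord less_than} = card {z \<in> W. (z, u') \<in> lexord less_than}"
  shows "u = u'"
proof (rule ccontr)
  assume ne: "u \<noteq> u'"
  have irr: "(z, z) \<notin> lexord less_than" for z by (rule lexord_irreflexive) simp
  have less: "card {z \<in> W. (z, u) \<in> lexord less_than} < card {z \<in> W. (z, u') \<in> lexord less_than}"
    if "u \<in> W" "(u, u') \<in> lexord less_than" for u u'
  proof (rule psubset_card_mono)
    show "finite {z \<in> W. (z, u') \<in> lexord less_than}" using assms(1) by simp
    have "u \<in> {z \<in> W. (z, u') \<in> lexord less_than}" "u \<notin> {z \<in> W. (z, u) \<in> lexord less_than}"
      using that irr by auto
    moreover have "{z \<in> W. (z, u) \<in> lexord less_than} \<subseteq> {z \<in> W. (z, u') \<in> lexord less_than}"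
      using that(2) lexord_trans[OF _ _ trans_less_than] by blast
    ultimately show "{z \<in> W. (z, u) \<in> lexord less_than} \<subset> {z \<in> W. (z, u') \<in> lexord less_than}" by blast
  qed
  have "(u, u') \<in> lexord less_than \<or> (u', u) \<in> lexord less_than"
    using total_lexord[OF total_less_than] ne unfolding total_on_def by blast
  then show False using less[OF assms(2), of u'] less[OF assms(3), of u] assms(4) by auto
qed

lemma branches_cone: "x \<in> branches S \<Longrightarrow> passes x u \<Longrightarrow> x \<in> branches (cone S u)"
  unfolding branches_def cone_def using passes_comparable[OF passes_restr] by blast

lemma strong_isomorphismD:
  assumes "strong_isomorphism k F p X Y" "X \<subseteq> branches Tmax" "Y \<subseteq> branches Tmax"
  shows "inj_on p X" "p ` X = Y"
    "\<And>x y. x \<in> X \<Longrightarrow> y \<in> X \<Longrightarrow> (x, y) \<in> lt (Fmax F) \<longleftrightarrow> (p x, p y) \<in> lt (Fmax F)"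
    "\<And>l x y. l < k \<Longrightarrow> x \<in> X \<Longrightarrow> y \<in> X \<Longrightarrow> (x, y) \<in> rel (Fmax F) l \<longleftrightarrow> (p x, p y) \<in> rel (Fmax F) l"
    "\<And>x0 y0 x1 y1. x0 \<in> X \<Longrightarrow> y0 \<in> X \<Longrightarrow> x1 \<in> X \<Longrightarrow> y1 \<in> X \<Longrightarrow> x0 \<noteq> y0 \<Longrightarrow> x1 \<noteq> y1 \<Longrightarrow>
        (length (meet x0 y0) \<le> length (meet x1 y1) \<longleftrightarrow>
         length (meet (p x0) (p y0)) \<le> length (meet (p x1) (p y1)))"
proof -
  have u: "univ (induced (Fmax F) W) = W" if "W \<subseteq> branches Tmax" for W
    using that by (auto simp: induced_def Fmax_def)
  have iso: "isomorphism k p (induced (Fmax F) X) (induced (Fmax F) Y)"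
    using assms(1) by (simp add: strong_isomorphism_def)
  then show i: "inj_on p X" and im: "p ` X = Y"
    using u[OF assms(2)] u[OF assms(3)] by (simp_all add: isomorphism_def embedding_def)
  have pY: "p x \<in> Y" if "x \<in> X" for x using im that by blast
  show "(x, y) \<in> lt (Fmax F) \<longleftrightarrow> (p x, p y) \<in> lt (Fmax F)" if "x \<in> X" "y \<in> X" for x y
    using iso that pY unfolding isomorphism_def embedding_def u[OF assms(2)] by (simp add: induced_def)
  show "(x, y) \<in> rel (Fmax F) l \<longleftrightarrow> (p x, p y) \<in> rel (Fmax F) l" if "l < k" "x \<in> X" "y \<in> X" for l x y
    using iso that pY unfolding isomorphism_def embedding_def u[OF assms(2)] by (simp add: induced_def)
  show "length (meet x0 y0) \<le> length (meet x1 y1) \<longleftrightarrow>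
         length (meet (p x0) (p y0)) \<le> length (meet (p x1) (p y1))"
    if "x0 \<in> X" "y0 \<in> X" "x1 \<in> X" "y1 \<in> X" "x0 \<noteq> y0" "x1 \<noteq> y1" for x0 y0 x1 y1
    using assms(1) that unfolding strong_isomorphism_def by blast
qed

lemma strong_isomorphismI:
  assumes "X \<subseteq> branches Tmax" "Y \<subseteq> branches Tmax" "inj_on p X" "p ` X = Y"
    "\<And>x y. x \<in> X \<Longrightarrow> y \<in> X \<Longrightarrow> x \<noteq> y \<Longrightarrow> (x, y) \<in> lt (Fmax F) \<longleftrightarrow> (p x, p y) \<in> lt (Fmax F)"
    "\<And>l x y. l < k \<Longrightarrow> x \<in> X \<Longrightarrow> y \<in> X \<Longrightarrow> x \<noteq> y \<Longrightarrow>
      (x, y) \<in> rel (Fmax F) l \<longleftrightarrow> (p x, p y) \<in> rel (Fmax F) l"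
    "\<And>x0 y0 x1 y1. x0 \<in> X \<Longrightarrow> y0 \<in> X \<Longrightarrow> x1 \<in> X \<Longrightarrow> y1 \<in> X \<Longrightarrow> x0 \<noteq> y0 \<Longrightarrow> x1 \<noteq> y1 \<Longrightarrow>
        (length (meet x0 y0) \<le> length (meet x1 y1) \<longleftrightarrow>
         length (meet (p x0) (p y0)) \<le> length (meet (p x1) (p y1)))"
  shows "strong_isomorphism k F p X Y"
proof -
  have u: "univ (induced (Fmax F) W) = W" if "W \<subseteq> branches Tmax" for W
    using that by (auto simp: induced_def Fmax_def)
  have pY: "p x \<in> Y" if "x \<in> X" for x using assms(4) that by blast
  have lt: "(x, y) \<in> lt (Fmax F) \<longleftrightarrow> (p x, p y) \<in> lt (Fmax F)" if "x \<in> X" "y \<in> X" for x y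
    using assms(5)[OF that] lt_Fmax_irrefl by (cases "x = y") auto
  have rel: "(x, y) \<in> rel (Fmax F) l \<longleftrightarrow> (p x, p y) \<in> rel (Fmax F) l" if "l < k" "x \<in> X" "y \<in> X" for l x y
    using assms(6)[OF that] rel_Fmax_irrefl by (cases "x = y") auto
  have "isomorphism k p (induced (Fmax F) X) (induced (Fmax F) Y)"
    unfolding isomorphism_def embedding_def u[OF assms(1)] u[OF assms(2)]
    using assms(3,4) lt rel pY by (simp add: induced_def)
  then show ?thesis unfolding strong_isomorphism_def using assms(7) by blast
qed

lemma strong_isomorphism_subset:
  assumes "strong_isomorphism k F p X Y" "X \<subseteq> branches Tmax" "Y \<subseteq> branches Tmax" "Z \<subseteq> X"
  shows "strong_isomorphism k F p Z (p ` Z)"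
proof -
  note s = strong_isomorphismD[OF assms(1-3)]
  have Z: "z \<in> X" if "z \<in> Z" for z using assms(4) that by blast
  show ?thesis
  proof (rule strong_isomorphismI)
    show "Z \<subseteq> branches Tmax" "p ` Z \<subseteq> branches Tmax" using assms s(2) by auto
    show "inj_on p Z" using s(1) assms(4) by (rule inj_on_subset)
  qed (use s(3-5) Z in simp_all)
qed

lemma meet_restr_cong:
  assumes "restr x N \<noteq> restr y N" "restr x' N = restr x N" "restr y' N = restr y N"
  shows "meet x' y' = meet x y" "\<And>i. i \<le> length (meet x y) \<Longrightarrow> x' i = x i \<and> y' i = y i"
    "restr x' (Suc (length (meet x y))) = restr x (Suc (length (meet x y)))"
    "restr y' (Suc (length (meet x y))) = restr y (Suc (length (meet x y)))"
proof -
  let ?L = "length (meet x y)"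
  have ne: "x \<noteq> y" using assms(1) by blast
  have L: "?L < N" using meet_length_less_iff[OF ne] assms(1) by simp
  show e: "x' i = x i \<and> y' i = y i" if "i \<le> ?L" for i
    using assms(2,3) that L by (simp add: restr_eq_iff)
  then show "restr x' (Suc ?L) = restr x (Suc ?L)" "restr y' (Suc ?L) = restr y (Suc ?L)"
    by (auto simp: restr_eq_iff)
  show "meet x' y' = meet x y"
  proof (rule meet_eqI)
    have "restr x' ?L = restr x ?L" "restr y' ?L = restr y ?L" using e by (auto simp: restr_eq_iff)
    then show "passes x' (meet x y)" "passes y' (meet x y)" using passes_meet(1)[of x y] passes_meet(2)[of y x] by (simp_all add: passes_def)
    show "x' ?L \<noteq> y' ?L" using e[of ?L] differ_at_meet[OF ne] by simp
  qed
qed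

text \<open>Restrictions that separate \<open>X\<close> contain all meets of \<open>X\<close> and
  the successors at the meets, and these determine the type. So having a given type is decided at a
  finite level, which allows a colouring of one type to be extended to all \<open>n\<close>-element
  sets.\<close>

lemma strong_iso_of_restr:
  assumes X: "X \<in> [branches Tmax]\<^bsup>n\<^esup>" and Y: "Y \<in> [branches Tmax]\<^bsup>n\<^esup>"
    and inj: "inj_on (\<lambda>x. restr x N) X" and eq: "restrs N Y = restrs N X"
  shows "(X, Y) \<in> strong_iso_rel k F n"
proof -
  let ?r = "\<lambda>x. restr x N"
  have XT: "X \<subseteq> branches Tmax" "finite X" "card X = n" and YT: "Y \<subseteq> branches Tmax" "finite Y" "card Y = n"
    using X Y by (auto simp: nsets_def)
  have "\<forall>x\<in>X. \<exists>y. y \<in> Y \<and> ?r y = ?r x"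
  proof
    fix x assume "x \<in> X"
    then have "?r x \<in> ?r ` Y" using eq by blast
    then show "\<exists>y. y \<in> Y \<and> ?r y = ?r x" by (metis imageE)
  qed
  from bchoice[OF this] obtain p where p: "\<forall>x\<in>X. p x \<in> Y \<and> ?r (p x) = ?r x" ..
  have ip: "inj_on p X"
  proof (rule inj_onI)
    fix x x' assume x: "x \<in> X" "x' \<in> X" "p x = p x'"
    then have "?r x = ?r x'" using p by metis
    then show "x = x'" using inj x by (auto dest: inj_onD)
  qed
  have "p ` X \<subseteq> Y" using p by blast
  then have pX: "p ` X = Y" using YT XT card_image[OF ip] by (simp add: card_subset_eq)
  have m: "meet (p x) (p y) = meet x y" "x \<in> branches Tmax" "y \<in> branches Tmax" "p x \<in> branches Tmax" "p y \<in> branches Tmax" "p x \<noteq> p y"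
    "(p x) (length (meet x y)) = x (length (meet x y))" "(p y) (length (meet x y)) = y (length (meet x y))"
    "restr (p x) (Suc (length (meet x y))) = restr x (Suc (length (meet x y)))"
    "restr (p y) (Suc (length (meet x y))) = restr y (Suc (length (meet x y)))"
    if xy: "x \<in> X" "y \<in> X" "x \<noteq> y" for x y
  proof -
    have d: "?r x \<noteq> ?r y" using inj xy by (auto dest: inj_onD)
    note mc = meet_restr_cong[OF d, of "p x" "p y"]
    show "meet (p x) (p y) = meet x y" "(p x) (length (meet x y)) = x (length (meet x y))"
      "(p y) (length (meet x y)) = y (length (meet x y))"
      "restr (p x) (Suc (length (meet x y))) = restr x (Suc (length (meet x y)))"
      "restr (p y) (Suc (length (meet x y))) = restr y (Suc (length (meet x y)))"
      using mc p xy by simp_all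
    show "x \<in> branches Tmax" "y \<in> branches Tmax" "p x \<in> branches Tmax" "p y \<in> branches Tmax"
      using XT(1) YT(1) p xy by blast+
    show "p x \<noteq> p y" using ip xy by (auto dest: inj_onD)
  qed
  have "strong_isomorphism k F p X Y"
  proof (rule strong_isomorphismI[OF XT(1) YT(1) ip pX])
    fix x y assume xy: "x \<in> X" "y \<in> X" "x \<noteq> y"
    note m = m[OF xy]
    show "(x, y) \<in> lt (Fmax F) \<longleftrightarrow> (p x, p y) \<in> lt (Fmax F)"
      unfolding lt_Fmax_iff[OF m(2,3) xy(3)] lt_Fmax_iff[OF m(4,5,6)] m(1) m(7) m(8) ..
    show "(x, y) \<in> rel (Fmax F) l \<longleftrightarrow> (p x, p y) \<in> rel (Fmax F) l" for l
      unfolding rel_Fmax_iff[OF m(2,3) xy(3)] rel_Fmax_iff[OF m(4,5,6)] m(1) m(9) m(10) ..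
  qed (simp add: m(1))
  then show ?thesis using X Y unfolding strong_iso_rel_def by blast
qed

lemma restr_inj_bound:
  assumes "finite X"
  shows "\<exists>N. \<forall>N'\<ge>N. inj_on (\<lambda>x. restr x N') X"
proof -
  have "finite ((\<lambda>(x, y). length (meet x y)) ` (X \<times> X))" using assms by simp
  then obtain b where b: "\<forall>z\<in>(\<lambda>(x, y). length (meet x y)) ` (X \<times> X). z \<le> b"
    by (metis finite_nat_set_iff_bounded_le)
  have "inj_on (\<lambda>x. restr x N') X" if N': "Suc b \<le> N'" for N'
  proof (rule inj_onI, rule ccontr)
    fix x y assume xy: "x \<in> X" "y \<in> X" "restr x N' = restr y N'" "x \<noteq> y"
    have "length (meet x y) \<le> b" using b xy(1,2) by auto
    then show False using meet_length_less_iff[OF xy(4), of N'] xy(3) N' by simp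
  qed
  then show ?thesis by blast
qed

section \<open>Node structures seen from the branches\<close>

context ramsey_class begin

lemma induced_in_K:
  assumes w: "w \<in> Tmax" and P: "P \<subseteq> tsucc Tmax w" "P \<noteq> {}"
  shows "\<exists>A\<in>K. card (univ A) = card P \<and> isomorphic k (induced (F w) P) A"
proof -
  obtain B g where B: "B \<in> K" "isomorphism k g (F w) B"
    using nodes w unfolding node_structures_def isomorphic_def by blast
  have uF: "univ (F w) = tsucc Tmax w" by (rule univ_F[OF w])
  have g: "embedding k g (F w) B" using B(2) by (simp add: isomorphism_def)
  have gP: "g ` P \<subseteq> univ B" using g P(1) uF by (auto simp: embedding_def)
  have iso: "isomorphism k g (induced (F w) P) (induced B (g ` P))"
    by (rule embedding_restrict[OF g]) (use P(1) uF in simp)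
  have oB: "ordered_structure k B" by (rule K_ordered[OF B(1)])
  have "ordered_structure k (induced B Q)" if Q: "Q \<subseteq> univ B" "Q \<noteq> {}" for Q
  proof -
    have uQ: "univ (induced B Q) = Q" using Q(1) by (auto simp: univ_induced)
    have sl: "trans (lt B)" "irrefl (lt B)" "total_on (univ B) (lt B)"
      using oB by (simp_all add: ordered_structure_def strict_linear_order_on_def)
    have "trans (lt B \<inter> Q \<times> Q)" by (rule transI) (auto dest: transD[OF sl(1)])
    moreover have "irrefl (lt B \<inter> Q \<times> Q)" using sl(2) by (simp add: irrefl_def)
    moreover have "total_on Q (lt B \<inter> Q \<times> Q)"
      using sl(3) Q(1) unfolding total_on_def by blast
    ultimately show ?thesis
      unfolding ordered_structure_def uQ using Q(2) by (auto simp: strict_linear_order_on_def induced_def)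
  qed
  from this[OF gP] have "ordered_structure k (induced B (g ` P))" using P(2) by simp
  moreover have "embedding k id (induced B (g ` P)) B"
    by (auto simp: embedding_def induced_def)
  ultimately have "induced B (g ` P) \<in> K" using K_hereditary[OF B(1)] unfolding embeds_def by blast
  moreover have "card (univ (induced B (g ` P))) = card P"
  proof -
    have "inj_on g P" using g P(1) uF by (auto simp: embedding_def elim: inj_on_subset)
    moreover have "univ (induced B (g ` P)) = g ` P" using gP by (auto simp: univ_induced)
    ultimately show ?thesis by (simp add: card_image)
  qed
  ultimately show ?thesis using iso unfolding isomorphic_def by blast
qed

text \<open>The one-point structures of \<open>K\<close> are isomorphic by
  \<open>uniform_loops\<close>, so a loop at one successor of a node occurs at all successors of all
  nodes.\<close>

lemma loops_agree:
  assumes "w \<in> Tmax" "a \<in> tsucc Tmax w" "w' \<in> Tmax" "a' \<in> tsucc Tmax w'" "l < k"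
  shows "(a, a) \<in> rel (F w) l \<longleftrightarrow> (a', a') \<in> rel (F w') l"
proof -
  obtain A where A: "A \<in> K" "card (univ A) = 1" "isomorphic k (induced (F w) {a}) A"
    using induced_in_K[OF assms(1), of "{a}"] assms(2) by auto
  obtain A' where A': "A' \<in> K" "card (univ A') = 1" "isomorphic k (induced (F w') {a'}) A'"
    using induced_in_K[OF assms(3), of "{a'}"] assms(4) by auto
  have "isomorphic k A A'" using loops A A' unfolding uniform_loops_def by blast
  then have "isomorphic k (induced (F w) {a}) (induced (F w') {a'})"
    by (rule isomorphic_trans[OF isomorphic_trans[OF A(3)] isomorphic_sym[OF A'(3)]])
  then obtain h where h: "isomorphism k h (induced (F w) {a}) (induced (F w') {a'})"
    unfolding isomorphic_def by blast
  have u: "univ (induced (F w) {a}) = {a}" "univ (induced (F w') {a'}) = {a'}"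
    using univ_F assms by (auto simp: univ_induced)
  have ha: "h a = a'" using h unfolding isomorphism_def u by simp
  have "(a, a) \<in> rel (induced (F w) {a}) l \<longleftrightarrow> (h a, h a) \<in> rel (induced (F w') {a'}) l"
    using h assms(5) unfolding isomorphism_def embedding_def u by simp
  then show ?thesis unfolding ha by (simp add: induced_def)
qed

lemma lt_node:
  assumes "w \<in> Tmax" "a \<in> tsucc Tmax w" "b \<in> tsucc Tmax w"
  shows "(a, b) \<in> lt (F w) \<longleftrightarrow> (a, b) \<in> lexord less_than"
proof -
  have "lt (F w) = lexord less_than \<inter> tsucc Tmax w \<times> tsucc Tmax w"
    using nodes assms(1) unfolding node_structures_def by blast
  then show ?thesis using assms by simp
qed

text \<open>Passage from branches back to nodes. Pairs of distinct successors of \<open>w\<close>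
  come from pairs of branches with meet \<open>w\<close>, whose order and relations \<open>p\<close>
  preserves; loops leave no trace in \<open>Fmax\<close> and agree by
  \<open>loops_agree\<close>.\<close>

lemma node_copy:
  assumes P: "P \<subseteq> branches Tmax" "\<forall>x\<in>P. passes x w" "inj_on (\<lambda>x. restr x (Suc (length w))) P"
    and P': "P' \<subseteq> branches Tmax" "\<forall>x\<in>P'. passes x w'" "inj_on (\<lambda>x. restr x (Suc (length w'))) P'"
    and p: "p ` P = P'" "inj_on p P"
    and lt: "\<And>x y. x \<in> P \<Longrightarrow> y \<in> P \<Longrightarrow> (x, y) \<in> lt (Fmax F) \<longleftrightarrow> (p x, p y) \<in> lt (Fmax F)"
    and rel: "\<And>l x y. l < k \<Longrightarrow> x \<in> P \<Longrightarrow> y \<in> P \<Longrightarrow> (x, y) \<in> rel (Fmax F) l \<longleftrightarrow> (p x, p y) \<in> rel (Fmax F) l"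
    and ne: "P \<noteq> {}"
  shows "isomorphic k (induced (F w) (restrs (Suc (length w)) P))
    (induced (F w') (restrs (Suc (length w')) P'))"
proof -
  let ?r = "\<lambda>x. restr x (Suc (length w))" and ?r' = "\<lambda>x. restr x (Suc (length w'))"
  have succ: "restr x (Suc (length v)) \<in> tsucc Tmax v" "v \<in> Tmax" if "x \<in> branches Tmax" "passes x v" for x v
  proof -
    show "v \<in> Tmax" using branches_passes[OF that] .
    have "restr x (Suc (length v)) = v @ [x (length v)]" using that(2) by (simp add: restr_Suc passes_def)
    moreover have "restr x (Suc (length v)) \<in> Tmax" using that(1) by (simp add: branches_def)
    ultimately show "restr x (Suc (length v)) \<in> tsucc Tmax v" by (auto simp: tsucc_def)
  qed
  have key: "meet x y = v \<and> x \<noteq> y" if "passes x v" "passes y v" "restr x (Suc (length v)) \<noteq> restr y (Suc (length v))" for x y v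
  proof -
    have "x (length v) \<noteq> y (length v)" using that by (auto simp: restr_Suc passes_def)
    then show ?thesis using meet_eqI[OF that(1,2)] by blast
  qed
  have pb: "p x \<in> branches Tmax" "passes (p x) w'" "x \<in> branches Tmax" "passes x w" if "x \<in> P" for x
    using P P' p that by blast+
  obtain x0 where x0: "x0 \<in> P" using ne by blast
  have wT: "w \<in> Tmax" "w' \<in> Tmax" using succ(2) pb[OF x0] by blast+
  define g where "g a = ?r' (p (inv_into P ?r a))" for a
  have g: "g (?r x) = ?r' (p x)" if "x \<in> P" for x
    using inv_into_f_f[OF P(3) that] by (simp add: g_def)
  have rr: "?r x = ?r y \<longleftrightarrow> x = y" "?r' (p x) = ?r' (p y) \<longleftrightarrow> x = y" if "x \<in> P" "y \<in> P" for x y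
    using P(3) P'(3) p that by (auto simp: inj_on_def)
  have u: "univ (induced (F w) (?r ` P)) = ?r ` P" "univ (induced (F w') (?r' ` P')) = ?r' ` P'"
    using succ pb p univ_F wT by (auto simp: univ_induced)
  have im: "g ` ?r ` P = ?r' ` P'" using g p(1) by (auto simp: image_iff)
  have Lt: "(?r x, ?r y) \<in> lt (F w) \<longleftrightarrow> (?r' (p x), ?r' (p y)) \<in> lt (F w')" if xy: "x \<in> P" "y \<in> P" for x y
  proof (cases "x = y")
    case True
    have "(z, z) \<notin> lexord less_than" for z :: "nat list" by (rule lexord_irreflexive) simp
    then show ?thesis using True succ pb[OF xy(1)] wT by (simp add: lt_node)
  next
    case False
    have "(?r x, ?r y) \<in> lt (F w) \<longleftrightarrow> (x, y) \<in> lt (Fmax F)"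
      using lexord_restr_iff[of x y "Suc (length w)"] rr(1)[OF xy] False succ(1) pb xy wT by (simp add: lt_node)
    moreover have "(?r' (p x), ?r' (p y)) \<in> lt (F w') \<longleftrightarrow> (p x, p y) \<in> lt (Fmax F)"
      using lexord_restr_iff[of "p x" "p y" "Suc (length w')"] rr(2)[OF xy] False succ(1) pb xy wT by (simp add: lt_node)
    ultimately show ?thesis using lt[OF xy] by simp
  qed
  have Rel: "(?r x, ?r y) \<in> rel (F w) l \<longleftrightarrow> (?r' (p x), ?r' (p y)) \<in> rel (F w') l" if xy: "x \<in> P" "y \<in> P" and l: "l < k" for x y l
  proof (cases "x = y")
    case True
    have "?r x \<in> tsucc Tmax w" "?r' (p x) \<in> tsucc Tmax w'" using succ(1) pb[OF xy(1)] by blast+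
    then show ?thesis using True loops_agree[OF wT(1) _ wT(2) _ l] by simp
  next
    case False
    have 1: "meet x y = w" using key[of x w y] pb[OF xy(1)] pb[OF xy(2)] rr(1)[OF xy] False by simp
    have 2: "meet (p x) (p y) = w'" "p x \<noteq> p y"
      using key[of "p x" w' "p y"] pb[OF xy(1)] pb[OF xy(2)] rr(2)[OF xy] False by auto
    have "(x, y) \<in> rel (Fmax F) l \<longleftrightarrow> (?r x, ?r y) \<in> rel (F w) l"
      using rel_Fmax_iff[of x y] pb[OF xy(1)] pb[OF xy(2)] False 1 by simp
    moreover have "(p x, p y) \<in> rel (Fmax F) l \<longleftrightarrow> (?r' (p x), ?r' (p y)) \<in> rel (F w') l"
      using rel_Fmax_iff[of "p x" "p y"] pb[OF xy(1)] pb[OF xy(2)] 2 by simp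
    ultimately show ?thesis using rel[OF l xy] by simp
  qed
  have "isomorphism k g (induced (F w) (?r ` P)) (induced (F w') (?r' ` P'))"
    unfolding isomorphism_def embedding_def u
  proof (intro conjI ballI allI impI)
    show "inj_on g (?r ` P)"
    proof (rule inj_onI)
      fix a b assume "a \<in> ?r ` P" "b \<in> ?r ` P" "g a = g b"
      then show "a = b" using g rr by auto
    qed
    show "g ` ?r ` P \<subseteq> ?r' ` P'" "g ` ?r ` P = ?r' ` P'" using im by simp_all
    fix a b assume "a \<in> ?r ` P" "b \<in> ?r ` P"
    then obtain x y where xy: "x \<in> P" "y \<in> P" "a = ?r x" "b = ?r y" by blast
    have px: "p x \<in> P'" "p y \<in> P'" using p(1) xy by blast+
    show "(a, b) \<in> lt (induced (F w) (?r ` P)) \<longleftrightarrow> (g a, g b) \<in> lt (induced (F w') (?r' ` P'))"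
      using Lt[OF xy(1,2)] xy px g by (simp add: induced_def)
    show "(a, b) \<in> rel (induced (F w) (?r ` P)) l \<longleftrightarrow> (g a, g b) \<in> rel (induced (F w') (?r' ` P')) l" if "l < k" for l
      using Rel[OF xy(1,2) that] xy px g by (simp add: induced_def)
  qed
  then show ?thesis unfolding isomorphic_def by blast
qed

lemma colouring_mono:
  assumes "colouring n T c r" "S \<subseteq> T"
  shows "colouring n S c r"
proof -
  have sub: "[branches S]\<^bsup>n\<^esup> \<subseteq> [branches T]\<^bsup>n\<^esup>" using branches_mono[OF assms(2)] by (auto simp: nsets_def)
  note c0 = assms(1)[unfolded colouring_def]
  note c = conjunct1[OF c0] conjunct2[OF c0]
  show ?thesis
    unfolding colouring_def
  proof (intro conjI ballI)
    show "\<forall>X. c X < r" by (rule c(1))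
    fix X assume "X \<in> [branches S]\<^bsup>n\<^esup>"
    from bspec[OF c(2) subsetD[OF sub this]] obtain N where
      N: "\<forall>Y\<in>[branches T]\<^bsup>n\<^esup>. restrs N Y = restrs N X \<longrightarrow> c Y = c X" ..
    show "\<exists>N. \<forall>Y\<in>[branches S]\<^bsup>n\<^esup>. restrs N Y = restrs N X \<longrightarrow> c Y = c X"
      by (rule exI[of _ N], rule ballI, rule bspec[OF N subsetD[OF sub]])
  qed
qed

lemma config_mono:
  assumes "config A R' u W X" "u \<in> W" "\<And>v. v \<in> W \<Longrightarrow> R' v \<subseteq> R v"
  shows "config A R u W X"
proof -
  have b: "x \<in> branches (R v)" if "v \<in> W" "x \<in> branches (R' v)" for x v
    using branches_mono[OF assms(3)] that by blast
  obtain w P y where "prefix u w" "P \<subseteq> branches (R' u)" "\<forall>x\<in>P. passes x w"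
     "inj_on (\<lambda>x. restr x (Suc (length w))) P"
     "isomorphic k (induced (F w) (restrs (Suc (length w)) P)) A"
     "\<forall>v\<in>W - {u}. y v \<in> branches (R' v)" "X = P \<union> y ` (W - {u})"
    using assms(1) unfolding config_def by (elim exE conjE)
  then show ?thesis
    unfolding config_def using b assms(2) by (intro exI[of _ w] exI[of _ P] exI[of _ y]) auto
qed

end

section \<open>The partition theorem\<close>

context ramsey_class begin

text \<open>The finitely many pairs \<open>(W, u)\<close> are handled one after another; by
  \<open>config_mono\<close> later shrinking keeps what has been achieved. Equal lengths make
  distinct nodes incomparable.\<close>

lemma homogeneous_requirement:
  assumes c: "colouring n T c r" and A: "A \<in> K" "2 \<le> card (univ A)" and n': "n' + card (univ A) = Suc n"
    and V: "finite V" "\<forall>v\<in>V. stem_tree T (R v) v" "\<forall>u\<in>V. \<forall>v\<in>V. length u = length v"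
  shows "\<exists>R'. (\<forall>v\<in>V. stem_tree (R v) (R' v) v) \<and>
    (\<forall>W\<subseteq>V. \<forall>u\<in>W. card W = n' \<longrightarrow> (\<exists>\<epsilon>. \<forall>X. config A R' u W X \<longrightarrow> c X = \<epsilon>))"
proof -
  let ?ok = "\<lambda>R' x. \<exists>\<epsilon>. \<forall>X. config A R' (snd x) (fst x) X \<longrightarrow> c X = \<epsilon>"
  have all: "\<exists>R'. (\<forall>v\<in>V. stem_tree (R v) (R' v) v) \<and> (\<forall>x\<in>Z. ?ok R' x)"
    if "finite Z" "Z \<subseteq> {(W, u). W \<subseteq> V \<and> u \<in> W \<and> card W = n'}" for Z
    using that
  proof (induction Z rule: finite_induct)
    case empty
    have "\<forall>v\<in>V. stem_tree (R v) (R v) v" using V(2) by (simp add: stem_tree_def)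
    then show ?case by blast
  next
    case (insert x Z)
    then obtain R1 where R1: "\<forall>v\<in>V. stem_tree (R v) (R1 v) v" "\<forall>x\<in>Z. ?ok R1 x" by auto
    obtain W u where x: "x = (W, u)" "W \<subseteq> V" "u \<in> W" "card W = n'" using insert.prems by auto
    have st: "stem_tree T (R1 v) v" if "v \<in> W" for v
      using R1(1) V(2) x(2) that by (fastforce simp: stem_tree_def)
    have anti: "a = b" if "a \<in> W" "b \<in> W" "prefix a b" for a b
    proof -
      have "length a = length b" using V(3) x(2) that(1,2) by blast
      then show ?thesis using that(3) by (auto simp: prefix_def)
    qed
    have "\<exists>R' \<epsilon>. (\<forall>v\<in>W. stem_tree (R1 v) (R' v) v) \<and> (\<forall>X. config A R' u W X \<longrightarrow> c X = \<epsilon>)"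
      by (rule homogeneous_configurations[OF c A finite_subset[OF x(2) V(1)] x(3)])
        (use x(4) n' st anti in auto)
    then obtain R2 \<epsilon> where R2: "\<forall>v\<in>W. stem_tree (R1 v) (R2 v) v" "\<forall>X. config A R2 u W X \<longrightarrow> c X = \<epsilon>"
      by (elim exE conjE)
    define R' where "R' v = (if v \<in> W then R2 v else R1 v)" for v
    have sub: "R' v \<subseteq> R1 v" for v using R2(1) by (simp add: R'_def stem_tree_def)
    have "?ok R' x"
    proof (intro exI[of _ \<epsilon>] allI impI)
      fix X assume "config A R' (snd x) (fst x) X"
      then have "config A R' u W X" by (simp add: x(1))
      then have "config A R2 u W X" by (rule config_mono[OF _ x(3)]) (simp add: R'_def)
      then show "c X = \<epsilon>" using R2(2) by blast
    qed
    moreover have "?ok R' y" if y: "y \<in> Z" for y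
    proof -
      obtain \<delta> where \<delta>: "\<forall>X. config A R1 (snd y) (fst y) X \<longrightarrow> c X = \<delta>" using R1(2) y by blast
      have "snd y \<in> fst y" using insert.prems y by auto
      then have "config A R1 (snd y) (fst y) X" if "config A R' (snd y) (fst y) X" for X
        using config_mono[OF that] sub by blast
      then show ?thesis using \<delta> by blast
    qed
    moreover have "stem_tree (R v) (R' v) v" if v: "v \<in> V" for v
    proof (cases "v \<in> W")
      case True
      then have 2: "stem_tree (R1 v) (R2 v) v" and 1: "stem_tree (R v) (R1 v) v" using R2(1) R1(1) v by blast+
      have "R1 v \<subseteq> R v" using 1 by (simp add: stem_tree_def)
      from stem_tree_mono[OF 2 this] show ?thesis using True by (simp add: R'_def)
    next
      case False
      then show ?thesis using R1(1) v by (simp add: R'_def)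
    qed
    ultimately show ?case by blast
  qed
  have "finite {(W, u). W \<subseteq> V \<and> u \<in> W \<and> card W = n'}"
    by (rule finite_subset[of _ "Pow V \<times> V"]) (use V(1) in auto)
  from all[OF this order_refl] obtain R' where R': "\<forall>v\<in>V. stem_tree (R v) (R' v) v"
    "\<forall>x\<in>{(W, u). W \<subseteq> V \<and> u \<in> W \<and> card W = n'}. ?ok R' x" by (elim exE conjE)
  have "\<exists>\<epsilon>. \<forall>X. config A R' u W X \<longrightarrow> c X = \<epsilon>" if "W \<subseteq> V" "u \<in> W" "card W = n'" for W u
    using bspec[OF R'(2), of "(W, u)"] that by simp
  then show ?thesis using R'(1) by blast
qed

lemma type_members:
  assumes \<tau>: "\<tau> \<in> types k F n"
  shows "X \<in> \<tau> \<Longrightarrow> X \<in> [branches Tmax]\<^bsup>n\<^esup>" "X \<in> \<tau> \<Longrightarrow> Y \<in> \<tau> \<Longrightarrow> \<exists>p. strong_isomorphism k F p X Y"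
    "X \<in> \<tau> \<Longrightarrow> (X, Y) \<in> strong_iso_rel k F n \<Longrightarrow> Y \<in> \<tau>"
    "Y \<in> \<tau> \<Longrightarrow> (X, Y) \<in> strong_iso_rel k F n \<Longrightarrow> X \<in> \<tau>"
proof -
  note eq = equiv_strong_iso_rel[of n k F] and q = \<tau>[unfolded types_def]
  show "X \<in> \<tau> \<Longrightarrow> X \<in> [branches Tmax]\<^bsup>n\<^esup>" using in_quotient_imp_subset[OF eq q] by blast
  show "\<exists>p. strong_isomorphism k F p X Y" if "X \<in> \<tau>" "Y \<in> \<tau>"
    using in_quotient_imp_in_rel[OF eq q, of X Y] that by (auto simp: strong_iso_rel_def)
  show "X \<in> \<tau> \<Longrightarrow> (X, Y) \<in> strong_iso_rel k F n \<Longrightarrow> Y \<in> \<tau>"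
    by (rule in_quotient_imp_closed[OF eq q])
  have "sym (strong_iso_rel k F n)" using eq by (simp add: equiv_def)
  then show "Y \<in> \<tau> \<Longrightarrow> (X, Y) \<in> strong_iso_rel k F n \<Longrightarrow> X \<in> \<tau>"
    using in_quotient_imp_closed[OF eq q] by (blast dest: symD)
qed

text \<open>There is nothing to split: for one branch, local constancy at some branch of
  \<open>T\<close> gives a cone.\<close>

lemma homogeneous_small:
  assumes T: "ftree T" and c: "colouring n T c r" and \<tau>: "\<tau> \<in> types k F n" and n: "n \<le> 1"
  shows "\<exists>S i. ftree S \<and> S \<subseteq> T \<and> (\<forall>X\<in>of_type S \<tau>. c X = i)"
proof (cases "n = 0")
  case True
  have "c X = c {}" if "X \<in> of_type T \<tau>" for X
    using that type_members(1)[OF \<tau>, of X] True by (auto simp: of_type_def nsets_def)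
  then show ?thesis using T by blast
next
  case False
  then have n1: "n = 1" using n by simp
  obtain x where x: "x \<in> branches T" using branch_through[OF T ftree_Nil[OF T]] by blast
  then have "{x} \<in> [branches T]\<^bsup>n\<^esup>" by (simp add: nsets_def n1)
  then obtain N where N: "\<forall>Y\<in>[branches T]\<^bsup>n\<^esup>. restrs N Y = restrs N {x} \<longrightarrow> c Y = c {x}"
    using bspec[OF conjunct2[OF c[unfolded colouring_def]]] by blast
  let ?S = "cone T (restr x N)"
  have rT: "restr x N \<in> T" using x by (simp add: branches_def)
  have S: "stem_tree T ?S (restr x N)" by (rule stem_tree_cone[OF T rT])
  have "c X = c {x}" if X: "X \<in> of_type ?S \<tau>" for X
  proof -
    have "X \<in> [branches Tmax]\<^bsup>n\<^esup>" "X \<subseteq> branches ?S" using X type_members(1)[OF \<tau>] by (auto simp: of_type_def)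
    then obtain y where y: "X = {y}" "y \<in> branches ?S" by (auto simp: nsets_def n1 card_1_singleton_iff)
    have "passes y (restr x N)" by (rule stem_tree_branch[OF S y(2)])
    then have "restrs N X = restrs N {x}" by (simp add: y(1) passes_def)
    moreover have "X \<in> [branches T]\<^bsup>n\<^esup>"
      using y branches_mono[of ?S T] by (auto simp: nsets_def n1 cone_def)
    ultimately show ?thesis using N by blast
  qed
  then show ?thesis using S unfolding stem_tree_def by blast
qed

text \<open>Three trees: \<open>S1\<close> is skew; in \<open>S2\<close> the colour of a
  configuration over a recorded level depends only on its nodes and the place of its copy; in
  \<open>S3\<close> the induction hypothesis, applied to the colouring \<open>c'\<close> of the
  smaller sets, removes this dependence.\<close>

lemma homogeneous_subtree:
  assumes "ftree T" "colouring n T c r" "\<tau> \<in> types k F n"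
  shows "\<exists>S i. ftree S \<and> S \<subseteq> T \<and> (\<forall>X\<in>of_type S \<tau>. c X = i)"
  using assms
proof (induction n arbitrary: T c r \<tau> rule: less_induct)
  case (less n)
  note T = less.prems(1) and c = less.prems(2) and \<tau> = less.prems(3)
  show ?case
  proof (cases "n \<le> 1")
    case True
    then show ?thesis using homogeneous_small[OF T c \<tau>] by blast
  next
    case False
    \<comment> \<open>Fusion with an empty requirement: only the skewness of the result is of
      interest.\<close>
    have "\<exists>S l wt. ftree S \<and> S \<subseteq> T \<and> strict_mono (l :: nat \<Rightarrow> nat) \<and> l 0 = 0 \<and>
      (\<forall>m::nat. True) \<and>
      (\<forall>x\<in>branches S. \<forall>y\<in>branches S. x \<noteq> y \<longrightarrow> (\<exists>m. meet x y = wt m \<and> Suc (length (wt m)) = l (Suc m)))"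
    proof (rule fusion[OF T, of "\<lambda>_ _. True"])
      show "\<forall>V R. finite V \<and> (\<forall>v\<in>V. stem_tree T (R v) v) \<and> (\<forall>u\<in>V. \<forall>v\<in>V. length u = length v) \<longrightarrow>
        (\<exists>R'. (\<forall>v\<in>V. stem_tree (R v) (R' v) v) \<and> True)"
      proof (intro allI impI)
        fix V :: "nat list set" and R assume "finite V \<and> (\<forall>v\<in>V. stem_tree T (R v) v) \<and> (\<forall>u\<in>V. \<forall>v\<in>V. length u = length v)"
        then have "\<forall>v\<in>V. stem_tree (R v) (R v) v" unfolding stem_tree_def by blast
        then show "\<exists>R'. (\<forall>v\<in>V. stem_tree (R v) (R' v) v) \<and> True" by blast
      qed
    qed simp
    then obtain S1 l1 wt1 where S1: "ftree S1" "S1 \<subseteq> T" "strict_mono (l1 :: nat \<Rightarrow> nat)"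
      and sk1: "\<forall>x\<in>branches S1. \<forall>y\<in>branches S1. x \<noteq> y \<longrightarrow> (\<exists>m. meet x y = wt1 m \<and> Suc (length (wt1 m)) = l1 (Suc m))"
      by (elim exE conjE)
    have skew: "meet x y = meet x' y'"
      if "x \<in> branches S1" "y \<in> branches S1" "x \<noteq> y" "x' \<in> branches S1" "y' \<in> branches S1" "x' \<noteq> y'"
        "length (meet x y) = length (meet x' y')" for x y x' y'
    proof -
      obtain m m' where m: "meet x y = wt1 m" "Suc (length (wt1 m)) = l1 (Suc m)"
        "meet x' y' = wt1 m'" "Suc (length (wt1 m')) = l1 (Suc m')"
        using sk1 \<open>x \<in> branches S1\<close> \<open>y \<in> branches S1\<close> \<open>x \<noteq> y\<close> \<open>x' \<in> branches S1\<close> \<open>y' \<in> branches S1\<close> \<open>x' \<noteq> y'\<close>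
        by blast
      then have "l1 (Suc m) = l1 (Suc m')" using \<open>length (meet x y) = length (meet x' y')\<close> by metis
      then have "m = m'" using S1(3) by (simp add: strict_mono_eq)
      then show ?thesis using m by simp
    qed
    show ?thesis
    proof (cases "of_type S1 \<tau> = {}")
      case True
      then show ?thesis using S1 by blast
    next
      case ne: False
      have S1T: "branches S1 \<subseteq> branches Tmax" by (rule branches_mono[OF ftree_Tmax[OF S1(1)]])
      \<comment> \<open>One set of the type serves as a template: it fixes the structure
        \<open>A\<close>, the type of the smaller sets and the rank \<open>j0\<close>.\<close>
      obtain X0 where "X0 \<in> of_type S1 \<tau>" using ne by blast
      then have X0: "X0 \<in> \<tau>" "X0 \<subseteq> branches S1" by (auto simp: of_type_def)
      have X0n: "finite X0" "card X0 = n" "X0 \<subseteq> branches Tmax"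
        using type_members(1)[OF \<tau> X0(1)] by (auto simp: nsets_def)
      let ?D = "(\<lambda>(x, y). length (meet x y)) ` {(x, y). x \<in> X0 \<and> y \<in> X0 \<and> x \<noteq> y}"
      have finD: "finite ?D"
        by (rule finite_imageI, rule finite_subset[of _ "X0 \<times> X0"]) (use X0n in auto)
      have "\<not> card X0 \<le> Suc 0" using X0n(2) False by simp
      then have Dne: "?D \<noteq> {}" using card_le_Suc0_iff_eq[OF X0n(1)] by auto
      define L0 where "L0 = Max ?D"
      have "L0 \<in> ?D" unfolding L0_def by (rule Max_in[OF finD Dne])
      then obtain a b where ab: "a \<in> X0" "b \<in> X0" "a \<noteq> b" "length (meet a b) = L0" by auto
      have L0max: "length (meet x y) \<le> L0" if "x \<in> X0" "y \<in> X0" "x \<noteq> y" for x y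
        unfolding L0_def by (rule Max_ge[OF finD]) (use that in auto)
      define w0 where "w0 = meet a b"
      have lw0: "length w0 = L0" using ab(4) by (simp add: w0_def)
      define P0 where "P0 = {x \<in> X0. passes x w0}"
      have aP: "a \<in> P0" "b \<in> P0" using ab passes_meet(1)[of a b] passes_meet(2)[of b a] by (auto simp: P0_def w0_def)
      have in_P: "meet x y = w0" if "x \<in> P0" "y \<in> P0" "x \<noteq> y" for x y
      proof -
        have p: "passes x w0" "passes y w0" "x \<in> X0" "y \<in> X0" using that by (auto simp: P0_def)
        then have "\<not> length (meet x y) < L0" using meet_length_less_iff[OF that(3), of L0] by (simp add: passes_def lw0)
        then have "length (meet x y) = length w0" using L0max[OF p(3,4) that(3)] lw0 by simp
        then show ?thesis by (rule passes_same_length[OF passes_meet(1) p(1)])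
      qed
      \<comment> \<open>Here skewness enters: a meet of maximal length equals \<open>w0\<close>, so
        its two branches lie in \<open>P0\<close>.\<close>
      have out_P: "length (meet x y) < L0" if "x \<in> X0" "y \<in> X0" "x \<noteq> y" "\<not> (x \<in> P0 \<and> y \<in> P0)" for x y
      proof (rule ccontr)
        assume "\<not> ?thesis"
        then have "length (meet x y) = length (meet a b)" using L0max[OF that(1-3)] ab(4) by simp
        then have "meet x y = w0" unfolding w0_def using skew X0(2) that ab by blast
        then have "x \<in> P0 \<and> y \<in> P0" using that passes_meet(1)[of x y] passes_meet(2)[of y x] by (simp add: P0_def)
        then show False using that(4) by blast
      qed
      have P0X: "P0 \<subseteq> X0" by (auto simp: P0_def)
      have finP0: "finite P0" using finite_subset[OF P0X X0n(1)] .
      have cP0: "2 \<le> card P0"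
        using card_mono[OF finP0, of "{a, b}"] aP ab(3) by simp
      \<comment> \<open>\<open>a\<close> stands for all of \<open>P0\<close>. As \<open>P0\<close>
        also contains \<open>b\<close>, the set gets smaller and the induction hypothesis
        applies.\<close>
      define Y0 where "Y0 = insert a (X0 - P0)"
      have aX: "a \<notin> X0 - P0" using aP by simp
      have finY0: "finite Y0" using X0n(1) by (simp add: Y0_def)
      have cY0: "card Y0 + card P0 = Suc n"
      proof -
        have "card Y0 = Suc (card (X0 - P0))" using aX X0n(1) by (simp add: Y0_def)
        moreover have "card (X0 - P0) = card X0 - card P0" by (rule card_Diff_subset[OF finP0 P0X])
        moreover have "card P0 \<le> card X0" by (rule card_mono[OF X0n(1) P0X])
        ultimately show ?thesis using X0n(2) by simp
      qed
      define n' where "n' = card Y0"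
      have n'n: "n' < n" using cY0 cP0 by (simp add: n'_def)
      have Y0X: "Y0 \<subseteq> X0" using ab(1) by (auto simp: Y0_def)
      have w0T: "w0 \<in> Tmax"
        using branches_passes[of a Tmax w0] passes_meet(1)[of a b] X0n(3) ab(1) by (auto simp: w0_def)
      let ?rz = "\<lambda>x. restr x (Suc (length w0))"
      have inj0: "inj_on ?rz P0"
      proof (rule inj_onI, rule ccontr)
        fix x y assume xy: "x \<in> P0" "y \<in> P0" "?rz x = ?rz y" "x \<noteq> y"
        then show False using meet_length_less_iff[OF xy(4), of "Suc (length w0)"] in_P[OF xy(1,2,4)] by simp
      qed
      have r0T: "?rz x \<in> tsucc Tmax w0" if x: "x \<in> P0" for x
      proof -
        have "?rz x \<in> Tmax" using x X0n(3) by (auto simp: P0_def branches_def)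
        moreover have "?rz x = w0 @ [x (length w0)]" using x by (simp add: P0_def restr_Suc passes_def)
        ultimately show ?thesis by (auto simp: tsucc_def)
      qed
      have "?rz ` P0 \<subseteq> tsucc Tmax w0" "?rz ` P0 \<noteq> {}" using r0T aP by blast+
      from induced_in_K[OF w0T this] obtain A where A: "A \<in> K" "card (univ A) = card (?rz ` P0)"
        and isoA: "isomorphic k (induced (F w0) (?rz ` P0)) A" by blast
      have cA: "card (univ A) = card P0" using A(2) card_image[OF inj0] by simp
      define j0 where "j0 = card {z \<in> Y0. (z, a) \<in> lt (Fmax F)}"
      define \<tau>' where "\<tau>' = strong_iso_rel k F n' `` {Y0}"
      have Y0n: "Y0 \<in> [branches Tmax]\<^bsup>n'\<^esup>" using Y0X X0n(3) finY0 by (auto simp: nsets_def n'_def)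
      have \<tau>': "\<tau>' \<in> types k F n'" unfolding types_def \<tau>'_def by (rule quotientI[OF Y0n])
      have c1: "colouring n S1 c r" by (rule colouring_mono[OF c S1(2)])
      define Req where "Req V R \<longleftrightarrow> (\<forall>W\<subseteq>V. \<forall>u\<in>W. card W = n' \<longrightarrow> (\<exists>\<epsilon>. \<forall>X. config A R u W X \<longrightarrow> c X = \<epsilon>))" for V R
      have "\<exists>S l wt. ftree S \<and> S \<subseteq> S1 \<and> strict_mono (l :: nat \<Rightarrow> nat) \<and> l 0 = 0 \<and>
        (\<forall>m. Req {s \<in> S. length s = l m} (cone S)) \<and>
        (\<forall>x\<in>branches S. \<forall>y\<in>branches S. x \<noteq> y \<longrightarrow> (\<exists>m. meet x y = wt m \<and> Suc (length (wt m)) = l (Suc m)))"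
      proof (rule fusion[OF S1(1)])
        fix V R R' assume R: "Req V R" and sub: "\<And>v. v \<in> V \<Longrightarrow> R' v \<subseteq> R v"
        show "Req V R'"
          unfolding Req_def
        proof (intro allI ballI impI)
          fix W u assume W: "W \<subseteq> V" "u \<in> W" "card W = n'"
          then obtain \<epsilon> where \<epsilon>: "\<forall>X. config A R u W X \<longrightarrow> c X = \<epsilon>" using R unfolding Req_def by blast
          have "config A R u W X" if "config A R' u W X" for X
            by (rule config_mono[OF that W(2)]) (use sub W(1) in blast)
          then show "\<exists>\<epsilon>. \<forall>X. config A R' u W X \<longrightarrow> c X = \<epsilon>" using \<epsilon> by blast
        qed
      next
        show "\<forall>V R. finite V \<and> (\<forall>v\<in>V. stem_tree S1 (R v) v) \<and> (\<forall>u\<in>V. \<forall>v\<in>V. length u = length v) \<longrightarrow>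
          (\<exists>R'. (\<forall>v\<in>V. stem_tree (R v) (R' v) v) \<and> Req V R')"
        proof (intro allI impI)
          fix V R assume V: "finite V \<and> (\<forall>v\<in>V. stem_tree S1 (R v) v) \<and> (\<forall>u\<in>V. \<forall>v\<in>V. length u = length v)"
          have "2 \<le> card (univ A)" "n' + card (univ A) = Suc n" using cA cP0 cY0 by (simp_all add: n'_def)
          then show "\<exists>R'. (\<forall>v\<in>V. stem_tree (R v) (R' v) v) \<and> Req V R'"
            unfolding Req_def using homogeneous_requirement[OF c1 A(1)] V by blast
        qed
      qed
      then obtain S2 l wt where S2: "ftree S2" "S2 \<subseteq> S1" "strict_mono (l :: nat \<Rightarrow> nat)"
        and req: "\<forall>m. Req {s \<in> S2. length s = l m} (cone S2)"
        and sp: "\<forall>x\<in>branches S2. \<forall>y\<in>branches S2. x \<noteq> y \<longrightarrow> (\<exists>m. meet x y = wt m \<and> Suc (length (wt m)) = l (Suc m))"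
        by (elim exE conjE)
      \<comment> \<open>The colour \<open>c'\<close> of \<open>Y\<close> is the one forced at the least level separating \<open>Y\<close>. The element of \<open>Y\<close>
        whose place is taken by the copy of \<open>A\<close> is recovered from its rank \<open>j0\<close>.\<close>
      define des where "des W = (SOME u. u \<in> W \<and> card {z \<in> W. (z, u) \<in> lexord less_than} = j0)" for W
      define E where "E W = (SOME \<epsilon>. \<forall>X. config A (cone S2) (des W) W X \<longrightarrow> c X = \<epsilon>)" for W
      define img where "img Y m = restrs (l m) Y" for Y m
      define lev where "lev Y = (LEAST m. card (img Y m) = n')" for Y
      define c' where "c' Y = E (img Y (lev Y)) mod r" for Y
      have cr: "c X < r" for X using c by (simp add: colouring_def)
      have r0: "0 < r" using cr[of "{}"] by simp
      have l_ge: "m \<le> l m" for m by (rule strict_mono_imp_increasing[OF S2(3)])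
      have lev: "card (img Y (lev Y)) = n'" if Y: "finite Y" "card Y = n'" for Y
      proof -
        obtain N where "\<forall>N'\<ge>N. inj_on (\<lambda>x. restr x N') Y" using restr_inj_bound[OF Y(1)] ..
        then have "inj_on (\<lambda>x. restr x (l N)) Y" using l_ge[of N] by blast
        then have "card (img Y N) = n'" using card_image Y(2) by (simp add: img_def card_image)
        then show ?thesis unfolding lev_def by (rule LeastI)
      qed
      \<comment> \<open>The restrictions of \<open>Y\<close> to level \<open>l (lev Y)\<close>
        determine those to all earlier levels, hence \<open>lev Y\<close> and the colour.\<close>
      have c'_col: "colouring n' S2 c' r"
        unfolding colouring_def
      proof (intro conjI allI ballI)
        show "c' Y < r" for Y using r0 by (simp add: c'_def)
        fix Y assume "Y \<in> [branches S2]\<^bsup>n'\<^esup>"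
        then have Y: "finite Y" "card Y = n'" by (auto simp: nsets_def)
        show "\<exists>N. \<forall>Z\<in>[branches S2]\<^bsup>n'\<^esup>. restrs N Z = restrs N Y \<longrightarrow> c' Z = c' Y"
        proof (intro exI[of _ "l (lev Y)"] ballI impI)
          fix Z assume eq: "restrs (l (lev Y)) Z = restrs (l (lev Y)) Y"
          have im: "img Z m = img Y m" if "m \<le> lev Y" for m
            unfolding img_def using restr_image_mono[OF eq] that S2(3) by (simp add: strict_mono_less_eq)
          have "lev Z = lev Y"
            unfolding lev_def[of Z]
          proof (rule Least_equality)
            show "card (img Z (lev Y)) = n'" using im[of "lev Y"] lev[OF Y] by simp
            fix m assume m: "card (img Z m) = n'"
            show "lev Y \<le> m"
            proof (rule ccontr)
              assume nm: "\<not> lev Y \<le> m"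
              then have "card (img Y m) = n'" using m im[of m] by simp
              then have "lev Y \<le> m" unfolding lev_def by (rule Least_le)
              then show False using nm by simp
            qed
          qed
          then show "c' Z = c' Y" using im[of "lev Y"] by (simp add: c'_def)
        qed
      qed
      obtain S3 i where S3: "ftree S3" "S3 \<subseteq> S2" "\<forall>X\<in>of_type S3 \<tau>'. c' X = i"
        using less.IH[OF n'n S2(1) c'_col \<tau>'] by (elim exE conjE)
      have "c X = i" if X: "X \<in> of_type S3 \<tau>" for X
      proof -
        have X\<tau>: "X \<in> \<tau>" "X \<subseteq> branches S3" using X by (auto simp: of_type_def)
        have XT: "X \<subseteq> branches Tmax" using type_members(1)[OF \<tau> X\<tau>(1)] by (auto simp: nsets_def)
        have XS2: "X \<subseteq> branches S2" using X\<tau>(2) branches_mono[OF S3(2)] by blast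
        obtain p where p: "strong_isomorphism k F p X0 X" using type_members(2)[OF \<tau> X0(1) X\<tau>(1)] ..
        note pp = strong_isomorphismD[OF p X0n(3) XT]
        have pX: "p x \<in> X" if "x \<in> X0" for x using pp(2) that by blast
        have pS: "p x \<in> branches S2" "p x \<in> branches Tmax" if "x \<in> X0" for x using pX[OF that] XS2 XT by blast+
        have pne: "p x \<noteq> p y" if "x \<in> X0" "y \<in> X0" "x \<noteq> y" for x y using pp(1) that by (auto dest: inj_onD)
        define Y where "Y = p ` Y0"
        have inY: "inj_on p Y0" using pp(1) Y0X by (rule inj_on_subset)
        have Yn: "Y \<in> [branches Tmax]\<^bsup>n'\<^esup>" "finite Y" "card Y = n'"
          using pS(2) Y0X finY0 card_image[OF inY] by (auto simp: nsets_def Y_def n'_def)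
        have "strong_isomorphism k F p Y0 Y" unfolding Y_def by (rule strong_isomorphism_subset[OF p X0n(3) XT Y0X])
        then have "(Y0, Y) \<in> strong_iso_rel k F n'" using Y0n Yn(1) unfolding strong_iso_rel_def by blast
        then have "Y \<in> \<tau>'" by (simp add: \<tau>'_def)
        moreover have "Y \<subseteq> branches S3" using pX Y0X X\<tau>(2) unfolding Y_def by blast
        ultimately have c'Y: "c' Y = i" using S3(3) by (simp add: of_type_def)
        define m where "m = lev Y"
        define W where "W = img Y m"
        have cW: "card W = n'" using lev[OF Yn(2,3)] by (simp add: W_def m_def)
        let ?r = "\<lambda>x. restr x (l m)"
        have injY: "inj_on ?r Y"
          by (rule eq_card_imp_inj_on[OF Yn(2)]) (use cW Yn(3) in \<open>simp add: W_def img_def\<close>)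
        have aY: "a \<in> Y0" by (simp add: Y0_def)
        define u where "u = ?r (p a)"
        have uW: "u \<in> W" using aY by (auto simp: u_def W_def img_def Y_def)
        \<comment> \<open>Both \<open>p\<close> and the restriction to a separating level preserve
          the order, so \<open>u\<close> has in \<open>W\<close> the rank of \<open>a\<close> in
          \<open>Y0\<close>.\<close>
        have "card {z \<in> W. (z, u) \<in> lexord less_than} = j0"
        proof -
          have inr: "inj_on (\<lambda>z. ?r (p z)) Y0"
            using comp_inj_on[OF inY, of ?r] injY by (simp add: Y_def comp_def)
          have "{z \<in> W. (z, u) \<in> lexord less_than} = (\<lambda>z. ?r (p z)) ` {z \<in> Y0. (z, a) \<in> lt (Fmax F)}"
          proof -
            have "(?r (p z), u) \<in> lexord less_than \<longleftrightarrow> (z, a) \<in> lt (Fmax F)" if z: "z \<in> Y0" for z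
            proof (cases "z = a")
              case True
              have "(s, s) \<notin> lexord less_than" for s :: "nat list" by (rule lexord_irreflexive) simp
              then show ?thesis using True lt_Fmax_irrefl by (simp add: u_def)
            next
              case False
              then have d: "?r (p z) \<noteq> ?r (p a)" using inr z aY by (auto dest: inj_onD)
              have zX: "z \<in> X0" using z Y0X by blast
              show ?thesis
                using lexord_restr_iff[OF pS(2)[OF zX] pS(2)[OF ab(1)] d] pp(3)[OF zX ab(1)] by (simp add: u_def)
            qed
            then show ?thesis unfolding W_def img_def Y_def by blast
          qed
          moreover have "inj_on (\<lambda>z. ?r (p z)) {z \<in> Y0. (z, a) \<in> lt (Fmax F)}"
            by (rule inj_on_subset[OF inr]) auto
          ultimately show ?thesis by (simp add: card_image j0_def)
        qed
        note uj = this
        have finW: "finite W" using Yn(2) by (simp add: W_def img_def)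
        have "des W \<in> W \<and> card {z \<in> W. (z, des W) \<in> lexord less_than} = j0"
          unfolding des_def by (rule someI[of _ u]) (use uW uj in simp)
        then have des: "des W = u" using lexord_less_than_rank_unique[OF finW, of "des W" u] uW uj by simp
        define w where "w = meet (p a) (p b)"
        have pab: "p a \<noteq> p b" by (rule pne[OF ab(1-3)])
        have eqlen: "length (meet (p x) (p y)) = length w" if xy: "x \<in> P0" "y \<in> P0" "x \<noteq> y" for x y
        proof -
          have X: "x \<in> X0" "y \<in> X0" using xy P0X by blast+
          have "length (meet x y) = length (meet a b)" using in_P[OF xy] by (simp add: w0_def)
          then show ?thesis using pp(5)[OF X ab(1,2) xy(3) ab(3)] pp(5)[OF ab(1,2) X ab(3) xy(3)]
            by (simp add: w_def)
        qed
        have pw: "passes (p x) w" if x: "x \<in> P0" for x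
        proof (cases "x = a")
          case True
          then show ?thesis by (simp add: w_def passes_meet)
        next
          case False
          have "length (meet (p x) (p a)) = length w" by (rule eqlen[OF x aP(1) False])
          then have "meet (p x) (p a) = w"
            using passes_same_length[OF passes_meet(2)[of "p a" "p x"], of w] passes_meet(1)[of "p a" "p b"] by (simp add: w_def)
          then show ?thesis using passes_meet(1)[of "p x" "p a"] by simp
        qed
        let ?rw = "\<lambda>x. restr x (Suc (length w))"
        have inj1: "inj_on ?rw (p ` P0)"
        proof (rule inj_onI, rule ccontr)
          fix x' y' assume xy': "x' \<in> p ` P0" "y' \<in> p ` P0" "?rw x' = ?rw y'" "x' \<noteq> y'"
          then obtain x y where xy: "x \<in> P0" "y \<in> P0" "x' = p x" "y' = p y" by blast
          then have "x \<noteq> y" using xy'(4) by blast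
          then show False using meet_length_less_iff[OF xy'(4), of "Suc (length w)"] eqlen[OF xy(1,2)] xy xy'(3) by simp
        qed
        have P0T: "P0 \<subseteq> branches Tmax" using P0X X0n(3) by blast
        have "isomorphic k (induced (F w0) (?rz ` P0)) (induced (F w) (?rw ` p ` P0))"
        proof (rule node_copy[OF P0T _ inj0 _ _ inj1 refl])
          show "\<forall>x\<in>P0. passes x w0" by (simp add: P0_def)
          show "p ` P0 \<subseteq> branches Tmax" using pS(2) P0X by blast
          show "\<forall>x\<in>p ` P0. passes x w" using pw by blast
          show "inj_on p P0" using pp(1) P0X by (rule inj_on_subset)
          show "P0 \<noteq> {}" using aP by blast
          fix x y assume "x \<in> P0" "y \<in> P0"
          then have xy: "x \<in> X0" "y \<in> X0" using P0X by blast+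
          show "(x, y) \<in> lt (Fmax F) \<longleftrightarrow> (p x, p y) \<in> lt (Fmax F)" by (rule pp(3)[OF xy])
          show "(x, y) \<in> rel (Fmax F) l \<longleftrightarrow> (p x, p y) \<in> rel (Fmax F) l" if "l < k" for l
            by (rule pp(4)[OF that xy])
        qed
        then have isoW: "isomorphic k (induced (F w) (?rw ` p ` P0)) A"
          using isoA isomorphic_sym isomorphic_trans by blast
        obtain m1 where m1: "Suc (length w) = l (Suc m1)"
          using sp pS(1)[OF ab(1)] pS(1)[OF ab(2)] pab unfolding w_def by metis
        have sm: "l i \<le> l j \<longleftrightarrow> i \<le> j" for i j by (rule strict_mono_less_eq[OF S2(3)])
        have sm': "l i < l j \<longleftrightarrow> i < j" for i j by (rule strict_mono_less[OF S2(3)])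
        \<comment> \<open>\<open>Y\<close> is separated before the splitting at \<open>w\<close>:
          its meets are strictly shorter than \<open>w\<close> by \<open>out_P\<close>, and a
          recorded level comes right after each splitting node, so the recorded level
          \<open>l m1\<close> preceding \<open>l (Suc m1) = Suc (length w)\<close> is already beyond
          all of them. Hence \<open>lev Y\<close> is at most \<open>m1\<close>, and \<open>u\<close>
          is an initial segment of \<open>w\<close>.\<close>
        have "card (img Y m1) = n'"
        proof -
          have "inj_on (\<lambda>x. restr x (l m1)) Y"
          proof (rule inj_onI, rule ccontr)
            fix y y' assume yy: "y \<in> Y" "y' \<in> Y" "restr y (l m1) = restr y' (l m1)" "y \<noteq> y'"
            then obtain z z' where z: "z \<in> Y0" "z' \<in> Y0" "y = p z" "y' = p z'" unfolding Y_def by blast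
            have zX: "z \<in> X0" "z' \<in> X0" using z Y0X by blast+
            have zne: "z \<noteq> z'" using yy(4) z by blast
            have "\<not> (z \<in> P0 \<and> z' \<in> P0)" using z(1,2) zne by (auto simp: Y0_def)
            then have "\<not> length (meet a b) \<le> length (meet z z')" using out_P[OF zX zne] ab(4) by simp
            then have lt: "length (meet y y') < length w"
              using pp(5)[OF ab(1,2) zX ab(3) zne] z by (simp add: w_def)
            have "y \<in> branches S2" "y' \<in> branches S2" using pS(1) zX z by blast+
            then obtain m2 where m2: "Suc (length (meet y y')) = l (Suc m2)" using sp yy(4) by metis
            then have "l (Suc m2) < l (Suc m1)" using lt m1 by simp
            then have "l (Suc m2) \<le> l m1" using sm sm' by (simp add: Suc_le_eq)
            then have "length (meet y y') < l m1" using m2 by simp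
            then show False using meet_length_less_iff[OF yy(4)] yy(3) by blast
          qed
          then show ?thesis using Yn(3) by (simp add: img_def card_image)
        qed
        then have "m \<le> m1" unfolding m_def lev_def by (rule Least_le)
        then have "l m < l (Suc m1)" using sm' by simp
        then have lmw: "l m \<le> length w" using m1 by simp
        have uw: "prefix u w"
        proof (rule passes_shorter)
          show "passes (p a) u" by (simp add: u_def)
          show "passes (p a) w" using pw aP by blast
          show "length u \<le> length w" using lmw by (simp add: u_def)
        qed
        define y where "y v = inv_into Y ?r v" for v
        have y1: "y v \<in> Y" "?r (y v) = v" if "v \<in> W" for v
        proof -
          have "v \<in> ?r ` Y" using that by (simp add: W_def img_def)
          then show "y v \<in> Y" "?r (y v) = v" unfolding y_def
            by (rule inv_into_into, rule f_inv_into_f)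
        qed
        have y2: "y (?r z) = z" if "z \<in> Y" for z
          using inv_into_f_f[OF injY that] by (simp add: y_def)
        have YX: "Y \<subseteq> X" using pX Y0X unfolding Y_def by blast
        have "config A (cone S2) u W X"
          unfolding config_def
        proof (intro exI[of _ w] exI[of _ "p ` P0"] exI[of _ y] conjI ballI)
          show "prefix u w" by (rule uw)
          show "p ` P0 \<subseteq> branches (cone S2 u)"
            using branches_cone passes_prefix[OF pw uw] pS(1) P0X by blast
          show "passes x w" if "x \<in> p ` P0" for x using pw that by blast
          show "inj_on ?rw (p ` P0)" by (rule inj1)
          show "isomorphic k (induced (F w) (?rw ` p ` P0)) A" by (rule isoW)
          fix v assume "v \<in> W - {u}"
          then have v: "v \<in> W" by simp
          show "y v \<in> branches (cone S2 v)"
          proof (rule branches_cone)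
            show "y v \<in> branches S2" using y1(1)[OF v] YX XS2 by blast
            show "passes (y v) v" using y1(2)[OF v] passes_restr by metis
          qed
        next
          have "y ` (W - {u}) = Y - {p a}"
          proof
            show "y ` (W - {u}) \<subseteq> Y - {p a}"
            proof
              fix z assume "z \<in> y ` (W - {u})"
              then obtain v where v: "v \<in> W" "v \<noteq> u" "z = y v" by blast
              have "z \<noteq> p a" using y1(2)[OF v(1)] v(2,3) by (auto simp: u_def)
              then show "z \<in> Y - {p a}" using y1(1)[OF v(1)] v(3) by simp
            qed
            show "Y - {p a} \<subseteq> y ` (W - {u})"
            proof
              fix z assume z: "z \<in> Y - {p a}"
              have "?r z \<in> W" using z by (auto simp: W_def img_def)
              moreover have "?r z \<noteq> u"
              proof
                assume "?r z = u"
                then have "z = p a" using injY z aY unfolding u_def by (auto simp: Y_def dest: inj_onD)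
                then show False using z by simp
              qed
              ultimately show "z \<in> y ` (W - {u})" using y2[of z] z by (metis DiffD1 DiffI imageI singletonD)
            qed
          qed
          moreover have "Y - {p a} = p ` (X0 - P0)"
          proof -
            have "p a \<notin> p ` (X0 - P0)" using pp(1) ab(1) aX by (auto dest: inj_onD)
            then show ?thesis unfolding Y_def Y0_def by auto
          qed
          ultimately show "X = p ` P0 \<union> y ` (W - {u})" using pp(2) P0X by auto
        qed
        moreover have "\<forall>X. config A (cone S2) (des W) W X \<longrightarrow> c X = E W"
          unfolding E_def
        proof (rule someI_ex)
          have "W \<subseteq> {s \<in> S2. length s = l m}"
            using YX XS2 by (auto simp: W_def img_def branches_def)
          then show "\<exists>\<epsilon>. \<forall>X. config A (cone S2) (des W) W X \<longrightarrow> c X = \<epsilon>"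
            using spec[OF req, of m] cW uW unfolding Req_def des by blast
        qed
        ultimately have "c X = E W" unfolding des by blast
        moreover have "c' Y = E W mod r" by (simp add: c'_def W_def m_def)
        \<comment> \<open>Here \<open>E W\<close> is the colour \<open>c X\<close>, which is below
          \<open>r\<close>, so the reduction modulo \<open>r\<close> in \<open>c'\<close> has no
          effect.\<close>
        ultimately have "c X = c' Y" using cr[of X] by simp
        then show ?thesis using c'Y by simp
      qed
      then show ?thesis using S3 S2(2) S1(2) by (intro exI[of _ S3] exI[of _ i]) auto
    qed
  qed
qed

end

section \<open>From the topology to finite levels\<close>

lemma open_cylinder:
  fixes U :: "(nat \<Rightarrow> nat) set"
  assumes "open U" "x \<in> U"
  shows "\<exists>N. \<forall>y. restr y N = restr x N \<longrightarrow> y \<in> U"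
proof -
  have "openin (product_topology (\<lambda>i. euclidean) UNIV) U" using assms(1) by (simp add: open_fun_def)
  from product_topology_open_contains_basis[OF this assms(2)] obtain V where V: "x \<in> (\<Pi>\<^sub>E i\<in>UNIV. V i)"
    "finite {i. V i \<noteq> (UNIV :: nat set)}" "(\<Pi>\<^sub>E i\<in>UNIV. V i) \<subseteq> U" by auto
  obtain b where b: "\<forall>i\<in>{i. V i \<noteq> (UNIV :: nat set)}. i \<le> b"
    using V(2) by (metis finite_nat_set_iff_bounded_le)
  have "y \<in> U" if "restr y (Suc b) = restr x (Suc b)" for y
  proof -
    have "y i \<in> V i" for i
    proof (cases "i \<le> b")
      case True
      then have "y i = x i" using that by (simp add: restr_eq_iff)
      then show ?thesis using V(1) by auto
    next
      case False
      then show ?thesis using b by auto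
    qed
    then show ?thesis using V(3) by auto
  qed
  then show ?thesis by blast
qed

text \<open>Cylinders given by a level separating \<open>Y\<close> are pairwise disjoint
  neighbourhoods of its elements.\<close>

lemma nsets_subset_topspace: "[branches Tmax]\<^bsup>n\<^esup> \<subseteq> topspace (nset_topology n)"
proof -
  let ?B = "[branches Tmax]\<^bsup>n\<^esup>"
  have "nset_open n ?B"
    unfolding nset_open_def
  proof (intro conjI ballI)
    fix Y assume "Y \<in> ?B"
    then have fY: "finite Y" "Y \<subseteq> branches Tmax" by (auto simp: nsets_def)
    obtain N where N: "inj_on (\<lambda>x. restr x N) Y" using restr_inj_bound[OF fY(1)] by blast
    show "\<exists>V. (\<forall>x\<in>Y. x \<in> V x \<and> openin (top_of_set (branches Tmax)) (V x)) \<and> disjoint_family_on V Y \<and>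
        (\<forall>Z\<in>?B. (\<forall>x\<in>Y. \<exists>!y. y \<in> Z \<inter> V x) \<longrightarrow> Z \<in> ?B)"
    proof (intro exI[of _ "\<lambda>x. branches Tmax \<inter> {y. \<forall>i\<in>{..<N}. y i = x i}"] conjI ballI)
      fix x assume "x \<in> Y"
      then show "x \<in> branches Tmax \<inter> {y. \<forall>i\<in>{..<N}. y i = x i}" using fY(2) by auto
      have "{y. \<forall>i\<in>{..<N}. y i = x i} = (\<Inter>i\<in>{..<N}. (\<lambda>y. y i) -` {x i})" by auto
      moreover have "open ((\<lambda>y::nat \<Rightarrow> nat. y i) -` {x i})" for i
        by (rule open_vimage) (auto intro: continuous_on_product_coordinates open_discrete)
      ultimately have "open {y :: nat \<Rightarrow> nat. \<forall>i\<in>{..<N}. y i = x i}" by (simp add: open_INT)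
      then show "openin (top_of_set (branches Tmax)) (branches Tmax \<inter> {y. \<forall>i\<in>{..<N}. y i = x i})"
        by (rule openin_open_Int)
    next
      show "disjoint_family_on (\<lambda>x. branches Tmax \<inter> {y. \<forall>i\<in>{..<N}. y i = x i}) Y"
        unfolding disjoint_family_on_def
      proof (intro ballI impI)
        fix x x' assume x: "x \<in> Y" "x' \<in> Y" "x \<noteq> x'"
        then have "restr x N \<noteq> restr x' N" using N by (auto dest: inj_onD)
        then obtain i where i: "i < N" "x i \<noteq> x' i" by (auto simp: restr_eq_iff)
        have False if "\<forall>i\<in>{..<N}. y i = x i" "\<forall>i\<in>{..<N}. y i = x' i" for y
          using i bspec[OF that(1), of i] bspec[OF that(2), of i] by simp
        then show "(branches Tmax \<inter> {y. \<forall>i\<in>{..<N}. y i = x i}) \<inter> (branches Tmax \<inter> {y. \<forall>i\<in>{..<N}. y i = x' i}) = {}"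
          by blast
      qed
    qed simp
  qed simp
  then show "?B \<subseteq> topspace (nset_topology n)"
    using openin_nset_topology[of n ?B] openin_subset by blast
qed

text \<open>At a level beyond the given neighbourhoods that also separates \<open>X\<close>,
  equality of the restrictions puts an element of \<open>Y\<close> into each neighbourhood; since
  these are disjoint, it puts only one.\<close>

lemma continuous_colouring_determined:
  assumes c: "continuous_map (subtopology (nset_topology n) D) (discrete_topology {..<2}) c"
    and X: "X \<in> D" "X \<in> [branches Tmax]\<^bsup>n\<^esup>"
  shows "\<exists>N. \<forall>N'\<ge>N. \<forall>Y\<in>D \<inter> [branches Tmax]\<^bsup>n\<^esup>.
    restrs N' Y = restrs N' X \<longrightarrow> c Y = c X"
proof -
  let ?B = "[branches Tmax]\<^bsup>n\<^esup>"
  note top = nsets_subset_topspace[of n]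
  have Xt: "X \<in> topspace (subtopology (nset_topology n) D)" using X top by auto
  then have cX: "c X \<in> {..<2}" using continuous_map_funspace[OF c] by auto
  then have "openin (subtopology (nset_topology n) D) {Y \<in> topspace (subtopology (nset_topology n) D). c Y \<in> {c X}}"
    using c by (intro openin_continuous_map_preimage[OF c]) simp
  then obtain U where U: "nset_open n U"
    "{Y \<in> topspace (subtopology (nset_topology n) D). c Y \<in> {c X}} = U \<inter> D"
    unfolding openin_subtopology openin_nset_topology by blast
  have "X \<in> U" using U(2) Xt by blast
  from nset_openE[OF U(1) this] obtain V where
    V: "\<forall>x\<in>X. x \<in> V x \<and> openin (top_of_set (branches Tmax)) (V x)" and dV: "disjoint_family_on V X"
    and VU: "\<forall>Y\<in>?B. (\<forall>x\<in>X. \<exists>!y. y \<in> Y \<inter> V x) \<longrightarrow> Y \<in> U" .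
  have finX: "finite X" "card X = n" using X(2) by (auto simp: nsets_def)
  have "\<forall>x\<in>X. \<exists>N. \<forall>y\<in>branches Tmax. restr y N = restr x N \<longrightarrow> y \<in> V x"
  proof
    fix x assume x: "x \<in> X"
    then have Vx: "x \<in> V x" "openin (top_of_set (branches Tmax)) (V x)" using V by blast+
    then obtain O' where O': "open O'" "V x = branches Tmax \<inter> O'" unfolding openin_open by blast
    then obtain N where "\<forall>y. restr y N = restr x N \<longrightarrow> y \<in> O'" using open_cylinder[of O' x] Vx(1) by blast
    then show "\<exists>N. \<forall>y\<in>branches Tmax. restr y N = restr x N \<longrightarrow> y \<in> V x" using O'(2) by blast
  qed
  from bchoice[OF this] obtain h where h: "\<forall>x\<in>X. \<forall>y\<in>branches Tmax. restr y (h x) = restr x (h x) \<longrightarrow> y \<in> V x" ..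
  obtain b where b: "\<forall>i\<in>h ` X. i \<le> b" using finX(1) by (metis finite_imageI finite_nat_set_iff_bounded_le)
  obtain N1 where N1: "\<forall>N'\<ge>N1. inj_on (\<lambda>x. restr x N') X" using restr_inj_bound[OF finX(1)] ..
  have "c Y = c X" if N: "max b N1 \<le> N" and Y: "Y \<in> D" "Y \<in> ?B"
    and eq: "restrs N Y = restrs N X" for N Y
  proof -
    have YT: "Y \<subseteq> branches Tmax" "finite Y" "card Y = n" using Y(2) by (auto simp: nsets_def)
    have injX: "inj_on (\<lambda>x. restr x N) X" using N1 N by simp
    have "card (restrs N Y) = card Y" using eq card_image[OF injX] finX(2) YT(3) by simp
    then have injY: "inj_on (\<lambda>x. restr x N) Y" by (rule eq_card_imp_inj_on[OF YT(2)])
    have cyl: "y \<in> V x" if "x \<in> X" "y \<in> Y" "restr y N = restr x N" for x y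
    proof -
      have "h x \<le> N" using b N \<open>x \<in> X\<close> by auto
      then have "restr y (h x) = restr x (h x)" using that(3) by (simp add: restr_eq_iff)
      then show ?thesis using h that(1,2) YT(1) by blast
    qed
    have "\<forall>x\<in>X. \<exists>!y. y \<in> Y \<inter> V x"
    proof
      fix x assume x: "x \<in> X"
      then have "restr x N \<in> restrs N Y" unfolding eq by blast
      then obtain y where y: "y \<in> Y" "restr y N = restr x N" by (metis imageE)
      show "\<exists>!y. y \<in> Y \<inter> V x"
      proof (rule ex1I[of _ y])
        show "y \<in> Y \<inter> V x" using cyl[OF x y] y(1) by blast
        fix z assume z: "z \<in> Y \<inter> V x"
        then have "restr z N \<in> restrs N X" unfolding eq[symmetric] by blast
        then obtain x' where x': "x' \<in> X" "restr z N = restr x' N" by (metis imageE)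
        have "z \<in> V x'" using cyl[OF x'(1) _ x'(2)] z by blast
        then have "x' = x" using dV z x x'(1) unfolding disjoint_family_on_def by blast
        then have "restr z N = restr y N" using x'(2) y(2) by simp
        then show "z = y" using injY z y(1) by (auto dest: inj_onD)
      qed
    qed
    then have "Y \<in> U" using VU Y(2) by blast
    then have "Y \<in> U \<inter> D" using Y(1) by blast
    then show ?thesis unfolding U(2)[symmetric] by simp
  qed
  then show ?thesis by (intro exI[of _ "max b N1"]) blast
qed

theorem theorem5p6:
  fixes k n :: nat
    and K :: "nat ostruct set"
    and M :: "nat ostruct"
    and F :: "nat list \<Rightarrow> nat list ostruct"
    and T :: "nat list set"
    and \<tau> :: "(nat \<Rightarrow> nat) set set"
    and c :: "(nat \<Rightarrow> nat) set \<Rightarrow> nat"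
  assumes "fraisse_class k K"
    and "ramsey_property k K"
    and "uniform_loops k K"
    and "fraisse_limit k K M"
    and "node_structures k K M F"
    and "Fmax_tree k K F T"
    and "\<tau> \<in> types k F n"
    and "continuous_map (subtopology (nset_topology n) (of_type T \<tau>))
           (discrete_topology {..<2}) c"
  shows "\<exists>S. Fmax_tree k K F S \<and> S \<subseteq> T \<and> (\<exists>i<2. \<forall>X\<in>of_type S \<tau>. c X = i)"
proof -
  interpret ramsey_class k K M F by unfold_locales (use assms in auto)
  note T = assms(6) and \<tau> = assms(7)
  have TT: "branches T \<subseteq> branches Tmax" by (rule branches_mono[OF ftree_Tmax[OF T]])
  have in2: "c X < 2" if X: "X \<in> of_type T \<tau>" for X
  proof -
    have "X \<in> topspace (subtopology (nset_topology n) (of_type T \<tau>))"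
      using X type_members(1)[OF \<tau>, of X] nsets_subset_topspace[of n] by (auto simp: of_type_def)
    then show ?thesis using continuous_map_funspace[OF assms(8)] by auto
  qed
  \<comment> \<open>Sets outside the type get a third colour. Since membership in the type is
    decided at a level separating the set, \<open>c'\<close> is locally constant on all
    \<open>n\<close>-element sets.\<close>
  define c' where "c' X = (if X \<in> of_type T \<tau> then c X else 2)" for X
  have "colouring n T c' 3"
    unfolding colouring_def
  proof (intro conjI allI ballI)
    show "c' X < 3" for X using in2[of X] by (auto simp: c'_def)
    fix X assume XB: "X \<in> [branches T]\<^bsup>n\<^esup>"
    then have X: "X \<in> [branches Tmax]\<^bsup>n\<^esup>" "finite X" "X \<subseteq> branches T" using TT by (auto simp: nsets_def)
    obtain N1 where N1: "\<forall>N'\<ge>N1. inj_on (\<lambda>x. restr x N') X" using restr_inj_bound[OF X(2)] ..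
    have iff: "Y \<in> of_type T \<tau> \<longleftrightarrow> X \<in> of_type T \<tau>" and YB: "Y \<in> [branches Tmax]\<^bsup>n\<^esup>"
      if Y: "Y \<in> [branches T]\<^bsup>n\<^esup>" and N: "N1 \<le> N" and eq: "restrs N Y = restrs N X" for Y N
    proof -
      show YB: "Y \<in> [branches Tmax]\<^bsup>n\<^esup>" using Y TT by (auto simp: nsets_def)
      have "(X, Y) \<in> strong_iso_rel k F n"
        by (rule strong_iso_of_restr[OF X(1) YB _ eq]) (use N1 N in simp)
      then have "X \<in> \<tau> \<longleftrightarrow> Y \<in> \<tau>" using type_members(3,4)[OF \<tau>] by blast
      then show "Y \<in> of_type T \<tau> \<longleftrightarrow> X \<in> of_type T \<tau>" using Y X(3) by (auto simp: of_type_def nsets_def)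
    qed
    show "\<exists>N. \<forall>Y\<in>[branches T]\<^bsup>n\<^esup>. restrs N Y = restrs N X \<longrightarrow> c' Y = c' X"
    proof (cases "X \<in> of_type T \<tau>")
      case True
      obtain N2 where N2: "\<forall>N'\<ge>N2. \<forall>Y\<in>of_type T \<tau> \<inter> [branches Tmax]\<^bsup>n\<^esup>.
        restrs N' Y = restrs N' X \<longrightarrow> c Y = c X"
        using continuous_colouring_determined[OF assms(8) True X(1)] ..
      show ?thesis
      proof (intro exI[of _ "max N1 N2"] ballI impI)
        fix Y assume Y: "Y \<in> [branches T]\<^bsup>n\<^esup>" and eq: "restrs (max N1 N2) Y = restrs (max N1 N2) X"
        have YD: "Y \<in> of_type T \<tau>" using iff[OF Y _ eq] True by simp
        have "c Y = c X"
          by (rule N2[rule_format, of "max N1 N2"]) (use YD YB[OF Y _ eq] eq in auto)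
        then show "c' Y = c' X" using YD True by (simp add: c'_def)
      qed
    next
      case False
      show ?thesis
      proof (intro exI[of _ N1] ballI impI)
        fix Y assume Y: "Y \<in> [branches T]\<^bsup>n\<^esup>" and eq: "restrs N1 Y = restrs N1 X"
        show "c' Y = c' X" using iff[OF Y order_refl eq] False by (simp add: c'_def)
      qed
    qed
  qed
  from homogeneous_subtree[OF T this \<tau>] obtain S i where S: "ftree S" "S \<subseteq> T" "\<forall>X\<in>of_type S \<tau>. c' X = i"
    by (elim exE conjE)
  have sub: "X \<in> of_type T \<tau>" if "X \<in> of_type S \<tau>" for X
    using that branches_mono[OF S(2)] by (auto simp: of_type_def)
  have cS: "c X = i" if "X \<in> of_type S \<tau>" for X
    using bspec[OF S(3) that] sub[OF that] by (simp add: c'_def)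
  show ?thesis
  \<comment> \<open>If \<open>S\<close> contains no set of the type, \<open>i\<close> need not be
    below 2 and 0 is taken instead.\<close>
  proof (cases "of_type S \<tau> = {}")
    case True
    then show ?thesis using S by (intro exI[of _ S] conjI exI[of _ 0]) simp_all
  next
    case False
    then obtain X where X: "X \<in> of_type S \<tau>" by blast
    have "i < 2" using in2[OF sub[OF X]] cS[OF X] by simp
    then show ?thesis using S cS by blast
  qed
qed

end
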